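(* Let $R=\bigoplus_{i\in\mathbb{N}_0}R_i$ be a homogeneous commutative Noetherian graded ring, let $R_+=\bigoplus_{i\ge1}R_i$, let $M$ be a $\mathbb{Z}$-graded $R$-module, and let $s$ be a fixed non-negative integer such that the modules $$\operatorname{Ext}^{s-j}_R(R/R_+,H^j_{R_+}(M)),\qquad \operatorname{Ext}^{s-j+1}_R(R/R_+,H^j_{R_+}(M)),\qquad j=0,1,\dots,s-1,$$ are asymptotically zero. Then the following statements hold. (i) $\operatorname{Ext}^s_R(R/R_+,M)$ has the property of asymptotic stability of associated primes if and only if $\operatorname{Hom}_R(R/R_+,H^s_{R_+}(M))$ has the property of asymptotic stability of associated primes. (ii) $\operatorname{Ext}^s_R(R/R_+,M)$ has the property of asymptotic stability of supports if and only if $\operatorname{Hom}_R(R/R_+,H^s_{R_+}(M))$ has the property of asymptotic stability of supports. (iii) $\operatorname{Ext}^s_R(R/R_+,M)$ is tame if and only if $\operatorname{Hom}_R(R/R_+,H^s_{R_+}(M))$ is tame.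
   Context: Homogeneous means $R=R_0[R_1]$. $M$ is not assumed finitely generated. $H^j_{R_+}(M)$ is the $j$th local cohomology module of $M$ with respect to $R_+$; it and the modules $\operatorname{Ext}^i_R(R/R_+,-)$, $\operatorname{Hom}_R(R/R_+,-)$ applied to graded modules carry their natural $\mathbb{Z}$-gradings. For a $\mathbb{Z}$-graded $R$-module $X=\bigoplus_n X_n$: $X$ is asymptotically zero if $X_n=0$ for all $n\ll0$ (e.g. every finitely generated graded $R$-module is asymptotically zero); $X$ has the property of asymptotic stability of associated primes if there is an integer $n_0$ with $\operatorname{Ass}_{R_0}(X_n)=\operatorname{Ass}_{R_0}(X_{n_0})$ for all $n\le n_0$; $X$ has the property of asymptotic stability of supports if there is an integer $n_0$ with $\operatorname{Supp}_{R_0}(X_n)=\operatorname{Supp}_{R_0}(X_{n_0})$ for all $n\le n_0$; $X$ is tame if either $X_n=0$ for all $n\ll0$, or $X_n\neq0$ for all $n\ll0$. *)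

theory Defs
  imports "HOL-Algebra.Module" "HOL-Algebra.Ring_Divisibility" "HOL-Algebra.Ideal_Product"
    "HOL-Algebra.Generated_Rings"
begin

section \<open>Graded rings and graded modules\<close>

record 'a gring = "'a ring" +
  rgr :: "nat \<Rightarrow> 'a set"

record ('a, 'm) gmodule = "('a, 'm) module" +
  gr :: "int \<Rightarrow> 'm set"

definition internal_direct_sum :: "('m, 'z) ring_scheme \<Rightarrow> ('i \<Rightarrow> 'm set) \<Rightarrow> bool" where
  "internal_direct_sum G C \<longleftrightarrow>
     (\<forall>i. additive_subgroup (C i) G) \<and>
     (\<forall>x\<in>carrier G. \<exists>!c. (\<forall>i. c i \<in> C i) \<and> finite {i. c i \<noteq> \<zero>\<^bsub>G\<^esub>} \<and>
         x = (\<Oplus>\<^bsub>G\<^esub>i\<in>{i. c i \<noteq> \<zero>\<^bsub>G\<^esub>}. c i))"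

definition graded_ring :: "'a gring \<Rightarrow> bool" where
  "graded_ring R \<longleftrightarrow> cring R \<and> internal_direct_sum R (rgr R) \<and>
     (\<forall>i j. \<forall>a\<in>rgr R i. \<forall>b\<in>rgr R j. a \<otimes>\<^bsub>R\<^esub> b \<in> rgr R (i + j))"

definition homogeneous_ring :: "'a gring \<Rightarrow> bool" where
  "homogeneous_ring R \<longleftrightarrow> graded_ring R \<and> carrier R = generate_ring R (rgr R 0 \<union> rgr R 1)"

definition deg0_ring :: "'a gring \<Rightarrow> 'a gring" where
  "deg0_ring R = R\<lparr>carrier := rgr R 0\<rparr>"

definition irrelevant_ideal :: "'a gring \<Rightarrow> 'a set" where
  "irrelevant_ideal R =
     {\<Oplus>\<^bsub>R\<^esub>i\<in>F. c i | F c. finite F \<and> (\<forall>i\<in>F. 1 \<le> i \<and> c i \<in> rgr R i)}"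

definition graded_module :: "'a gring \<Rightarrow> ('a, 'm) gmodule \<Rightarrow> bool" where
  "graded_module R M \<longleftrightarrow> module R M \<and> internal_direct_sum M (gr M) \<and>
     (\<forall>i n. \<forall>a\<in>rgr R i. \<forall>x\<in>gr M n. a \<odot>\<^bsub>M\<^esub> x \<in> gr M (int i + n))"

text \<open>The component \<open>X\<^sub>n\<close>, regarded as a module over \<open>R\<^sub>0\<close>.\<close>

definition gr_part :: "('a, 'm) gmodule \<Rightarrow> int \<Rightarrow> ('a, 'm) gmodule" where
  "gr_part X n = X\<lparr>carrier := gr X n\<rparr>"

definition regular_gmodule :: "'a gring \<Rightarrow> ('a, 'a) gmodule" where
  "regular_gmodule R =
     \<lparr>carrier = carrier R, mult = mult R, one = one R, zero = zero R, add = add R,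
      smult = mult R, gr = (\<lambda>n. if n < 0 then {\<zero>\<^bsub>R\<^esub>} else rgr R (nat n))\<rparr>"

definition sub_gmodule :: "('a, 'm) gmodule \<Rightarrow> 'm set \<Rightarrow> ('a, 'm) gmodule" where
  "sub_gmodule M N = M\<lparr>carrier := N, gr := (\<lambda>n. gr M n \<inter> N)\<rparr>"

text \<open>Module records extend ring records, so they have fields \<^const>\<open>mult\<close> and \<^const>\<open>one\<close>;
  these play no role for modules and are left unspecified.\<close>

definition quot_gmodule :: "('a, 'm) gmodule \<Rightarrow> 'm set \<Rightarrow> ('a, 'm set) gmodule" where
  "quot_gmodule M N =
     \<lparr>carrier = a_rcosets\<^bsub>M\<^esub> N, mult = undefined, one = undefined, zero = N, add = set_add M,
      smult = (\<lambda>a C. \<Union>x\<in>C. N +>\<^bsub>M\<^esub> (a \<odot>\<^bsub>M\<^esub> x)),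
      gr = (\<lambda>n. {N +>\<^bsub>M\<^esub> x | x. x \<in> gr M n})\<rparr>"

definition lin_maps :: "'a gring \<Rightarrow> ('a, 'm) gmodule \<Rightarrow> ('a, 'n) gmodule \<Rightarrow> ('m \<Rightarrow> 'n) set" where
  "lin_maps R A B =
     {f \<in> carrier A \<rightarrow> carrier B.
        (\<forall>x\<in>carrier A. \<forall>y\<in>carrier A. f (x \<oplus>\<^bsub>A\<^esub> y) = f x \<oplus>\<^bsub>B\<^esub> f y) \<and>
        (\<forall>a\<in>carrier R. \<forall>x\<in>carrier A. f (a \<odot>\<^bsub>A\<^esub> x) = a \<odot>\<^bsub>B\<^esub> f x)}"

definition lin_maps_deg ::
    "'a gring \<Rightarrow> ('a, 'm) gmodule \<Rightarrow> ('a, 'n) gmodule \<Rightarrow> int \<Rightarrow> ('m \<Rightarrow> 'n) set" where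
  "lin_maps_deg R A B n =
     {f \<in> lin_maps R A B. \<forall>k. \<forall>x\<in>gr A k. f x \<in> gr B (k + n)}"

definition ker_of :: "('a, 'm) gmodule \<Rightarrow> ('a, 'n) gmodule \<Rightarrow> ('m \<Rightarrow> 'n) \<Rightarrow> 'm set" where
  "ker_of A B f = {x \<in> carrier A. f x = \<zero>\<^bsub>B\<^esub>}"

text \<open>All \<open>R\<close>-linear maps, graded by the homogeneous maps of degree \<open>n\<close>. This is a grading of the
  full module of homomorphisms whenever \<open>A\<close> is finitely generated, the only case used below.\<close>

definition hom_gmodule ::
    "'a gring \<Rightarrow> ('a, 'm) gmodule \<Rightarrow> ('a, 'n) gmodule \<Rightarrow> ('a, 'm \<Rightarrow> 'n) gmodule" where
  "hom_gmodule R A B =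
     \<lparr>carrier = lin_maps R A B \<inter> extensional (carrier A), mult = undefined, one = undefined,
      zero = (\<lambda>x\<in>carrier A. \<zero>\<^bsub>B\<^esub>), add = (\<lambda>f g. \<lambda>x\<in>carrier A. f x \<oplus>\<^bsub>B\<^esub> g x),
      smult = (\<lambda>a f. \<lambda>x\<in>carrier A. a \<odot>\<^bsub>B\<^esub> f x),
      gr = (\<lambda>n. lin_maps_deg R A B n \<inter> extensional (carrier A))\<rparr>"

section \<open>Ext\<close>

definition cohomology ::
    "(nat \<Rightarrow> ('a, 'm) gmodule) \<Rightarrow> (nat \<Rightarrow> 'm \<Rightarrow> 'm) \<Rightarrow> nat \<Rightarrow> ('a, 'm set) gmodule" where
  "cohomology C d i =
     quot_gmodule (sub_gmodule (C i) (ker_of (C i) (C (Suc i)) (d i)))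
       (case i of 0 \<Rightarrow> {\<zero>\<^bsub>C 0\<^esub>} | Suc k \<Rightarrow> d k ` carrier (C k))"

text \<open>Graded free modules with a finite basis \<open>B\<close> of homogeneous elements.\<close>

definition fin_graded_free :: "'a gring \<Rightarrow> ('a, 'm) gmodule \<Rightarrow> bool" where
  "fin_graded_free R F \<longleftrightarrow> graded_module R F \<and>
     (\<exists>B. finite B \<and> B \<subseteq> (\<Union>n. gr F n) \<and>
        (\<forall>x\<in>carrier F. \<exists>!c. c \<in> B \<rightarrow>\<^sub>E carrier R \<and> x = (\<Oplus>\<^bsub>F\<^esub>b\<in>B. c b \<odot>\<^bsub>F\<^esub> b)))"

definition graded_free_resolution ::
    "'a gring \<Rightarrow> ('a, 'n) gmodule \<Rightarrow> (nat \<Rightarrow> ('a, 'p) gmodule) \<Rightarrow> (nat \<Rightarrow> 'p \<Rightarrow> 'p) \<Rightarrow> ('p \<Rightarrow> 'n) \<Rightarrow> bool"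
  where
  "graded_free_resolution R A P d \<epsilon> \<longleftrightarrow>
     (\<forall>i. fin_graded_free R (P i)) \<and>
     (\<forall>i. d i \<in> lin_maps_deg R (P (Suc i)) (P i) 0) \<and>
     \<epsilon> \<in> lin_maps_deg R (P 0) A 0 \<and> \<epsilon> ` carrier (P 0) = carrier A \<and>
     ker_of (P 0) A \<epsilon> = d 0 ` carrier (P 1) \<and>
     (\<forall>i. ker_of (P (Suc i)) (P i) (d i) = d (Suc i) ` carrier (P (Suc (Suc i))))"

text \<open>\<open>Ext\<^sup>i\<^sub>R(A, X)\<close> with its natural grading, computed from a graded free resolution
  \<open>(P, d)\<close> of \<open>A\<close> by modules of finite rank.\<close>

definition Ext_gmodule ::
    "'a gring \<Rightarrow> (nat \<Rightarrow> ('a, 'p) gmodule) \<Rightarrow> (nat \<Rightarrow> 'p \<Rightarrow> 'p) \<Rightarrow> nat \<Rightarrow> ('a, 'm) gmodule \<Rightarrow>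
      ('a, ('p \<Rightarrow> 'm) set) gmodule" where
  "Ext_gmodule R P d i X =
     cohomology (\<lambda>k. hom_gmodule R (P k) X) (\<lambda>k f. \<lambda>x\<in>carrier (P (Suc k)). f (d k x)) i"

section \<open>Local cohomology\<close>

text \<open>Injective objects of the category of graded \<open>R\<close>-modules and degree-preserving maps
  (``*injective'' modules). HOL cannot quantify over types here; the test monomorphisms
  \<open>A \<rightarrow> B\<close> range over the graded modules carried by the type of \<open>R\<close>. As these
  include the inclusions \<open>J(n) \<subseteq> R(n)\<close> of shifted homogeneous ideals, the graded form of Baer's
  criterion shows that \<open>E\<close> is then injective with respect to all graded modules.\<close>

definition graded_injective :: "'a gring \<Rightarrow> ('a, 'e) gmodule \<Rightarrow> bool" where
  "graded_injective R E \<longleftrightarrow> graded_module R E \<and>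
     (\<forall>(A :: ('a, 'a) gmodule) (B :: ('a, 'a) gmodule) h f.
        graded_module R A \<and> graded_module R B \<and>
        h \<in> lin_maps_deg R A B 0 \<and> inj_on h (carrier A) \<and> f \<in> lin_maps_deg R A E 0 \<longrightarrow>
        (\<exists>g \<in> lin_maps_deg R B E 0. \<forall>x\<in>carrier A. g (h x) = f x))"

definition graded_injective_resolution ::
    "'a gring \<Rightarrow> ('a, 'm) gmodule \<Rightarrow> (nat \<Rightarrow> ('a, 'e) gmodule) \<Rightarrow> (nat \<Rightarrow> 'e \<Rightarrow> 'e) \<Rightarrow> ('m \<Rightarrow> 'e) \<Rightarrow> bool"
  where
  "graded_injective_resolution R M E \<delta> \<iota> \<longleftrightarrow>
     (\<forall>i. graded_injective R (E i)) \<and>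
     (\<forall>i. \<delta> i \<in> lin_maps_deg R (E i) (E (Suc i)) 0) \<and>
     \<iota> \<in> lin_maps_deg R M (E 0) 0 \<and> inj_on \<iota> (carrier M) \<and>
     ker_of (E 0) (E 1) (\<delta> 0) = \<iota> ` carrier M \<and>
     (\<forall>i. ker_of (E (Suc i)) (E (Suc (Suc i))) (\<delta> (Suc i)) = \<delta> i ` carrier (E i))"

text \<open>The ideal power is taken in the multiplicative monoid \<^const>\<open>ideals_set\<close> of ideals.\<close>

definition torsion_gmodule :: "'a gring \<Rightarrow> 'a set \<Rightarrow> ('a, 'm) gmodule \<Rightarrow> ('a, 'm) gmodule" where
  "torsion_gmodule R I M =
     sub_gmodule M {x \<in> carrier M. \<exists>n::nat. \<forall>a \<in> I [^]\<^bsub>ideals_set R\<^esub> n. a \<odot>\<^bsub>M\<^esub> x = \<zero>\<^bsub>M\<^esub>}"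

text \<open>\<open>H\<^sup>j\<^sub>I(M)\<close> with its natural grading: the right derived functors of the \<open>I\<close>-torsion functor on
  graded modules, computed from a graded injective resolution \<open>(E, \<delta>)\<close> of \<open>M\<close>.\<close>

definition local_cohomology ::
    "'a gring \<Rightarrow> 'a set \<Rightarrow> (nat \<Rightarrow> ('a, 'e) gmodule) \<Rightarrow> (nat \<Rightarrow> 'e \<Rightarrow> 'e) \<Rightarrow> nat \<Rightarrow>
      ('a, 'e set) gmodule" where
  "local_cohomology R I E \<delta> j = cohomology (\<lambda>i. torsion_gmodule R I (E i)) \<delta> j"

section \<open>Associated primes, supports and asymptotic behaviour\<close>

definition Ass :: "'a gring \<Rightarrow> ('a, 'm) gmodule \<Rightarrow> 'a set set" where
  "Ass A X = {p. primeideal p A \<and> (\<exists>x\<in>carrier X. p = {a \<in> carrier A. a \<odot>\<^bsub>X\<^esub> x = \<zero>\<^bsub>X\<^esub>})}"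

definition loc_rel ::
    "'a gring \<Rightarrow> ('a, 'm) gmodule \<Rightarrow> 'a set \<Rightarrow> (('m \<times> 'a) \<times> ('m \<times> 'a)) set" where
  "loc_rel A X p =
     {((x, s), (y, t)). x \<in> carrier X \<and> y \<in> carrier X \<and> s \<in> carrier A - p \<and> t \<in> carrier A - p \<and>
        (\<exists>u \<in> carrier A - p. u \<odot>\<^bsub>X\<^esub> (t \<odot>\<^bsub>X\<^esub> x) = u \<odot>\<^bsub>X\<^esub> (s \<odot>\<^bsub>X\<^esub> y))}"

text \<open>The underlying set of the localization \<open>X\<^sub>p\<close>; the class of \<open>(x, s)\<close> is the fraction \<open>x/s\<close>.\<close>

definition localization :: "'a gring \<Rightarrow> ('a, 'm) gmodule \<Rightarrow> 'a set \<Rightarrow> ('m \<times> 'a) set set" where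
  "localization A X p = (carrier X \<times> (carrier A - p)) // loc_rel A X p"

definition Supp :: "'a gring \<Rightarrow> ('a, 'm) gmodule \<Rightarrow> 'a set set" where
  "Supp A X = {p. primeideal p A \<and> localization A X p \<noteq> {loc_rel A X p `` {(\<zero>\<^bsub>X\<^esub>, \<one>\<^bsub>A\<^esub>)}}}"

definition asymptotically_zero :: "('a, 'm) gmodule \<Rightarrow> bool" where
  "asymptotically_zero X \<longleftrightarrow> (\<exists>n0. \<forall>n\<le>n0. gr X n = {\<zero>\<^bsub>X\<^esub>})"

definition asymptotic_stability_Ass :: "'a gring \<Rightarrow> ('a, 'm) gmodule \<Rightarrow> bool" where
  "asymptotic_stability_Ass R X \<longleftrightarrow>
     (\<exists>n0. \<forall>n\<le>n0. Ass (deg0_ring R) (gr_part X n) = Ass (deg0_ring R) (gr_part X n0))"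

definition asymptotic_stability_Supp :: "'a gring \<Rightarrow> ('a, 'm) gmodule \<Rightarrow> bool" where
  "asymptotic_stability_Supp R X \<longleftrightarrow>
     (\<exists>n0. \<forall>n\<le>n0. Supp (deg0_ring R) (gr_part X n) = Supp (deg0_ring R) (gr_part X n0))"

definition tame :: "('a, 'm) gmodule \<Rightarrow> bool" where
  "tame X \<longleftrightarrow>
     (\<exists>n0. \<forall>n\<le>n0. gr X n = {\<zero>\<^bsub>X\<^esub>}) \<or> (\<exists>n0. \<forall>n\<le>n0. gr X n \<noteq> {\<zero>\<^bsub>X\<^esub>})"

end

theory Submission
  imports Defs
begin

text \<open>Let \<open>T\<^sup>j\<close> be the \<open>R\<^sub>+\<close>-torsion of \<open>E\<^sup>j\<close>, and let \<open>Z\<^sup>j\<close>, \<open>B\<^sup>j\<close> be the cocycles and coboundaries of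
  the complex \<open>T\<close>, so that \<open>H\<^sup>j = Z\<^sup>j / B\<^sup>j\<close>. The modules \<open>T\<^sup>j\<close> satisfy the graded Baer criterion, hence
  \<open>Ext\<^sup>i(R/R\<^sub>+, T\<^sup>j) = 0\<close> for \<open>i > 0\<close>. In a fixed sufficiently small degree the hypotheses give, by
  induction on \<open>j\<close> along \<open>0 \<rightarrow> B\<^sup>j \<rightarrow> Z\<^sup>j \<rightarrow> H\<^sup>j \<rightarrow> 0\<close> and \<open>0 \<rightarrow> Z\<^sup>j \<rightarrow> T\<^sup>j \<rightarrow> B\<^sup>j\<^sup>+\<^sup>1 \<rightarrow> 0\<close>, that \<open>Ext\<^sup>1(R/R\<^sub>+, B\<^sup>s)\<close> and
  \<open>Ext\<^sup>1(R/R\<^sub>+, Z\<^sup>s\<^sup>-\<^sup>1)\<close> vanish. Therefore \<open>Hom(R/R\<^sub>+, H\<^sup>s)\<close> is the quotient of \<open>Hom(R/R\<^sub>+, Z\<^sup>s)\<close> by the image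
  of \<open>Hom(R/R\<^sub>+, T\<^sup>s\<^sup>-\<^sup>1)\<close>. Homomorphisms from \<open>R/R\<^sub>+\<close> do not distinguish \<open>T\<close> from \<open>E\<close>, so dimension
  shifting along \<open>E\<close> identifies this quotient with \<open>Ext\<^sup>s(R/R\<^sub>+, M)\<close>. Associated primes, supports and
  vanishing of an \<open>R\<^sub>0\<close>-module depend only on the set of annihilators of its elements, so only these
  sets are compared and no isomorphism has to be constructed.\<close>

section \<open>Internal direct sums\<close>

text \<open>The hypotheses come from the spectral sequence with second page
  \<open>Ext^p(R/R_+, H^q)\<close> and limit \<open>Ext^(p+q)(R/R_+, M)\<close>. For
  \<open>j < s\<close>, the modules \<open>Ext^(s-j)(R/R_+, H^j)\<close> are the other terms on the
  diagonal of \<open>Hom(R/R_+, H^s)\<close>, and the modules \<open>Ext^(s-j+1)(R/R_+, H^j)\<close>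
  are the possible targets of the differentials that leave it. In a degree where all of them vanish,
  the edge map from \<open>Ext^s(R/R_+, M)\<close> to \<open>Hom(R/R_+, H^s)\<close> is bijective;
  the proof makes this comparison by hand along short exact sequences. Two obstacles shape it. The
  hypotheses give vanishing in single degrees, so every argument runs inside one degree
  \<open>n\<close>, and homogeneous maps are obtained by building a plain linear map first and
  cutting out its part of degree \<open>n\<close> afterwards. Moreover, the Baer property of torsion
  modules has to be proved in graded form; this is where chains of ideals in the Noetherian ring are
  used.\<close>

definition hcomp :: "('m, 'z) ring_scheme \<Rightarrow> ('i \<Rightarrow> 'm set) \<Rightarrow> 'i \<Rightarrow> 'm \<Rightarrow> 'm" where
  "hcomp G C i x = (THE c. (\<forall>i. c i \<in> C i) \<and> finite {i. c i \<noteq> \<zero>\<^bsub>G\<^esub>} \<and>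
     x = (\<Oplus>\<^bsub>G\<^esub>i\<in>{i. c i \<noteq> \<zero>\<^bsub>G\<^esub>}. c i)) i"

locale direct_sum = abelian_group G for G (structure) +
  fixes C
  assumes direct_sum: "internal_direct_sum G C"
begin

lemma component_subgroup: "additive_subgroup (C i) G"
  using direct_sum by (auto simp: internal_direct_sum_def)

lemma component_closed [simp]: "x \<in> C i \<Longrightarrow> x \<in> carrier G"
  using additive_subgroup.a_Hcarr[OF component_subgroup] .

lemma component_zero [simp]: "\<zero> \<in> C i"
  using additive_subgroup.zero_closed[OF component_subgroup] .

lemma component_add: "x \<in> C i \<Longrightarrow> y \<in> C i \<Longrightarrow> x \<oplus> y \<in> C i"
  using additive_subgroup.a_closed[OF component_subgroup] .

lemma component_minus: "x \<in> C i \<Longrightarrow> \<ominus> x \<in> C i"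
  using additive_subgroup.a_inv_closed[OF component_subgroup] .

lemma hcomp_props:
  assumes "x \<in> carrier G"
  shows "hcomp G C i x \<in> C i" "finite {i. hcomp G C i x \<noteq> \<zero>}"
    "x = (\<Oplus>i\<in>{i. hcomp G C i x \<noteq> \<zero>}. hcomp G C i x)"
proof -
  have "\<exists>!c. (\<forall>i. c i \<in> C i) \<and> finite {i. c i \<noteq> \<zero>} \<and> x = (\<Oplus>i\<in>{i. c i \<noteq> \<zero>}. c i)"
    using direct_sum assms by (auto simp: internal_direct_sum_def)
  from theI'[OF this]
  show "hcomp G C i x \<in> C i" "finite {i. hcomp G C i x \<noteq> \<zero>}"
    "x = (\<Oplus>i\<in>{i. hcomp G C i x \<noteq> \<zero>}. hcomp G C i x)"
    by (simp_all add: hcomp_def)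
qed

lemma hcomp_closed [simp]: "x \<in> carrier G \<Longrightarrow> hcomp G C i x \<in> carrier G"
  using hcomp_props(1) component_closed by blast

text \<open>\<open>F\<close> may be larger than the support of \<open>c\<close>, the extra summands
  being zero. This freedom lets two families be summed over a common index set.\<close>

lemma hcomp_eqI:
  assumes "\<And>i. c i \<in> C i" "finite F" "\<And>i. i \<notin> F \<Longrightarrow> c i = \<zero>" "x = (\<Oplus>i\<in>F. c i)"
  shows "hcomp G C i x = c i"
proof -
  have c: "c \<in> F \<rightarrow> carrier G" using component_closed[OF assms(1)] by auto
  have sub: "{i. c i \<noteq> \<zero>} \<subseteq> F" using assms(3) by auto
  have "(\<Oplus>i\<in>{i. c i \<noteq> \<zero>}. c i) = (\<Oplus>i\<in>F. c i)"
    by (rule add.finprod_mono_neutral_cong_left[OF assms(2) sub]) (use c in auto)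
  then have x: "x = (\<Oplus>i\<in>{i. c i \<noteq> \<zero>}. c i)" using assms(4) by simp
  have xc: "x \<in> carrier G" using assms(4) c finsum_closed by metis
  have fin: "finite {i. c i \<noteq> \<zero>}" using sub assms(2) finite_subset by blast
  have u: "\<exists>!c. (\<forall>i. c i \<in> C i) \<and> finite {i. c i \<noteq> \<zero>} \<and> x = (\<Oplus>i\<in>{i. c i \<noteq> \<zero>}. c i)"
    using direct_sum xc by (auto simp: internal_direct_sum_def)
  have "(THE c. (\<forall>i. c i \<in> C i) \<and> finite {i. c i \<noteq> \<zero>} \<and> x = (\<Oplus>i\<in>{i. c i \<noteq> \<zero>}. c i)) = c"
    by (rule the1_equality[OF u]) (use assms(1) fin x in blast)
  then show ?thesis unfolding hcomp_def by simp
qed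

lemma hcomp_add:
  assumes x: "x \<in> carrier G" and y: "y \<in> carrier G"
  shows "hcomp G C i (x \<oplus> y) = hcomp G C i x \<oplus> hcomp G C i y"
proof (rule hcomp_eqI[where c = "\<lambda>i. hcomp G C i x \<oplus> hcomp G C i y"
        and F = "{i. hcomp G C i x \<noteq> \<zero>} \<union> {i. hcomp G C i y \<noteq> \<zero>}"])
  let ?F = "{i. hcomp G C i x \<noteq> \<zero>} \<union> {i. hcomp G C i y \<noteq> \<zero>}"
  have fin: "finite ?F" using hcomp_props(2) x y by auto
  have "x = (\<Oplus>i\<in>?F. hcomp G C i x)"
    by (subst hcomp_props(3)[OF x], rule add.finprod_mono_neutral_cong_left[OF fin]) (use x in auto)
  moreover have "y = (\<Oplus>i\<in>?F. hcomp G C i y)"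
    by (subst hcomp_props(3)[OF y], rule add.finprod_mono_neutral_cong_left[OF fin]) (use y in auto)
  ultimately show "x \<oplus> y = (\<Oplus>i\<in>?F. hcomp G C i x \<oplus> hcomp G C i y)"
    using x y by (subst finsum_addf) auto
qed (use x y hcomp_props component_add in auto)

lemma hcomp_component:
  assumes "x \<in> C j"
  shows "hcomp G C i x = (if i = j then x else \<zero>)"
  by (rule hcomp_eqI[where F = "{j}"]) (use assms in \<open>auto simp: finsum_insert\<close>)

lemma hcomp_same [simp]: "x \<in> C i \<Longrightarrow> hcomp G C i x = x"
  by (simp add: hcomp_component)

lemma hcomp_zero [simp]: "hcomp G C i \<zero> = \<zero>"
  using hcomp_component[OF component_zero] by simp

text \<open>Every element is a finite sum of homogeneous ones, so a property that survives addition
  needs checking in single degrees only. Most identities about components below are proved this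
  way.\<close>

lemma homogeneous_induct [consumes 1, case_names homogeneous add]:
  assumes x: "x \<in> carrier G"
    and h: "\<And>i x. x \<in> C i \<Longrightarrow> Q x"
    and a: "\<And>x y. x \<in> carrier G \<Longrightarrow> y \<in> carrier G \<Longrightarrow> Q x \<Longrightarrow> Q y \<Longrightarrow> Q (x \<oplus> y)"
  shows "Q x"
proof -
  have "Q (\<Oplus>i\<in>F. hcomp G C i x) " if "finite F" for F
    using that
  proof induct
    case empty
    then show ?case using h[OF component_zero] by simp
  next
    case (insert j F)
    have "Q (hcomp G C j x \<oplus> (\<Oplus>i\<in>F. hcomp G C i x))"
      by (rule a) (use x insert h[OF hcomp_props(1)[OF x]] in auto)
    then show ?case using insert x by (simp add: finsum_insert)
  qed
  from this[OF hcomp_props(2)[OF x]] show ?thesis using hcomp_props(3)[OF x] by simp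
qed

lemma hcomp_all_zero: "x \<in> carrier G \<Longrightarrow> (\<And>i. hcomp G C i x = \<zero>) \<Longrightarrow> x = \<zero>"
  using hcomp_props(3)[of x] by simp

lemma hcomp_unique:
  assumes "\<And>x y. x \<in> carrier G \<Longrightarrow> y \<in> carrier G \<Longrightarrow> \<pi> (x \<oplus> y) = \<pi> x \<oplus> \<pi> y"
    and "\<And>j x. x \<in> C j \<Longrightarrow> \<pi> x = (if i = j then x else \<zero>)"
    and "x \<in> carrier G"
  shows "hcomp G C i x = \<pi> x"
  using assms(3)
  by (induct rule: homogeneous_induct) (auto simp: hcomp_add assms hcomp_component)

end

text \<open>The projections \<open>\<pi>\<close> replace unique decompositions. Applied to a finite
  sum with one summand in each \<open>C i\<close>, \<open>\<pi> j\<close> returns the summand of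
  index \<open>j\<close>, which gives uniqueness; for existence, \<open>inj\<close> is applied to
  the difference of \<open>x\<close> and the sum of its projections.\<close>

lemma (in abelian_group) internal_direct_sumI:
  assumes sub: "\<And>i. additive_subgroup (C i) G"
    and pi: "\<And>i x. x \<in> carrier G \<Longrightarrow> \<pi> i x \<in> C i"
    and fin: "\<And>x. x \<in> carrier G \<Longrightarrow> finite {i. \<pi> i x \<noteq> \<zero>}"
    and add: "\<And>i x y. x \<in> carrier G \<Longrightarrow> y \<in> carrier G \<Longrightarrow> \<pi> i (x \<oplus> y) = \<pi> i x \<oplus> \<pi> i y"
    and same: "\<And>i x. x \<in> C i \<Longrightarrow> \<pi> i x = x"
    and diff: "\<And>i j x. x \<in> C i \<Longrightarrow> i \<noteq> j \<Longrightarrow> \<pi> j x = \<zero>"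
    and inj: "\<And>x. x \<in> carrier G \<Longrightarrow> (\<And>i. \<pi> i x = \<zero>) \<Longrightarrow> x = \<zero>"
  shows "internal_direct_sum G C"
proof -
  have Cc: "x \<in> carrier G" if "x \<in> C i" for i x
    using additive_subgroup.a_Hcarr[OF sub that] .
  have zero: "\<zero> \<in> C i" for i by (rule additive_subgroup.zero_closed[OF sub])
  have pisum: "\<pi> j (\<Oplus>i\<in>F. c i) = (if j \<in> F then c j else \<zero>)"
    if "finite F" "\<And>i. c i \<in> C i" for F j c
    using that(1)
  proof induct
    case empty
    show ?case using same[OF zero] by simp
  next
    case (insert k F)
    have "\<pi> j (\<Oplus>i\<in>insert k F. c i) = \<pi> j (c k) \<oplus> \<pi> j (\<Oplus>i\<in>F. c i)"
      using insert Cc[OF that(2)] by (subst finsum_insert) (auto simp: add Pi_def)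
    then show ?case using insert Cc[OF that(2)] same[OF that(2)] diff[OF that(2), of k j]
      by (cases "k = j") auto
  qed
  have "\<exists>!c. (\<forall>i. c i \<in> C i) \<and> finite {i. c i \<noteq> \<zero>} \<and> x = (\<Oplus>i\<in>{i. c i \<noteq> \<zero>}. c i)"
    if x: "x \<in> carrier G" for x
  proof (rule ex1I[where a = "\<lambda>i. \<pi> i x"], intro conjI allI)
    let ?y = "\<Oplus>i\<in>{i. \<pi> i x \<noteq> \<zero>}. \<pi> i x"
    have y: "?y \<in> carrier G" using Cc[OF pi[OF x]] by (intro finsum_closed) auto
    have "\<pi> j (x \<oplus> \<ominus> ?y) = \<zero>" for j
    proof -
      have "\<pi> j ?y = \<pi> j x" using pisum[OF fin[OF x] pi[OF x]] by auto
      \<comment> \<open>Additivity is assumed for sums only; the value at the negative of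
        \<open>?y\<close> is recovered from the sum \<open>\<ominus> ?y \<oplus> ?y\<close>, which
        is zero.\<close>
      moreover have "\<pi> j (\<ominus> ?y) \<oplus> \<pi> j ?y = \<pi> j (\<ominus> ?y \<oplus> ?y)" using y by (simp add: add)
      moreover have "\<pi> j \<zero> = \<zero>" using same[OF zero] .
      ultimately have "\<pi> j (\<ominus> ?y) \<oplus> \<pi> j x = \<zero>" using y by (simp add: l_neg)
      then show ?thesis using x y Cc[OF pi] by (simp add: add a_comm)
    qed
    then have "x \<oplus> \<ominus> ?y = \<zero>" using inj x y by simp
    then show "x = ?y" using minus_equality[of x "\<ominus> ?y"] x y by simp
  next
    fix c assume c: "(\<forall>i. c i \<in> C i) \<and> finite {i. c i \<noteq> \<zero>} \<and> x = (\<Oplus>i\<in>{i. c i \<noteq> \<zero>}. c i)"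
    show "c = (\<lambda>i. \<pi> i x)"
    proof
      fix j
      have "\<pi> j x = (if j \<in> {i. c i \<noteq> \<zero>} then c j else \<zero>)"
        using pisum[of "{i. c i \<noteq> \<zero>}" c j] c by metis
      then show "c j = \<pi> j x" by auto
    qed
  qed (use pi[OF x] fin[OF x] in auto)
  then show ?thesis using sub unfolding internal_direct_sum_def by blast
qed

section \<open>Graded modules and linear maps\<close>

abbreviation hc :: "('a, 'm) gmodule \<Rightarrow> int \<Rightarrow> 'm \<Rightarrow> 'm" where
  "hc X n x \<equiv> hcomp X (gr X) n x"

lemma graded_moduleD:
  assumes "graded_module R X"
  shows "module R X" "direct_sum X (gr X)"
    "\<And>a i x n. a \<in> rgr R i \<Longrightarrow> x \<in> gr X n \<Longrightarrow> a \<odot>\<^bsub>X\<^esub> x \<in> gr X (int i + n)"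
proof -
  show X: "module R X" using assms by (simp add: graded_module_def)
  show "direct_sum X (gr X)"
    by (intro direct_sum.intro direct_sum_axioms.intro module.axioms(2)[OF X])
      (use assms in \<open>simp add: graded_module_def\<close>)
qed (use assms in \<open>simp add: graded_module_def\<close>)

lemma graded_ringD:
  assumes "graded_ring R"
  shows "cring R" "direct_sum R (rgr R)"
    "\<And>a i b j. a \<in> rgr R i \<Longrightarrow> b \<in> rgr R j \<Longrightarrow> a \<otimes>\<^bsub>R\<^esub> b \<in> rgr R (i + j)"
proof -
  show R: "cring R" using assms by (simp add: graded_ring_def)
  show "direct_sum R (rgr R)"
    by (intro direct_sum.intro direct_sum_axioms.intro cring.axioms(1)[OF R, THEN ring.axioms(1)])
      (use assms in \<open>simp add: graded_ring_def\<close>)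
qed (use assms in \<open>simp add: graded_ring_def\<close>)

lemma sub_gmodule_simps [simp]:
  "carrier (sub_gmodule X S) = S" "add (sub_gmodule X S) = add X" "zero (sub_gmodule X S) = zero X"
  "smult (sub_gmodule X S) = smult X" "gr (sub_gmodule X S) n = gr X n \<inter> S"
  by (simp_all add: sub_gmodule_def)

text \<open>Being a module does not depend on the grading or on the unspecified fields
  \<open>mult\<close> and \<open>one\<close>. The lemma moves the library's submodule structure to
  \<open>sub_gmodule\<close>.\<close>

lemma module_cong:
  assumes "module R X" "carrier Y = carrier X" "add Y = add X" "zero Y = zero X" "smult Y = smult X"
  shows "module R Y"
proof (rule moduleI)
  interpret X: module R X by fact
  show "cring R" by (rule X.R.is_cring)
  show "abelian_group Y"
  proof (rule abelian_groupI)
    fix x assume "x \<in> carrier Y"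
    then show "\<exists>y\<in>carrier Y. y \<oplus>\<^bsub>Y\<^esub> x = \<zero>\<^bsub>Y\<^esub>"
      using X.M.l_neg[of x] X.M.a_inv_closed[of x] unfolding assms by blast
  next
    fix x y assume "x \<in> carrier Y" "y \<in> carrier Y"
    then show "x \<oplus>\<^bsub>Y\<^esub> y = y \<oplus>\<^bsub>Y\<^esub> x" using X.M.a_comm unfolding assms by blast
  qed (simp_all add: assms X.M.a_assoc)
qed (use assms(2-5) module.smult_closed[OF assms(1)] module.smult_l_distr[OF assms(1)]
      module.smult_r_distr[OF assms(1)] module.smult_assoc1[OF assms(1)]
      module.smult_one[OF assms(1)] in auto)

lemma submoduleD:
  assumes "module R X" "submodule S R X"
  shows "S \<subseteq> carrier X" "\<zero>\<^bsub>X\<^esub> \<in> S" "\<And>x. x \<in> S \<Longrightarrow> \<ominus>\<^bsub>X\<^esub> x \<in> S"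
    "\<And>x y. x \<in> S \<Longrightarrow> y \<in> S \<Longrightarrow> x \<oplus>\<^bsub>X\<^esub> y \<in> S" "\<And>a x. a \<in> carrier R \<Longrightarrow> x \<in> S \<Longrightarrow> a \<odot>\<^bsub>X\<^esub> x \<in> S"
proof -
  have "subgroup S (add_monoid X)" by (rule submodule.axioms(1)[OF assms(2)])
  from subgroup.one_closed[OF this] show "\<zero>\<^bsub>X\<^esub> \<in> S" by simp
  note E = module.submoduleE[OF assms]
  show "S \<subseteq> carrier X" by (rule E(1))
  show "\<ominus>\<^bsub>X\<^esub> x \<in> S" if "x \<in> S" for x using that by (rule E(3))
  show "x \<oplus>\<^bsub>X\<^esub> y \<in> S" if "x \<in> S" "y \<in> S" for x y using that by (rule E(5))
  show "a \<odot>\<^bsub>X\<^esub> x \<in> S" if "a \<in> carrier R" "x \<in> S" for a x using that by (rule E(4))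
qed

lemma submodule_module:
  assumes "module R X" "submodule S R X"
  shows "module R (sub_gmodule X S)"
  by (rule module_cong[OF submodule.submodule_is_module[OF assms(2,1)]]) simp_all

text \<open>\<open>a_inv\<close> is defined relative to the carrier of its record, so passing to a
  smaller carrier could in principle change it.\<close>

lemma a_inv_sub:
  assumes "module R X" "submodule S R X" "x \<in> S"
  shows "\<ominus>\<^bsub>sub_gmodule X S\<^esub> x = \<ominus>\<^bsub>X\<^esub> x"
proof -
  interpret X: module R X by fact
  interpret S: module R "sub_gmodule X S" by (rule submodule_module) fact+
  show ?thesis
    using S.M.minus_equality[of "\<ominus>\<^bsub>X\<^esub> x" x] submoduleD(1,3)[OF assms(1,2)] assms(3)
    by (simp add: X.M.l_neg subset_iff)
qed

definition homogeneous_submodule :: "'a gring \<Rightarrow> ('a, 'm) gmodule \<Rightarrow> 'm set \<Rightarrow> bool" where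
  "homogeneous_submodule R X S \<longleftrightarrow> submodule S R X \<and> (\<forall>x\<in>S. \<forall>n. hc X n x \<in> S)"

lemma homogeneous_submoduleD:
  assumes "module R X" "homogeneous_submodule R X S"
  shows "submodule S R X" "S \<subseteq> carrier X" "\<zero>\<^bsub>X\<^esub> \<in> S" "\<And>x. x \<in> S \<Longrightarrow> \<ominus>\<^bsub>X\<^esub> x \<in> S"
    "\<And>x y. x \<in> S \<Longrightarrow> y \<in> S \<Longrightarrow> x \<oplus>\<^bsub>X\<^esub> y \<in> S" "\<And>a x. a \<in> carrier R \<Longrightarrow> x \<in> S \<Longrightarrow> a \<odot>\<^bsub>X\<^esub> x \<in> S"
    "\<And>x n. x \<in> S \<Longrightarrow> hc X n x \<in> S"
proof -
  show S: "submodule S R X" using assms(2) by (simp add: homogeneous_submodule_def)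
  note E = submoduleD[OF assms(1) S]
  show "S \<subseteq> carrier X" by (rule E(1))
  show "\<zero>\<^bsub>X\<^esub> \<in> S" by (rule E(2))
  show "\<ominus>\<^bsub>X\<^esub> x \<in> S" if "x \<in> S" for x using that by (rule E(3))
  show "x \<oplus>\<^bsub>X\<^esub> y \<in> S" if "x \<in> S" "y \<in> S" for x y using that by (rule E(4))
  show "a \<odot>\<^bsub>X\<^esub> x \<in> S" if "a \<in> carrier R" "x \<in> S" for a x using that by (rule E(5))
  show "hc X n x \<in> S" if "x \<in> S" for x n
    using assms(2) that by (simp add: homogeneous_submodule_def)
qed

lemma homogeneous_submoduleI:
  assumes "module R X" "S \<subseteq> carrier X" "\<zero>\<^bsub>X\<^esub> \<in> S"
    "\<And>x y. x \<in> S \<Longrightarrow> y \<in> S \<Longrightarrow> x \<oplus>\<^bsub>X\<^esub> y \<in> S" "\<And>a x. a \<in> carrier R \<Longrightarrow> x \<in> S \<Longrightarrow> a \<odot>\<^bsub>X\<^esub> x \<in> S"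
    "\<And>x n. x \<in> S \<Longrightarrow> hc X n x \<in> S"
  shows "homogeneous_submodule R X S"
proof -
  interpret X: module R X by fact
  have "\<ominus>\<^bsub>X\<^esub> x \<in> S" if "x \<in> S" for x
    using assms(5)[of "\<ominus>\<^bsub>R\<^esub> \<one>\<^bsub>R\<^esub>" x] that assms(2) by (simp add: X.smult_l_minus subset_iff)
  then have "submodule S R X" by (intro X.submoduleI assms)
  then show ?thesis
    unfolding homogeneous_submodule_def using assms(6) by blast
qed

text \<open>Because \<open>S\<close> contains the components of its elements, the projections of
  \<open>X\<close> restrict to \<open>S\<close>. \<open>internal_direct_sumI\<close> applies to
  them, and they are again the projections of the new grading.\<close>

lemma homogeneous_sub_gmodule:
  assumes "graded_module R X" "homogeneous_submodule R X S" "graded_ring R"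
  shows "graded_module R (sub_gmodule X S)"
    and "x \<in> S \<Longrightarrow> hc (sub_gmodule X S) n x = hc X n x"
proof -
  interpret X: module R X by (rule graded_moduleD[OF assms(1)])
  interpret D: direct_sum X "gr X" by (rule graded_moduleD[OF assms(1)])
  interpret DR: direct_sum R "rgr R" by (rule graded_ringD[OF assms(3)])
  note S = homogeneous_submoduleD[OF X.module_axioms assms(2)]
  interpret S: module R "sub_gmodule X S" by (rule submodule_module[OF X.module_axioms S(1)])
  have Sc: "x \<in> carrier X" if "x \<in> S" for x using S(2) that by blast
  have "internal_direct_sum (sub_gmodule X S) (gr (sub_gmodule X S))"
  proof (rule S.M.internal_direct_sumI[where \<pi> = "\<lambda>n. hc X n"])
    fix i
    have "subgroup (gr (sub_gmodule X S) i) (add_monoid (sub_gmodule X S))"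
    proof (rule S.M.add.subgroupI)
      show "gr (sub_gmodule X S) i \<noteq> {}" using D.component_zero S(3) by force
    next
      fix x assume "x \<in> gr (sub_gmodule X S) i"
      then show "\<ominus>\<^bsub>sub_gmodule X S\<^esub> x \<in> gr (sub_gmodule X S) i"
        using a_inv_sub[OF X.module_axioms S(1), of x] D.component_minus S(4)
        by simp
    next
      fix x y assume "x \<in> gr (sub_gmodule X S) i" "y \<in> gr (sub_gmodule X S) i"
      then show "x \<oplus>\<^bsub>sub_gmodule X S\<^esub> y \<in> gr (sub_gmodule X S) i"
        using D.component_add S(5) by simp
    qed auto
    then show "additive_subgroup (gr (sub_gmodule X S) i) (sub_gmodule X S)"
      by (rule additive_subgroup.intro)
  next
    fix i x assume "x \<in> carrier (sub_gmodule X S)"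
    then show "hc X i x \<in> gr (sub_gmodule X S) i"
      using D.hcomp_props(1) S(7) Sc by simp
  next
    fix x assume "x \<in> carrier (sub_gmodule X S)"
    then show "finite {i. hc X i x \<noteq> \<zero>\<^bsub>sub_gmodule X S\<^esub>}"
      using D.hcomp_props(2)[of x] Sc by simp
  next
    fix x assume "x \<in> carrier (sub_gmodule X S)" "\<And>i. hc X i x = \<zero>\<^bsub>sub_gmodule X S\<^esub>"
    then show "x = \<zero>\<^bsub>sub_gmodule X S\<^esub>"
      using D.hcomp_all_zero[of x] Sc by simp
  next
    fix i j x assume "x \<in> gr (sub_gmodule X S) i" "i \<noteq> j"
    then show "hc X j x = \<zero>\<^bsub>sub_gmodule X S\<^esub>"
      using D.hcomp_component[of x i j] by simp
  qed (simp_all add: Sc D.hcomp_add)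
  then show gS: "graded_module R (sub_gmodule X S)"
    unfolding graded_module_def
    using S.module_axioms graded_moduleD(3)[OF assms(1)] S(6)[OF DR.component_closed] by auto
  interpret DS: direct_sum "sub_gmodule X S" "gr (sub_gmodule X S)" by (rule graded_moduleD[OF gS])
  show "hc (sub_gmodule X S) n x = hc X n x" if "x \<in> S"
  proof (rule DS.hcomp_unique)
    fix j x assume "x \<in> gr (sub_gmodule X S) j"
    then show "hc X n x = (if n = j then x else \<zero>\<^bsub>sub_gmodule X S\<^esub>)"
      using D.hcomp_component[of x j n] by simp
  qed (use that in \<open>simp_all add: Sc D.hcomp_add\<close>)
qed

lemma hc_smult:
  assumes "graded_module R X" "a \<in> rgr R i" "a \<in> carrier R" "x \<in> carrier X"
  shows "hc X n (a \<odot>\<^bsub>X\<^esub> x) = a \<odot>\<^bsub>X\<^esub> hc X (n - int i) x"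
proof -
  interpret X: module R X by (rule graded_moduleD[OF assms(1)])
  interpret D: direct_sum X "gr X" by (rule graded_moduleD[OF assms(1)])
  show ?thesis using assms(4)
  proof (induct rule: D.homogeneous_induct)
    case (homogeneous k x)
    then show ?case
      using graded_moduleD(3)[OF assms(1,2) homogeneous] assms(3) by (auto simp: D.hcomp_component)
  next
    case (add x y)
    then show ?case using assms(3) by (auto simp: X.smult_r_distr D.hcomp_add)
  qed
qed

section \<open>Linear maps and their homogeneous parts\<close>

lemma lin_mapsD:
  assumes "f \<in> lin_maps R A B"
  shows "x \<in> carrier A \<Longrightarrow> f x \<in> carrier B"
    "x \<in> carrier A \<Longrightarrow> y \<in> carrier A \<Longrightarrow> f (x \<oplus>\<^bsub>A\<^esub> y) = f x \<oplus>\<^bsub>B\<^esub> f y"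
    "a \<in> carrier R \<Longrightarrow> x \<in> carrier A \<Longrightarrow> f (a \<odot>\<^bsub>A\<^esub> x) = a \<odot>\<^bsub>B\<^esub> f x"
  using assms by (auto simp: lin_maps_def)

lemma lin_mapsI:
  assumes "\<And>x. x \<in> carrier A \<Longrightarrow> f x \<in> carrier B"
    "\<And>x y. x \<in> carrier A \<Longrightarrow> y \<in> carrier A \<Longrightarrow> f (x \<oplus>\<^bsub>A\<^esub> y) = f x \<oplus>\<^bsub>B\<^esub> f y"
    "\<And>a x. a \<in> carrier R \<Longrightarrow> x \<in> carrier A \<Longrightarrow> f (a \<odot>\<^bsub>A\<^esub> x) = a \<odot>\<^bsub>B\<^esub> f x"
  shows "f \<in> lin_maps R A B"
  using assms by (auto simp: lin_maps_def)

lemma lin_maps_zero: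
  assumes "f \<in> lin_maps R A B" "module R A" "module R B"
  shows "f \<zero>\<^bsub>A\<^esub> = \<zero>\<^bsub>B\<^esub>"
proof -
  interpret A: module R A by fact
  interpret B: module R B by fact
  have "f (\<zero>\<^bsub>R\<^esub> \<odot>\<^bsub>A\<^esub> \<zero>\<^bsub>A\<^esub>) = \<zero>\<^bsub>R\<^esub> \<odot>\<^bsub>B\<^esub> f \<zero>\<^bsub>A\<^esub>"
    by (rule lin_mapsD(3)[OF assms(1)]) simp_all
  then show ?thesis using lin_mapsD(1)[OF assms(1), of "\<zero>\<^bsub>A\<^esub>"] by simp
qed

lemma lin_maps_minus:
  assumes "f \<in> lin_maps R A B" "module R A" "module R B" "x \<in> carrier A"
  shows "f (\<ominus>\<^bsub>A\<^esub> x) = \<ominus>\<^bsub>B\<^esub> f x"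
proof -
  interpret A: module R A by fact
  interpret B: module R B by fact
  have "f ((\<ominus>\<^bsub>R\<^esub> \<one>\<^bsub>R\<^esub>) \<odot>\<^bsub>A\<^esub> x) = (\<ominus>\<^bsub>R\<^esub> \<one>\<^bsub>R\<^esub>) \<odot>\<^bsub>B\<^esub> f x"
    by (rule lin_mapsD(3)[OF assms(1)]) (simp_all add: assms)
  then show ?thesis
    using lin_mapsD(1)[OF assms(1), of x] assms(4) by (simp add: A.smult_l_minus B.smult_l_minus)
qed

lemma lin_maps_degD:
  assumes "f \<in> lin_maps_deg R A B n"
  shows "f \<in> lin_maps R A B" "x \<in> gr A k \<Longrightarrow> f x \<in> gr B (k + n)"
  using assms by (auto simp: lin_maps_deg_def)

lemma lin_maps_degI:
  assumes "f \<in> lin_maps R A B" "\<And>k x. x \<in> gr A k \<Longrightarrow> f x \<in> gr B (k + n)"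
  shows "f \<in> lin_maps_deg R A B n"
  using assms by (auto simp: lin_maps_deg_def)

lemma lin_maps_deg_hc:
  assumes "f \<in> lin_maps_deg R A B n" "graded_module R A" "graded_module R B" "x \<in> carrier A"
  shows "hc B k (f x) = f (hc A (k - n) x)"
proof -
  interpret A: module R A by (rule graded_moduleD[OF assms(2)])
  interpret DA: direct_sum A "gr A" by (rule graded_moduleD[OF assms(2)])
  interpret B: module R B by (rule graded_moduleD[OF assms(3)])
  interpret DB: direct_sum B "gr B" by (rule graded_moduleD[OF assms(3)])
  note f = lin_maps_degD[OF assms(1)] lin_mapsD[OF lin_maps_degD(1)[OF assms(1)]]
  note z = lin_maps_zero[OF f(1) A.module_axioms B.module_axioms]
  show ?thesis using assms(4)
  proof (induct rule: DA.homogeneous_induct)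
    case (homogeneous j x)
    then show ?case
      using f(2)[OF homogeneous] z by (auto simp: DA.hcomp_component DB.hcomp_component)
  next
    case (add x y)
    then show ?case using f by (auto simp: DA.hcomp_add DB.hcomp_add)
  qed
qed

lemma lin_maps_comp:
  assumes "f \<in> lin_maps R A B" "g \<in> lin_maps R B C"
  shows "(\<lambda>x. g (f x)) \<in> lin_maps R A C"
  using assms by (auto simp: lin_maps_def Pi_iff)

lemma lin_maps_deg_comp:
  assumes "f \<in> lin_maps_deg R A B m" "g \<in> lin_maps_deg R B C n" "k = m + n"
  shows "(\<lambda>x. g (f x)) \<in> lin_maps_deg R A C k"
proof (rule lin_maps_degI)
  show "(\<lambda>x. g (f x)) \<in> lin_maps R A C"
    by (rule lin_maps_comp) (use assms lin_maps_degD in blast)+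
  show "g (f x) \<in> gr C (j + k)" if "x \<in> gr A j" for x j
    using lin_maps_degD(2)[OF assms(2) lin_maps_degD(2)[OF assms(1) that]] assms(3)
    by (simp add: add.assoc)
qed

lemma lin_maps_deg_add:
  assumes "f \<in> lin_maps_deg R A B n" "g \<in> lin_maps_deg R A B n" "graded_module R B"
  shows "(\<lambda>x. f x \<oplus>\<^bsub>B\<^esub> g x) \<in> lin_maps_deg R A B n"
proof -
  interpret B: module R B by (rule graded_moduleD[OF assms(3)])
  interpret DB: direct_sum B "gr B" by (rule graded_moduleD[OF assms(3)])
  note f = lin_maps_degD[OF assms(1)] lin_mapsD[OF lin_maps_degD(1)[OF assms(1)]]
  note g = lin_maps_degD[OF assms(2)] lin_mapsD[OF lin_maps_degD(1)[OF assms(2)]]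
  show ?thesis
    by (intro lin_maps_degI lin_mapsI)
      (simp_all add: f g B.smult_r_distr B.M.a_ac DB.component_add)
qed

lemma lin_maps_smult:
  assumes "f \<in> lin_maps R A B" "a \<in> carrier R" "module R B"
  shows "(\<lambda>x. a \<odot>\<^bsub>B\<^esub> f x) \<in> lin_maps R A B"
proof -
  interpret B: module R B by fact
  show ?thesis
  proof (rule lin_mapsI)
    fix b x assume "b \<in> carrier R" "x \<in> carrier A"
    then show "a \<odot>\<^bsub>B\<^esub> f (b \<odot>\<^bsub>A\<^esub> x) = b \<odot>\<^bsub>B\<^esub> (a \<odot>\<^bsub>B\<^esub> f x)"
      using assms(2) lin_mapsD[OF assms(1)] by (simp flip: B.smult_assoc1 add: B.R.m_comm)
  qed (use assms(2) lin_mapsD[OF assms(1)] in \<open>simp_all add: B.smult_r_distr\<close>)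
qed

lemma lin_maps_deg_smult:
  assumes "f \<in> lin_maps_deg R A B n" "a \<in> rgr R 0" "a \<in> carrier R" "graded_module R B"
  shows "(\<lambda>x. a \<odot>\<^bsub>B\<^esub> f x) \<in> lin_maps_deg R A B n"
proof (rule lin_maps_degI)
  show "(\<lambda>x. a \<odot>\<^bsub>B\<^esub> f x) \<in> lin_maps R A B"
    by (rule lin_maps_smult[OF lin_maps_degD(1)[OF assms(1)] assms(3) graded_moduleD(1)[OF assms(4)]])
  show "a \<odot>\<^bsub>B\<^esub> f x \<in> gr B (k + n)" if "x \<in> gr A k" for x k
    using graded_moduleD(3)[OF assms(4,2) lin_maps_degD(2)[OF assms(1) that]] by simp
qed

lemma lin_maps_deg_uminus:
  assumes "f \<in> lin_maps_deg R A B n" "graded_module R B"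
  shows "(\<lambda>x. \<ominus>\<^bsub>B\<^esub> f x) \<in> lin_maps_deg R A B n"
proof -
  interpret B: module R B by (rule graded_moduleD[OF assms(2)])
  interpret DB: direct_sum B "gr B" by (rule graded_moduleD[OF assms(2)])
  note f = lin_maps_degD[OF assms(1)] lin_mapsD[OF lin_maps_degD(1)[OF assms(1)]]
  show ?thesis
    by (intro lin_maps_degI lin_mapsI)
      (simp_all add: f B.smult_r_minus B.M.minus_add DB.component_minus)
qed

lemma lin_maps_deg_minus:
  assumes "f \<in> lin_maps_deg R A B n" "g \<in> lin_maps_deg R A B n" "graded_module R B"
  shows "(\<lambda>x. f x \<ominus>\<^bsub>B\<^esub> g x) \<in> lin_maps_deg R A B n"
  using lin_maps_deg_add[OF assms(1) lin_maps_deg_uminus[OF assms(2,3)] assms(3)]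
  by (simp add: a_minus_def)

text \<open>On each degree \<open>k\<close> the map is cut down to its component in degree
  \<open>k + n\<close>, and the results are added up; linearity is checked on homogeneous scalars
  and vectors. This is how degrees are recovered throughout, after a lift or an extension has been
  built as a plain linear map.\<close>

lemma homogeneous_part:
  assumes "f \<in> lin_maps R A B" "graded_module R A" "graded_module R B" "graded_ring R"
  shows "\<exists>g\<in>lin_maps_deg R A B n. \<forall>k. \<forall>x\<in>gr A k. g x = hc B (k + n) (f x)"
proof -
  interpret A: module R A by (rule graded_moduleD[OF assms(2)])
  interpret DA: direct_sum A "gr A" by (rule graded_moduleD[OF assms(2)])
  interpret B: module R B by (rule graded_moduleD[OF assms(3)])
  interpret DB: direct_sum B "gr B" by (rule graded_moduleD[OF assms(3)])
  interpret DR: direct_sum R "rgr R" by (rule graded_ringD[OF assms(4)])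
  note f = lin_mapsD[OF assms(1)] lin_maps_zero[OF assms(1) A.module_axioms B.module_axioms]
  define g where "g x = (\<Oplus>\<^bsub>B\<^esub>k\<in>{k. hc A k x \<noteq> \<zero>\<^bsub>A\<^esub>}. hc B (k + n) (f (hc A k x)))" for x
  \<comment> \<open>The index set may be enlarged, so that the union of the supports of
    \<open>x\<close> and \<open>y\<close> serves for \<open>x\<close>, \<open>y\<close> and their
    sum.\<close>
  have g_eq: "g x = (\<Oplus>\<^bsub>B\<^esub>k\<in>F. hc B (k + n) (f (hc A k x)))"
    if "x \<in> carrier A" "finite F" "{k. hc A k x \<noteq> \<zero>\<^bsub>A\<^esub>} \<subseteq> F" for x F
    unfolding g_def
    by (rule B.M.add.finprod_mono_neutral_cong_left) (use that f in auto)
  have g_closed: "g x \<in> carrier B" if "x \<in> carrier A" for x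
    unfolding g_def by (intro B.M.finsum_closed) (use that f in auto)
  have g_hom: "g x = hc B (k + n) (f x)" if "x \<in> gr A k" for k x
    by (subst g_eq[where F = "{k}"]) (use that f in \<open>auto simp: DA.hcomp_component\<close>)
  have g_add: "g (x \<oplus>\<^bsub>A\<^esub> y) = g x \<oplus>\<^bsub>B\<^esub> g y" if x: "x \<in> carrier A" and y: "y \<in> carrier A" for x y
  proof -
    let ?F = "{k. hc A k x \<noteq> \<zero>\<^bsub>A\<^esub>} \<union> {k. hc A k y \<noteq> \<zero>\<^bsub>A\<^esub>}"
    have F: "finite ?F" "{k. hc A k (x \<oplus>\<^bsub>A\<^esub> y) \<noteq> \<zero>\<^bsub>A\<^esub>} \<subseteq> ?F"
      using x y DA.hcomp_props(2) by (auto simp: DA.hcomp_add)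
    have "g (x \<oplus>\<^bsub>A\<^esub> y) = (\<Oplus>\<^bsub>B\<^esub>k\<in>?F. hc B (k + n) (f (hc A k x)) \<oplus>\<^bsub>B\<^esub> hc B (k + n) (f (hc A k y)))"
      using x y f F by (subst g_eq[where F = ?F]) (auto simp: DA.hcomp_add DB.hcomp_add)
    also have "\<dots> = g x \<oplus>\<^bsub>B\<^esub> g y"
      using x y f F by (subst B.M.finsum_addf) (auto simp: g_eq[where F = ?F])
    finally show ?thesis .
  qed
  have g_smult: "g (a \<odot>\<^bsub>A\<^esub> x) = a \<odot>\<^bsub>B\<^esub> g x" if a: "a \<in> carrier R" and x: "x \<in> carrier A" for a x
    using a
  proof (induct rule: DR.homogeneous_induct)
    case (homogeneous i a)
    have ac: "a \<in> carrier R" using homogeneous by (rule DR.component_closed)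
    show ?case using x
    proof (induct rule: DA.homogeneous_induct)
      case (homogeneous k x)
      have xc: "x \<in> carrier A" using homogeneous by (rule DA.component_closed)
      have "a \<odot>\<^bsub>A\<^esub> x \<in> gr A (int i + k)"
        using graded_moduleD(3)[OF assms(2)] \<open>a \<in> rgr R i\<close> homogeneous by blast
      \<comment> \<open>Multiplication by \<open>a\<close>, of degree \<open>i\<close>, carries
        degree \<open>k + n\<close> to degree \<open>i + k + n\<close>, which is the component that
        \<open>g_hom\<close> selects for the multiple of \<open>x\<close>.\<close>
      then show ?case
        using g_hom[OF homogeneous] hc_smult[OF assms(3) \<open>a \<in> rgr R i\<close> ac f(1)[OF xc], of "int i + k + n"]
        by (simp add: g_hom f ac xc algebra_simps)
    next
      case (add x y)
      then show ?case using ac by (simp add: A.smult_r_distr B.smult_r_distr g_add g_closed)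
    qed
  next
    case (add a b)
    then show ?case using x by (simp add: A.smult_l_distr B.smult_l_distr g_add g_closed)
  qed
  have "g \<in> lin_maps_deg R A B n"
    by (intro lin_maps_degI lin_mapsI g_closed g_add g_smult)
      (use f(1) DA.component_closed in \<open>auto simp: g_hom intro: DB.hcomp_props\<close>)
  then show ?thesis using g_hom by blast
qed

section \<open>Quotients and modules of homomorphisms\<close>

lemma submodule_abelian_subgroup:
  assumes "module R M" "submodule N R M"
  shows "abelian_subgroup N M"
  by (rule abelian_subgroupI3[OF additive_subgroup.intro[OF submodule.axioms(1)[OF assms(2)]]
        module.axioms(2)[OF assms(1)]])

lemma coset_eq_iff:
  assumes "module R M" "submodule N R M" "x \<in> carrier M" "y \<in> carrier M"
  shows "N +>\<^bsub>M\<^esub> x = N +>\<^bsub>M\<^esub> y \<longleftrightarrow> x \<ominus>\<^bsub>M\<^esub> y \<in> N"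
proof -
  interpret M: module R M by fact
  interpret N: abelian_subgroup N M by (rule submodule_abelian_subgroup) fact+
  have N: "N \<subseteq> carrier M" by (rule submoduleD(1)) fact+
  have xy: "x \<ominus>\<^bsub>M\<^esub> y \<in> carrier M" using assms by simp
  show ?thesis
  proof
    assume "N +>\<^bsub>M\<^esub> x = N +>\<^bsub>M\<^esub> y"
    from M.a_coset_add_inv2[OF this assms(3,4) N] show "x \<ominus>\<^bsub>M\<^esub> y \<in> N"
      using M.a_coset_join1[OF _ xy N.a_subgroup] by (simp add: a_minus_def)
  next
    assume "x \<ominus>\<^bsub>M\<^esub> y \<in> N"
    from M.a_coset_join2[OF xy N.a_subgroup this] show "N +>\<^bsub>M\<^esub> x = N +>\<^bsub>M\<^esub> y"
      using M.a_coset_add_inv1[OF _ assms(3,4) N] by (simp add: a_minus_def)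
  qed
qed

lemma coset_zero_iff:
  assumes "module R M" "submodule N R M" "x \<in> carrier M"
  shows "N +>\<^bsub>M\<^esub> x = N \<longleftrightarrow> x \<in> N"
proof -
  interpret M: module R M by fact
  have N: "N \<subseteq> carrier M" by (rule submoduleD(1)) fact+
  have "\<ominus>\<^bsub>M\<^esub> \<zero>\<^bsub>M\<^esub> = \<zero>\<^bsub>M\<^esub>" by (rule M.M.minus_equality) simp_all
  then have "x \<ominus>\<^bsub>M\<^esub> \<zero>\<^bsub>M\<^esub> = x" unfolding a_minus_def using assms(3) by (metis M.M.r_zero)
  then show ?thesis
    using coset_eq_iff[OF assms M.M.zero_closed] M.M.a_coset_add_zero[OF N] by simp
qed

lemma quot_gmodule_simps:
  assumes "module R M" "submodule N R M"
  shows "carrier (quot_gmodule M N) = {N +>\<^bsub>M\<^esub> x |x. x \<in> carrier M}"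
    "zero (quot_gmodule M N) = N"
    "gr (quot_gmodule M N) n = {N +>\<^bsub>M\<^esub> x |x. x \<in> gr M n}"
    "x \<in> carrier M \<Longrightarrow> y \<in> carrier M \<Longrightarrow>
      (N +>\<^bsub>M\<^esub> x) \<oplus>\<^bsub>quot_gmodule M N\<^esub> (N +>\<^bsub>M\<^esub> y) = N +>\<^bsub>M\<^esub> (x \<oplus>\<^bsub>M\<^esub> y)"
    "a \<in> carrier R \<Longrightarrow> x \<in> carrier M \<Longrightarrow>
      a \<odot>\<^bsub>quot_gmodule M N\<^esub> (N +>\<^bsub>M\<^esub> x) = N +>\<^bsub>M\<^esub> (a \<odot>\<^bsub>M\<^esub> x)"
proof -
  interpret M: module R M by fact
  interpret N: abelian_subgroup N M by (rule submodule_abelian_subgroup) fact+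
  note Nd = submoduleD[OF assms]
  show "carrier (quot_gmodule M N) = {N +>\<^bsub>M\<^esub> x |x. x \<in> carrier M}"
    by (auto simp: quot_gmodule_def A_RCOSETS_def')
  show "(N +>\<^bsub>M\<^esub> x) \<oplus>\<^bsub>quot_gmodule M N\<^esub> (N +>\<^bsub>M\<^esub> y) = N +>\<^bsub>M\<^esub> (x \<oplus>\<^bsub>M\<^esub> y)"
    if "x \<in> carrier M" "y \<in> carrier M"
    using N.a_rcos_sum[OF that] by (simp add: quot_gmodule_def)
  show "a \<odot>\<^bsub>quot_gmodule M N\<^esub> (N +>\<^bsub>M\<^esub> x) = N +>\<^bsub>M\<^esub> (a \<odot>\<^bsub>M\<^esub> x)"
    if a: "a \<in> carrier R" and x: "x \<in> carrier M"
  proof -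
    \<comment> \<open>Scalar multiplication on the quotient is a union over representatives. It
      collapses to one coset because multiplication by \<open>a\<close> maps \<open>N\<close> into
      \<open>N\<close>.\<close>
    have "N +>\<^bsub>M\<^esub> (a \<odot>\<^bsub>M\<^esub> y) = N +>\<^bsub>M\<^esub> (a \<odot>\<^bsub>M\<^esub> x)" if y: "y \<in> N +>\<^bsub>M\<^esub> x" for y
    proof -
      obtain h where h: "h \<in> N" "y = h \<oplus>\<^bsub>M\<^esub> x" using y by (auto simp: a_r_coset_def')
      have hc: "h \<in> carrier M" using h Nd(1) by blast
      have "a \<odot>\<^bsub>M\<^esub> y \<ominus>\<^bsub>M\<^esub> a \<odot>\<^bsub>M\<^esub> x = a \<odot>\<^bsub>M\<^esub> h"
        using h(2) hc a x by (simp add: M.smult_r_distr a_minus_def M.a_assoc M.M.r_neg)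
      then show ?thesis
        using coset_eq_iff[OF assms, of "a \<odot>\<^bsub>M\<^esub> y" "a \<odot>\<^bsub>M\<^esub> x"] Nd(5)[OF a h(1)] h(2) hc a x
        by simp
    qed
    moreover have "x \<in> N +>\<^bsub>M\<^esub> x" by (rule N.a_rcos_self[OF x])
    ultimately have "(\<Union>y\<in>N +>\<^bsub>M\<^esub> x. N +>\<^bsub>M\<^esub> (a \<odot>\<^bsub>M\<^esub> y)) = N +>\<^bsub>M\<^esub> (a \<odot>\<^bsub>M\<^esub> x)"
      by (intro UN_constant_eq ballI)
    then show ?thesis by (simp add: quot_gmodule_def)
  qed
qed (simp_all add: quot_gmodule_def)

lemma quot_module:
  assumes "module R M" "submodule N R M"
  shows "module R (quot_gmodule M N)"
proof (rule moduleI)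
  interpret M: module R M by fact
  note q = quot_gmodule_simps[OF assms]
  note Nd = submoduleD[OF assms]
  have zero: "\<zero>\<^bsub>quot_gmodule M N\<^esub> = N +>\<^bsub>M\<^esub> \<zero>\<^bsub>M\<^esub>"
    using M.a_coset_add_zero[OF Nd(1)] q(2) by simp
  show "cring R" by (rule M.R.is_cring)
  show "abelian_group (quot_gmodule M N)"
  proof (rule abelian_groupI)
    fix X assume "X \<in> carrier (quot_gmodule M N)"
    then obtain x where x: "x \<in> carrier M" "X = N +>\<^bsub>M\<^esub> x" by (auto simp: q(1))
    have "N +>\<^bsub>M\<^esub> (\<ominus>\<^bsub>M\<^esub> x) \<in> carrier (quot_gmodule M N)" using x by (auto simp: q(1))
    moreover have "(N +>\<^bsub>M\<^esub> (\<ominus>\<^bsub>M\<^esub> x)) \<oplus>\<^bsub>quot_gmodule M N\<^esub> X = \<zero>\<^bsub>quot_gmodule M N\<^esub>"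
      using x by (simp add: q(4) zero M.M.l_neg)
    ultimately show "\<exists>Y\<in>carrier (quot_gmodule M N). Y \<oplus>\<^bsub>quot_gmodule M N\<^esub> X = \<zero>\<^bsub>quot_gmodule M N\<^esub>"
      by blast
    show "\<zero>\<^bsub>quot_gmodule M N\<^esub> \<oplus>\<^bsub>quot_gmodule M N\<^esub> X = X"
      using x by (simp add: q(4) zero)
    fix Y assume "Y \<in> carrier (quot_gmodule M N)"
    then obtain y where y: "y \<in> carrier M" "Y = N +>\<^bsub>M\<^esub> y" by (auto simp: q(1))
    have "x \<oplus>\<^bsub>M\<^esub> y \<in> carrier M" using x y by simp
    then show "X \<oplus>\<^bsub>quot_gmodule M N\<^esub> Y \<in> carrier (quot_gmodule M N)"
      using x y by (auto simp: q(1,4))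
    show "X \<oplus>\<^bsub>quot_gmodule M N\<^esub> Y = Y \<oplus>\<^bsub>quot_gmodule M N\<^esub> X"
      using x y by (simp add: q(4) M.a_comm)
    fix Z assume "Z \<in> carrier (quot_gmodule M N)"
    then obtain z where z: "z \<in> carrier M" "Z = N +>\<^bsub>M\<^esub> z" by (auto simp: q(1))
    show "X \<oplus>\<^bsub>quot_gmodule M N\<^esub> Y \<oplus>\<^bsub>quot_gmodule M N\<^esub> Z =
        X \<oplus>\<^bsub>quot_gmodule M N\<^esub> (Y \<oplus>\<^bsub>quot_gmodule M N\<^esub> Z)"
      using x y z by (simp add: q(4) M.a_assoc)
  next
    show "\<zero>\<^bsub>quot_gmodule M N\<^esub> \<in> carrier (quot_gmodule M N)" unfolding zero q(1) by blast
  qed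
  fix a X assume a: "a \<in> carrier R" and "X \<in> carrier (quot_gmodule M N)"
  then obtain x where x: "x \<in> carrier M" "X = N +>\<^bsub>M\<^esub> x" by (auto simp: q(1))
  have "a \<odot>\<^bsub>M\<^esub> x \<in> carrier M" using a x by simp
  then show "a \<odot>\<^bsub>quot_gmodule M N\<^esub> X \<in> carrier (quot_gmodule M N)"
    using a x by (auto simp: q(1,5))
  {
    fix b assume b: "b \<in> carrier R"
    show "(a \<oplus>\<^bsub>R\<^esub> b) \<odot>\<^bsub>quot_gmodule M N\<^esub> X =
        a \<odot>\<^bsub>quot_gmodule M N\<^esub> X \<oplus>\<^bsub>quot_gmodule M N\<^esub> b \<odot>\<^bsub>quot_gmodule M N\<^esub> X"
      using a b x by (simp add: q(4,5) M.smult_l_distr)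
    show "a \<otimes>\<^bsub>R\<^esub> b \<odot>\<^bsub>quot_gmodule M N\<^esub> X = a \<odot>\<^bsub>quot_gmodule M N\<^esub> (b \<odot>\<^bsub>quot_gmodule M N\<^esub> X)"
      using a b x by (simp add: q(4,5) M.smult_assoc1)
  }
  fix Y assume "Y \<in> carrier (quot_gmodule M N)"
  then obtain y where y: "y \<in> carrier M" "Y = N +>\<^bsub>M\<^esub> y" by (auto simp: q(1))
  show "a \<odot>\<^bsub>quot_gmodule M N\<^esub> (X \<oplus>\<^bsub>quot_gmodule M N\<^esub> Y) =
      a \<odot>\<^bsub>quot_gmodule M N\<^esub> X \<oplus>\<^bsub>quot_gmodule M N\<^esub> a \<odot>\<^bsub>quot_gmodule M N\<^esub> Y"
    using a x y by (simp add: q(4,5) M.smult_r_distr)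
next
  interpret M: module R M by fact
  fix X assume "X \<in> carrier (quot_gmodule M N)"
  then show "\<one>\<^bsub>R\<^esub> \<odot>\<^bsub>quot_gmodule M N\<^esub> X = X"
    by (auto simp: quot_gmodule_simps[OF assms])
qed

section \<open>Modules of homomorphisms\<close>

lemma hom_gmodule_simps [simp]:
  "carrier (hom_gmodule R A B) = lin_maps R A B \<inter> extensional (carrier A)"
  "\<zero>\<^bsub>hom_gmodule R A B\<^esub> = (\<lambda>x\<in>carrier A. \<zero>\<^bsub>B\<^esub>)"
  "f \<oplus>\<^bsub>hom_gmodule R A B\<^esub> g = (\<lambda>x\<in>carrier A. f x \<oplus>\<^bsub>B\<^esub> g x)"
  "a \<odot>\<^bsub>hom_gmodule R A B\<^esub> f = (\<lambda>x\<in>carrier A. a \<odot>\<^bsub>B\<^esub> f x)"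
  "gr (hom_gmodule R A B) n = lin_maps_deg R A B n \<inter> extensional (carrier A)"
  by (simp_all add: hom_gmodule_def)

lemma lin_maps_restrict:
  assumes "module R A" "f \<in> lin_maps R A B"
  shows "restrict f (carrier A) \<in> lin_maps R A B"
proof -
  interpret A: module R A by fact
  show ?thesis by (rule lin_mapsI) (simp_all add: lin_mapsD[OF assms(2)])
qed

lemma lin_maps_deg_restrict:
  assumes "graded_module R A" "f \<in> lin_maps_deg R A B n"
  shows "restrict f (carrier A) \<in> lin_maps_deg R A B n"
proof -
  interpret D: direct_sum A "gr A" by (rule graded_moduleD[OF assms(1)])
  show ?thesis
    by (rule lin_maps_degI[OF lin_maps_restrict[OF graded_moduleD(1)[OF assms(1)] lin_maps_degD(1)[OF assms(2)]]])
      (simp add: D.component_closed lin_maps_degD(2)[OF assms(2)])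
qed

lemma lin_maps_add:
  assumes "f \<in> lin_maps R A B" "g \<in> lin_maps R A B" "module R B"
  shows "(\<lambda>x. f x \<oplus>\<^bsub>B\<^esub> g x) \<in> lin_maps R A B"
proof -
  interpret B: module R B by fact
  show ?thesis
    by (rule lin_mapsI)
      (simp_all add: lin_mapsD[OF assms(1)] lin_mapsD[OF assms(2)] B.smult_r_distr B.M.a_ac)
qed

lemma lin_maps_const_zero:
  assumes "module R B"
  shows "(\<lambda>x. \<zero>\<^bsub>B\<^esub>) \<in> lin_maps R A B"
proof -
  interpret B: module R B by fact
  show ?thesis by (rule lin_mapsI) simp_all
qed

lemma hom_module:
  assumes "module R A" "module R B"
  shows "module R (hom_gmodule R A B)"
proof (rule moduleI)
  interpret A: module R A by fact
  interpret B: module R B by fact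
  note lin_maps_restrict[OF assms(1), intro]
  show "cring R" by (rule A.R.is_cring)
  show "abelian_group (hom_gmodule R A B)"
  proof (rule abelian_groupI)
    fix f assume f: "f \<in> carrier (hom_gmodule R A B)"
    then have fl: "f \<in> lin_maps R A B" and fe: "f \<in> extensional (carrier A)" by auto
    note fd = lin_mapsD[OF fl]
    \<comment> \<open>The negative is written as a scalar multiple, so that its linearity is an
      instance of \<open>lin_maps_smult\<close>.\<close>
    let ?g = "\<lambda>x\<in>carrier A. (\<ominus>\<^bsub>R\<^esub> \<one>\<^bsub>R\<^esub>) \<odot>\<^bsub>B\<^esub> f x"
    have "?g \<in> carrier (hom_gmodule R A B)"
      using lin_maps_smult[OF fl _ assms(2), of "\<ominus>\<^bsub>R\<^esub> \<one>\<^bsub>R\<^esub>"] by auto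
    moreover have "?g \<oplus>\<^bsub>hom_gmodule R A B\<^esub> f = \<zero>\<^bsub>hom_gmodule R A B\<^esub>"
      by (auto simp: fd B.smult_l_minus B.M.l_neg intro!: restrict_ext)
    ultimately show "\<exists>g\<in>carrier (hom_gmodule R A B). g \<oplus>\<^bsub>hom_gmodule R A B\<^esub> f = \<zero>\<^bsub>hom_gmodule R A B\<^esub>"
      by blast
    show "\<zero>\<^bsub>hom_gmodule R A B\<^esub> \<oplus>\<^bsub>hom_gmodule R A B\<^esub> f = f"
      by (rule extensionalityI[OF _ fe]) (auto simp: fd)
    fix g assume g: "g \<in> carrier (hom_gmodule R A B)"
    then have gl: "g \<in> lin_maps R A B" by auto
    note gd = lin_mapsD[OF gl]
    show "f \<oplus>\<^bsub>hom_gmodule R A B\<^esub> g \<in> carrier (hom_gmodule R A B)"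
      using lin_maps_add[OF fl gl assms(2)] by auto
    show "f \<oplus>\<^bsub>hom_gmodule R A B\<^esub> g = g \<oplus>\<^bsub>hom_gmodule R A B\<^esub> f"
      by (auto simp: fd gd B.M.a_comm intro!: restrict_ext)
    fix h assume h: "h \<in> carrier (hom_gmodule R A B)"
    then have hl: "h \<in> lin_maps R A B" by auto
    note hd = lin_mapsD[OF hl]
    show "f \<oplus>\<^bsub>hom_gmodule R A B\<^esub> g \<oplus>\<^bsub>hom_gmodule R A B\<^esub> h =
        f \<oplus>\<^bsub>hom_gmodule R A B\<^esub> (g \<oplus>\<^bsub>hom_gmodule R A B\<^esub> h)"
      by (auto simp: fd gd hd B.M.a_assoc intro!: restrict_ext)
  next
    show "\<zero>\<^bsub>hom_gmodule R A B\<^esub> \<in> carrier (hom_gmodule R A B)"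
      using lin_maps_const_zero[OF assms(2)] by auto
  qed
  fix a f assume a: "a \<in> carrier R" and f: "f \<in> carrier (hom_gmodule R A B)"
  then have fl: "f \<in> lin_maps R A B" and fe: "f \<in> extensional (carrier A)" by auto
  note fd = lin_mapsD[OF fl]
  show "a \<odot>\<^bsub>hom_gmodule R A B\<^esub> f \<in> carrier (hom_gmodule R A B)"
    using lin_maps_smult[OF fl a assms(2)] by auto
  {
    fix b assume b: "b \<in> carrier R"
    show "(a \<oplus>\<^bsub>R\<^esub> b) \<odot>\<^bsub>hom_gmodule R A B\<^esub> f =
        a \<odot>\<^bsub>hom_gmodule R A B\<^esub> f \<oplus>\<^bsub>hom_gmodule R A B\<^esub> b \<odot>\<^bsub>hom_gmodule R A B\<^esub> f"
      using a b by (auto simp: fd B.smult_l_distr intro!: restrict_ext)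
    show "a \<otimes>\<^bsub>R\<^esub> b \<odot>\<^bsub>hom_gmodule R A B\<^esub> f = a \<odot>\<^bsub>hom_gmodule R A B\<^esub> (b \<odot>\<^bsub>hom_gmodule R A B\<^esub> f)"
      using a b by (auto simp: fd B.smult_assoc1 intro!: restrict_ext)
  }
  fix g assume g: "g \<in> carrier (hom_gmodule R A B)"
  then have gl: "g \<in> lin_maps R A B" by auto
  show "a \<odot>\<^bsub>hom_gmodule R A B\<^esub> (f \<oplus>\<^bsub>hom_gmodule R A B\<^esub> g) =
      a \<odot>\<^bsub>hom_gmodule R A B\<^esub> f \<oplus>\<^bsub>hom_gmodule R A B\<^esub> a \<odot>\<^bsub>hom_gmodule R A B\<^esub> g"
    using a by (auto simp: fd lin_mapsD[OF gl] B.smult_r_distr intro!: restrict_ext)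
next
  interpret B: module R B by fact
  fix f assume "f \<in> carrier (hom_gmodule R A B)"
  then show "\<one>\<^bsub>R\<^esub> \<odot>\<^bsub>hom_gmodule R A B\<^esub> f = f"
    by (auto simp: lin_mapsD intro: extensionalityI)
qed

section \<open>Annihilators, associated primes and supports\<close>

text \<open>The type of this invariant does not mention the type of \<open>X\<close>, so modules
  carried by different types can be compared through it.\<close>

definition annihilators :: "'a gring \<Rightarrow> ('a, 'm) gmodule \<Rightarrow> int \<Rightarrow> 'a set set" where
  "annihilators R X n = (\<lambda>x. {a \<in> rgr R 0. a \<odot>\<^bsub>X\<^esub> x = \<zero>\<^bsub>X\<^esub>}) ` gr X n"

lemma gr_part_simps [simp]:
  "carrier (gr_part X n) = gr X n" "smult (gr_part X n) = smult X" "zero (gr_part X n) = zero X"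
  by (simp_all add: gr_part_def)

lemma deg0_ring_simps [simp]:
  "carrier (deg0_ring R) = rgr R 0" "mult (deg0_ring R) = mult R" "one (deg0_ring R) = one R"
  by (simp_all add: deg0_ring_def)

lemma Ass_gr_part:
  "Ass (deg0_ring R) (gr_part X n) = {p \<in> annihilators R X n. primeideal p (deg0_ring R)}"
  by (auto simp: Ass_def annihilators_def)

text \<open>A fraction \<open>x/s\<close> is zero iff some \<open>u\<close> outside \<open>p\<close>
  kills \<open>x\<close>, that is, iff the annihilator of \<open>x\<close> is not contained in
  \<open>p\<close>. So \<open>p\<close> lies in the support iff some element has its annihilator
  inside \<open>p\<close>.\<close>

lemma Supp_gr_part:
  assumes X: "module R X" and sub: "gr X n \<subseteq> carrier X" and R0: "rgr R 0 \<subseteq> carrier R"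
    and zero: "\<zero>\<^bsub>X\<^esub> \<in> gr X n" and sm: "\<And>a x. a \<in> rgr R 0 \<Longrightarrow> x \<in> gr X n \<Longrightarrow> a \<odot>\<^bsub>X\<^esub> x \<in> gr X n"
  shows "Supp (deg0_ring R) (gr_part X n) =
    {p. primeideal p (deg0_ring R) \<and> (\<exists>A\<in>annihilators R X n. A \<subseteq> p)}"
proof -
  interpret X: module R X by fact
  have "localization (deg0_ring R) (gr_part X n) p = {loc_rel (deg0_ring R) (gr_part X n) p `` {(\<zero>\<^bsub>X\<^esub>, \<one>\<^bsub>R\<^esub>)}}
      \<longleftrightarrow> (\<forall>x\<in>gr X n. \<exists>u\<in>rgr R 0 - p. u \<odot>\<^bsub>X\<^esub> x = \<zero>\<^bsub>X\<^esub>)" (is "?L = {?c} \<longleftrightarrow> ?T")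
    if p: "primeideal p (deg0_ring R)" for p
  proof -
    interpret p: primeideal p "deg0_ring R" by fact
    have oneR: "\<one>\<^bsub>R\<^esub> \<in> rgr R 0" using p.one_closed by simp
    have "\<one>\<^bsub>R\<^esub> \<notin> p" using p.one_imp_carrier p.I_notcarr by auto
    then have one: "\<one>\<^bsub>R\<^esub> \<in> rgr R 0 - p" using oneR by simp
    let ?r = "loc_rel (deg0_ring R) (gr_part X n) p"
    show ?thesis
    proof
      assume L: "?L = {?c}"
      show ?T
      proof
        fix x assume x: "x \<in> gr X n"
        have "?r `` {(x, \<one>\<^bsub>R\<^esub>)} \<in> ?L"
          unfolding localization_def using x one by (intro quotientI) simp
        then have "?r `` {(x, \<one>\<^bsub>R\<^esub>)} = ?c" using L by simp
        moreover have "(\<zero>\<^bsub>X\<^esub>, \<one>\<^bsub>R\<^esub>) \<in> ?c" using one zero by (auto simp: loc_rel_def)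
        ultimately have "((x, \<one>\<^bsub>R\<^esub>), (\<zero>\<^bsub>X\<^esub>, \<one>\<^bsub>R\<^esub>)) \<in> ?r" by blast
        then obtain u where u: "u \<in> rgr R 0 - p" "u \<odot>\<^bsub>X\<^esub> (\<one>\<^bsub>R\<^esub> \<odot>\<^bsub>X\<^esub> x) = u \<odot>\<^bsub>X\<^esub> (\<one>\<^bsub>R\<^esub> \<odot>\<^bsub>X\<^esub> \<zero>\<^bsub>X\<^esub>)"
          by (auto simp: loc_rel_def)
        have "u \<in> carrier R" "x \<in> carrier X" using u x R0 sub by auto
        then show "\<exists>u\<in>rgr R 0 - p. u \<odot>\<^bsub>X\<^esub> x = \<zero>\<^bsub>X\<^esub>" using u by auto
      qed
    next
      assume T: ?T
      \<comment> \<open>If \<open>u\<close> kills \<open>x\<close> and \<open>v\<close> kills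
        \<open>y\<close>, their product kills both and, \<open>p\<close> being prime, stays outside
        \<open>p\<close>. Hence any two fractions are equal.\<close>
      have "((x, s), (y, t)) \<in> ?r"
        if xy: "x \<in> gr X n" "y \<in> gr X n" and st: "s \<in> rgr R 0 - p" "t \<in> rgr R 0 - p" for x y s t
      proof -
        obtain u v where uv: "u \<in> rgr R 0 - p" "u \<odot>\<^bsub>X\<^esub> x = \<zero>\<^bsub>X\<^esub>" "v \<in> rgr R 0 - p" "v \<odot>\<^bsub>X\<^esub> y = \<zero>\<^bsub>X\<^esub>"
          using T xy by blast
        have c: "u \<in> carrier R" "v \<in> carrier R" "s \<in> carrier R" "t \<in> carrier R" "x \<in> carrier X" "y \<in> carrier X"
          using uv xy st R0 sub by auto
        have "u \<otimes>\<^bsub>R\<^esub> v \<in> rgr R 0 - p" using p.I_prime[of u v] p.m_closed[of u v] uv by auto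
        moreover have "(u \<otimes>\<^bsub>R\<^esub> v) \<odot>\<^bsub>X\<^esub> (t \<odot>\<^bsub>X\<^esub> x) = (v \<otimes>\<^bsub>R\<^esub> t) \<odot>\<^bsub>X\<^esub> (u \<odot>\<^bsub>X\<^esub> x)"
          using c by (simp add: X.R.m_ac flip: X.smult_assoc1)
        moreover have "(u \<otimes>\<^bsub>R\<^esub> v) \<odot>\<^bsub>X\<^esub> (s \<odot>\<^bsub>X\<^esub> y) = (u \<otimes>\<^bsub>R\<^esub> s) \<odot>\<^bsub>X\<^esub> (v \<odot>\<^bsub>X\<^esub> y)"
          using c by (simp add: X.R.m_ac flip: X.smult_assoc1)
        ultimately have w: "(u \<otimes>\<^bsub>R\<^esub> v) \<odot>\<^bsub>X\<^esub> (t \<odot>\<^bsub>X\<^esub> x) = (u \<otimes>\<^bsub>R\<^esub> v) \<odot>\<^bsub>X\<^esub> (s \<odot>\<^bsub>X\<^esub> y)"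
          "u \<otimes>\<^bsub>R\<^esub> v \<in> rgr R 0 - p"
          using uv c by simp_all
        then have "\<exists>w\<in>rgr R 0 - p. w \<odot>\<^bsub>X\<^esub> (t \<odot>\<^bsub>X\<^esub> x) = w \<odot>\<^bsub>X\<^esub> (s \<odot>\<^bsub>X\<^esub> y)" by blast
        then show ?thesis using xy st by (simp add: loc_rel_def)
      qed
      then have c: "?r `` {z} = gr X n \<times> (rgr R 0 - p)" if "z \<in> gr X n \<times> (rgr R 0 - p)" for z
        using that by (auto simp add: loc_rel_def)
      have z0: "(\<zero>\<^bsub>X\<^esub>, \<one>\<^bsub>R\<^esub>) \<in> gr X n \<times> (rgr R 0 - p)" using zero one by blast
      have "?L = (\<lambda>z. ?r `` {z}) ` (gr X n \<times> (rgr R 0 - p))"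
        unfolding localization_def quotient_def by auto
      also have "\<dots> = {gr X n \<times> (rgr R 0 - p)}" using c z0 by (auto simp: image_iff)
      finally show "?L = {?c}" using c[OF z0] by simp
    qed
  qed
  moreover have "(\<exists>A\<in>annihilators R X n. A \<subseteq> p) \<longleftrightarrow>
      \<not> (\<forall>x\<in>gr X n. \<exists>u\<in>rgr R 0 - p. u \<odot>\<^bsub>X\<^esub> x = \<zero>\<^bsub>X\<^esub>)" for p
    by (auto simp: annihilators_def)
  ultimately show ?thesis
    unfolding Supp_def gr_part_simps deg0_ring_simps by (simp cong: conj_cong)
qed

text \<open>\<open>\<one>\<close> kills only the zero element, so vanishing of a component can be
  read off its annihilators.\<close>

lemma gr_zero_iff_annihilators:
  assumes "module R X" "gr X n \<subseteq> carrier X" "\<one>\<^bsub>R\<^esub> \<in> rgr R 0" "\<zero>\<^bsub>X\<^esub> \<in> gr X n"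
  shows "gr X n = {\<zero>\<^bsub>X\<^esub>} \<longleftrightarrow> (\<forall>A\<in>annihilators R X n. \<one>\<^bsub>R\<^esub> \<in> A)"
proof -
  interpret X: module R X by fact
  have one: "\<one>\<^bsub>R\<^esub> \<odot>\<^bsub>X\<^esub> x = x" if "x \<in> gr X n" for x using assms(2) that by (intro X.smult_one) blast
  have "gr X n = {\<zero>\<^bsub>X\<^esub>} \<longleftrightarrow> (\<forall>x\<in>gr X n. x = \<zero>\<^bsub>X\<^esub>)" using assms(4) by blast
  also have "\<dots> \<longleftrightarrow> (\<forall>x\<in>gr X n. \<one>\<^bsub>R\<^esub> \<odot>\<^bsub>X\<^esub> x = \<zero>\<^bsub>X\<^esub>)" by (simp add: one)
  also have "\<dots> \<longleftrightarrow> (\<forall>A\<in>annihilators R X n. \<one>\<^bsub>R\<^esub> \<in> A)"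
    using assms(3) by (simp add: annihilators_def)
  finally show ?thesis .
qed

section \<open>Graded free modules\<close>

lemma lin_maps_eqI:
  assumes "graded_module R A" "f \<in> lin_maps R A B" "g \<in> lin_maps R A B"
    and "\<And>k x. x \<in> gr A k \<Longrightarrow> f x = g x" and "x \<in> carrier A"
  shows "f x = g x"
proof -
  interpret D: direct_sum A "gr A" by (rule graded_moduleD[OF assms(1)])
  show ?thesis using assms(5)
    by (induct rule: D.homogeneous_induct)
      (simp_all add: assms(4) lin_mapsD[OF assms(2)] lin_mapsD[OF assms(3)])
qed

text \<open>Universal property of free modules: coordinates with respect to \<open>B\<close> are
  unique, hence depend linearly on the vector, and the map can be defined coordinatewise.\<close>

lemma free_module_lift:
  assumes F: "module R F" and Y: "module R Y" and B: "finite B" "B \<subseteq> carrier F"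
    and ex1: "\<And>x. x \<in> carrier F \<Longrightarrow>
      \<exists>!c. c \<in> B \<rightarrow>\<^sub>E carrier R \<and> x = (\<Oplus>\<^bsub>F\<^esub>b\<in>B. c b \<odot>\<^bsub>F\<^esub> b)"
    and \<phi>: "\<And>b. b \<in> B \<Longrightarrow> \<phi> b \<in> carrier Y"
  shows "\<exists>f\<in>lin_maps R F Y. \<forall>b\<in>B. f b = \<phi> b"
proof -
  interpret F: module R F by fact
  interpret Y: module R Y by fact
  define cf where "cf x = (THE c. c \<in> B \<rightarrow>\<^sub>E carrier R \<and> x = (\<Oplus>\<^bsub>F\<^esub>b\<in>B. c b \<odot>\<^bsub>F\<^esub> b))" for x
  have cf: "cf x \<in> B \<rightarrow>\<^sub>E carrier R" "x = (\<Oplus>\<^bsub>F\<^esub>b\<in>B. cf x b \<odot>\<^bsub>F\<^esub> b)" if "x \<in> carrier F" for x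
    using theI'[OF ex1[OF that]] unfolding cf_def by blast+
  have cfc: "cf x b \<in> carrier R" if "x \<in> carrier F" "b \<in> B" for x b
    using PiE_mem[OF cf(1)[OF that(1)] that(2)] .
  have cf_eq: "cf x = c" if "x \<in> carrier F" "c \<in> B \<rightarrow>\<^sub>E carrier R" "x = (\<Oplus>\<^bsub>F\<^esub>b\<in>B. c b \<odot>\<^bsub>F\<^esub> b)" for x c
    unfolding cf_def by (rule the1_equality[OF ex1[OF that(1)]]) (use that in blast)
  have Bc: "b \<in> carrier F" if "b \<in> B" for b using B(2) that by blast
  define f where "f x = (\<Oplus>\<^bsub>Y\<^esub>b\<in>B. cf x b \<odot>\<^bsub>Y\<^esub> \<phi> b)" for x
  have "f \<in> lin_maps R F Y"
  proof (rule lin_mapsI)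
    fix x assume x: "x \<in> carrier F"
    show "f x \<in> carrier Y" unfolding f_def by (rule Y.M.finsum_closed) (simp add: cfc x \<phi>)
    fix y assume y: "y \<in> carrier F"
    have "cf (x \<oplus>\<^bsub>F\<^esub> y) = (\<lambda>b\<in>B. cf x b \<oplus>\<^bsub>R\<^esub> cf y b)"
    proof (rule cf_eq)
      have "x \<oplus>\<^bsub>F\<^esub> y = (\<Oplus>\<^bsub>F\<^esub>b\<in>B. cf x b \<odot>\<^bsub>F\<^esub> b) \<oplus>\<^bsub>F\<^esub> (\<Oplus>\<^bsub>F\<^esub>b\<in>B. cf y b \<odot>\<^bsub>F\<^esub> b)"
        using cf(2)[OF x] cf(2)[OF y] by simp
      also have "\<dots> = (\<Oplus>\<^bsub>F\<^esub>b\<in>B. cf x b \<odot>\<^bsub>F\<^esub> b \<oplus>\<^bsub>F\<^esub> cf y b \<odot>\<^bsub>F\<^esub> b)"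
        by (rule F.M.finsum_addf[symmetric]) (simp_all add: Pi_I Bc cfc x y)
      also have "\<dots> = (\<Oplus>\<^bsub>F\<^esub>b\<in>B. (\<lambda>b\<in>B. cf x b \<oplus>\<^bsub>R\<^esub> cf y b) b \<odot>\<^bsub>F\<^esub> b)"
        by (rule F.M.finsum_cong') (simp_all add: Pi_I Bc cfc x y F.smult_l_distr)
      finally show "x \<oplus>\<^bsub>F\<^esub> y = (\<Oplus>\<^bsub>F\<^esub>b\<in>B. (\<lambda>b\<in>B. cf x b \<oplus>\<^bsub>R\<^esub> cf y b) b \<odot>\<^bsub>F\<^esub> b)" .
    qed (simp_all add: x y cfc)
    then have "f (x \<oplus>\<^bsub>F\<^esub> y) = (\<Oplus>\<^bsub>Y\<^esub>b\<in>B. cf x b \<odot>\<^bsub>Y\<^esub> \<phi> b \<oplus>\<^bsub>Y\<^esub> cf y b \<odot>\<^bsub>Y\<^esub> \<phi> b)"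
      unfolding f_def by (intro Y.M.finsum_cong') (simp_all add: Pi_I \<phi> cfc x y Y.smult_l_distr)
    also have "\<dots> = f x \<oplus>\<^bsub>Y\<^esub> f y"
      unfolding f_def by (rule Y.M.finsum_addf) (simp_all add: Pi_I \<phi> cfc x y)
    finally show "f (x \<oplus>\<^bsub>F\<^esub> y) = f x \<oplus>\<^bsub>Y\<^esub> f y" .
  next
    fix a x assume a: "a \<in> carrier R" and x: "x \<in> carrier F"
    have "cf (a \<odot>\<^bsub>F\<^esub> x) = (\<lambda>b\<in>B. a \<otimes>\<^bsub>R\<^esub> cf x b)"
    proof (rule cf_eq)
      have "a \<odot>\<^bsub>F\<^esub> x = a \<odot>\<^bsub>F\<^esub> (\<Oplus>\<^bsub>F\<^esub>b\<in>B. cf x b \<odot>\<^bsub>F\<^esub> b)"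
        using cf(2)[OF x] by simp
      also have "\<dots> = (\<Oplus>\<^bsub>F\<^esub>b\<in>B. a \<odot>\<^bsub>F\<^esub> (cf x b \<odot>\<^bsub>F\<^esub> b))"
        by (rule F.finsum_smult_ldistr) (simp_all add: Pi_I Bc cfc x a B)
      also have "\<dots> = (\<Oplus>\<^bsub>F\<^esub>b\<in>B. (\<lambda>b\<in>B. a \<otimes>\<^bsub>R\<^esub> cf x b) b \<odot>\<^bsub>F\<^esub> b)"
        by (rule F.M.finsum_cong') (simp_all add: Pi_I Bc cfc x a F.smult_assoc1)
      finally show "a \<odot>\<^bsub>F\<^esub> x = (\<Oplus>\<^bsub>F\<^esub>b\<in>B. (\<lambda>b\<in>B. a \<otimes>\<^bsub>R\<^esub> cf x b) b \<odot>\<^bsub>F\<^esub> b)" .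
    qed (simp_all add: x a cfc)
    then have "f (a \<odot>\<^bsub>F\<^esub> x) = (\<Oplus>\<^bsub>Y\<^esub>b\<in>B. a \<odot>\<^bsub>Y\<^esub> (cf x b \<odot>\<^bsub>Y\<^esub> \<phi> b))"
      unfolding f_def by (intro Y.M.finsum_cong') (simp_all add: Pi_I \<phi> cfc x a Y.smult_assoc1)
    also have "\<dots> = a \<odot>\<^bsub>Y\<^esub> f x"
      unfolding f_def by (rule Y.finsum_smult_ldistr[symmetric]) (simp_all add: Pi_I \<phi> cfc x a B)
    finally show "f (a \<odot>\<^bsub>F\<^esub> x) = a \<odot>\<^bsub>Y\<^esub> f x" .
  qed
  moreover have "f b = \<phi> b" if b: "b \<in> B" for b
  proof -
    \<comment> \<open>The coordinates of a basis element are given by the Kronecker delta, so only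
      the summand \<open>\<phi> b\<close> survives.\<close>
    have "cf b = (\<lambda>b'\<in>B. if b = b' then \<one>\<^bsub>R\<^esub> else \<zero>\<^bsub>R\<^esub>)"
    proof (rule cf_eq[OF Bc[OF b]])
      have "b = (\<Oplus>\<^bsub>F\<^esub>b'\<in>B. if b = b' then b' else \<zero>\<^bsub>F\<^esub>)"
        by (rule F.M.finsum_singleton[symmetric]) (use b B in \<open>simp_all add: Pi_I Bc\<close>)
      also have "\<dots> = (\<Oplus>\<^bsub>F\<^esub>b'\<in>B. (\<lambda>b'\<in>B. if b = b' then \<one>\<^bsub>R\<^esub> else \<zero>\<^bsub>R\<^esub>) b' \<odot>\<^bsub>F\<^esub> b')"
        by (rule F.M.finsum_cong') (simp_all add: Pi_I Bc)
      finally show "b = (\<Oplus>\<^bsub>F\<^esub>b'\<in>B. (\<lambda>b'\<in>B. if b = b' then \<one>\<^bsub>R\<^esub> else \<zero>\<^bsub>R\<^esub>) b' \<odot>\<^bsub>F\<^esub> b')" .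
    qed simp
    then have "f b = (\<Oplus>\<^bsub>Y\<^esub>b'\<in>B. if b = b' then \<phi> b' else \<zero>\<^bsub>Y\<^esub>)"
      unfolding f_def by (intro Y.M.finsum_cong') (simp_all add: Pi_I \<phi>)
    also have "\<dots> = \<phi> b"
      by (rule Y.M.finsum_singleton) (use b B in \<open>simp_all add: Pi_I \<phi>\<close>)
    finally show ?thesis .
  qed
  ultimately show ?thesis by blast
qed

text \<open>Serves two purposes: two linear maps that agree on a basis agree everywhere, and a
  submodule that contains a basis is the whole module.\<close>

lemma finsum_span_induct:
  assumes F: "module R F" and B: "finite B" "B \<subseteq> carrier F" and c: "\<And>b. b \<in> B \<Longrightarrow> c b \<in> carrier R"
    and zero: "Q \<zero>\<^bsub>F\<^esub>" and gen: "\<And>a b. a \<in> carrier R \<Longrightarrow> b \<in> B \<Longrightarrow> Q (a \<odot>\<^bsub>F\<^esub> b)"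
    and add: "\<And>x y. x \<in> carrier F \<Longrightarrow> y \<in> carrier F \<Longrightarrow> Q x \<Longrightarrow> Q y \<Longrightarrow> Q (x \<oplus>\<^bsub>F\<^esub> y)"
  shows "Q (\<Oplus>\<^bsub>F\<^esub>b\<in>B. c b \<odot>\<^bsub>F\<^esub> b)"
proof -
  interpret F: module R F by fact
  have "Q (\<Oplus>\<^bsub>F\<^esub>b\<in>C. c b \<odot>\<^bsub>F\<^esub> b)" if "C \<subseteq> B" for C
    using finite_subset[OF that B(1)] that
  proof induct
    case empty
    show ?case using zero by simp
  next
    case (insert b C)
    have bc: "c b \<odot>\<^bsub>F\<^esub> b \<in> carrier F" "c b \<in> carrier R" using insert B(2) c by auto
    have C: "(\<lambda>b. c b \<odot>\<^bsub>F\<^esub> b) \<in> C \<rightarrow> carrier F" using insert B(2) c by auto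
    have "Q (c b \<odot>\<^bsub>F\<^esub> b \<oplus>\<^bsub>F\<^esub> (\<Oplus>\<^bsub>F\<^esub>b\<in>C. c b \<odot>\<^bsub>F\<^esub> b))"
      using insert by (intro add gen bc F.M.finsum_closed C) auto
    then show ?case using F.M.finsum_insert[OF insert(1,2) C bc(1)] by simp
  qed
  then show ?thesis by blast
qed

lemma fin_graded_freeE:
  assumes "fin_graded_free R F"
  obtains B where "graded_module R F" "finite B" "B \<subseteq> (\<Union>n. gr F n)" "B \<subseteq> carrier F"
    "\<forall>x\<in>carrier F. \<exists>!c. c \<in> B \<rightarrow>\<^sub>E carrier R \<and> x = (\<Oplus>\<^bsub>F\<^esub>b\<in>B. c b \<odot>\<^bsub>F\<^esub> b)"
proof -
  have g: "graded_module R F" using assms by (simp add: fin_graded_free_def)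
  interpret D: direct_sum F "gr F" by (rule graded_moduleD[OF g])
  obtain B where B: "finite B" "B \<subseteq> (\<Union>n. gr F n)"
    "\<forall>x\<in>carrier F. \<exists>!c. c \<in> B \<rightarrow>\<^sub>E carrier R \<and> x = (\<Oplus>\<^bsub>F\<^esub>b\<in>B. c b \<odot>\<^bsub>F\<^esub> b)"
    using assms unfolding fin_graded_free_def by blast
  have "B \<subseteq> carrier F" using B(2) D.component_closed by blast
  then show ?thesis by (rule that[OF g B(1,2) _ B(3)])
qed

text \<open>Preimages under \<open>q\<close> are chosen for the basis elements only. The linear
  extension of this choice is a lift because both sides are linear and agree on the basis.\<close>

lemma free_module_projective:
  assumes "fin_graded_free R F" "module R X" "module R Y"
    and f: "f \<in> lin_maps R F Y" and q: "q \<in> lin_maps R X Y" and "q ` carrier X = carrier Y"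
  shows "\<exists>g\<in>lin_maps R F X. \<forall>x\<in>carrier F. q (g x) = f x"
proof -
  obtain B where g: "graded_module R F" and B: "finite B" "B \<subseteq> (\<Union>n. gr F n)" "B \<subseteq> carrier F"
    and ex1: "\<forall>x\<in>carrier F. \<exists>!c. c \<in> B \<rightarrow>\<^sub>E carrier R \<and> x = (\<Oplus>\<^bsub>F\<^esub>b\<in>B. c b \<odot>\<^bsub>F\<^esub> b)"
    by (rule fin_graded_freeE[OF assms(1)])
  have F: "module R F" by (rule graded_moduleD[OF g])
  interpret F: module R F by fact
  note B = B(1,3)
  have Bc: "b \<in> carrier F" if "b \<in> B" for b using B(2) that by blast
  have "\<exists>y. y \<in> carrier X \<and> q y = f b" if "b \<in> B" for b
    using lin_mapsD(1)[OF f Bc[OF that]] assms(6) by (metis imageE)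
  then obtain \<phi> where \<phi>: "\<And>b. b \<in> B \<Longrightarrow> \<phi> b \<in> carrier X" "\<And>b. b \<in> B \<Longrightarrow> q (\<phi> b) = f b" by metis
  have "\<exists>h\<in>lin_maps R F X. \<forall>b\<in>B. h b = \<phi> b"
    by (rule free_module_lift[OF F assms(2) B]) (rule bspec[OF ex1] \<phi>(1); assumption)+
  then obtain h where h: "h \<in> lin_maps R F X" "\<forall>b\<in>B. h b = \<phi> b" by blast
  have "q (h x) = f x" if x: "x \<in> carrier F" for x
  proof -
    obtain c where c: "c \<in> B \<rightarrow>\<^sub>E carrier R" "x = (\<Oplus>\<^bsub>F\<^esub>b\<in>B. c b \<odot>\<^bsub>F\<^esub> b)" using bspec[OF ex1 x] by blast
    have "q (h (\<Oplus>\<^bsub>F\<^esub>b\<in>B. c b \<odot>\<^bsub>F\<^esub> b)) = f (\<Oplus>\<^bsub>F\<^esub>b\<in>B. c b \<odot>\<^bsub>F\<^esub> b)"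
    proof (rule finsum_span_induct[OF F B, where Q = "\<lambda>x. q (h x) = f x"])
      show "q (h \<zero>\<^bsub>F\<^esub>) = f \<zero>\<^bsub>F\<^esub>"
        using lin_maps_zero F assms(2,3) f q h(1) by metis
    next
      fix a b assume "a \<in> carrier R" "b \<in> B"
      then show "q (h (a \<odot>\<^bsub>F\<^esub> b)) = f (a \<odot>\<^bsub>F\<^esub> b)"
        by (simp add: lin_mapsD[OF h(1)] lin_mapsD[OF q] lin_mapsD[OF f] Bc h(2) \<phi>)
    next
      fix x y assume "x \<in> carrier F" "y \<in> carrier F" "q (h x) = f x" "q (h y) = f y"
      then show "q (h (x \<oplus>\<^bsub>F\<^esub> y)) = f (x \<oplus>\<^bsub>F\<^esub> y)"
        by (simp add: lin_mapsD[OF h(1)] lin_mapsD[OF q] lin_mapsD[OF f])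
    qed (use c(1) in auto)
    then show ?thesis using c(2) by simp
  qed
  then show ?thesis using h(1) by blast
qed

text \<open>A lift without regard to degrees exists. As \<open>q\<close> has degree 0, it commutes
  with taking components, so the part of degree \<open>n\<close> of that lift is still a lift of
  \<open>f\<close>.\<close>

lemma graded_free_projective:
  assumes "fin_graded_free R F" "graded_ring R" "graded_module R X" "graded_module R Y"
    and f: "f \<in> lin_maps_deg R F Y n" and q: "q \<in> lin_maps_deg R X Y 0"
    and "q ` carrier X = carrier Y"
  shows "\<exists>g\<in>lin_maps_deg R F X n. \<forall>x\<in>carrier F. q (g x) = f x"
proof -
  have F: "graded_module R F" using assms(1) by (simp add: fin_graded_free_def)
  interpret DY: direct_sum Y "gr Y" by (rule graded_moduleD[OF assms(4)])
  interpret DF: direct_sum F "gr F" by (rule graded_moduleD[OF F])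
  obtain h where h: "h \<in> lin_maps R F X" "\<And>x. x \<in> carrier F \<Longrightarrow> q (h x) = f x"
    using free_module_projective[OF assms(1) graded_moduleD(1)[OF assms(3)] graded_moduleD(1)[OF assms(4)]
        lin_maps_degD(1)[OF f] lin_maps_degD(1)[OF q] assms(7)] by blast
  obtain g where g: "g \<in> lin_maps_deg R F X n" "\<forall>k. \<forall>x\<in>gr F k. g x = hc X (k + n) (h x)"
    using homogeneous_part[OF h(1) F assms(3,2)] by blast
  have "q (g x) = f x" if "x \<in> carrier F" for x
  proof (rule lin_maps_eqI[OF F lin_maps_comp[OF lin_maps_degD(1)[OF g(1)] lin_maps_degD(1)[OF q]]
        lin_maps_degD(1)[OF f] _ that])
    fix k x assume x: "x \<in> gr F k"
    then have xc: "x \<in> carrier F" by (rule DF.component_closed)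
    have "q (g x) = q (hc X (k + n) (h x))" using g(2) x by simp
    also have "\<dots> = hc Y (k + n) (q (h x))"
      using lin_maps_deg_hc[OF q assms(3,4) lin_mapsD(1)[OF h(1) xc], of "k + n"] by simp
    also have "\<dots> = f x"
      using h(2)[OF xc] DY.hcomp_same[OF lin_maps_degD(2)[OF f x]] by simp
    finally show "q (g x) = f x" .
  qed
  then show ?thesis using g(1) by blast
qed

section \<open>Graded rings and the graded Baer criterion\<close>

lemma (in direct_sum) mem_of_hcomp_mem:
  assumes "additive_subgroup S G" "x \<in> carrier G" "\<And>i. hcomp G C i x \<in> S"
  shows "x \<in> S"
proof -
  interpret S: additive_subgroup S G by fact
  have "(\<Oplus>i\<in>F. hcomp G C i x) \<in> S" if "finite F" for F
    using that
  proof induct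
    case (insert i F)
    then show ?case using assms(2,3) by (subst finsum_insert) auto
  qed simp
  from this[OF hcomp_props(2)[OF assms(2)]] show ?thesis using hcomp_props(3)[OF assms(2)] by simp
qed

abbreviation rc :: "'a gring \<Rightarrow> nat \<Rightarrow> 'a \<Rightarrow> 'a" where
  "rc R i x \<equiv> hcomp R (rgr R) i x"

locale graded_cring = cring R + D: direct_sum R "rgr R" for R :: "'a gring" (structure) +
  assumes graded: "graded_ring R"

lemma graded_cringI: "graded_ring R \<Longrightarrow> graded_cring R"
  by (intro graded_cring.intro graded_cring_axioms.intro graded_ringD)

context graded_cring
begin

lemma mult_deg: "a \<in> rgr R i \<Longrightarrow> b \<in> rgr R j \<Longrightarrow> a \<otimes> b \<in> rgr R (i + j)"
  by (rule graded_ringD(3)[OF graded])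

lemma rgr_closed: "a \<in> rgr R i \<Longrightarrow> a \<in> carrier R"
  by (rule D.component_closed)

text \<open>The case distinction absorbs truncated subtraction: \<open>n - i\<close> is a natural
  number, and a multiple of an element of degree \<open>i\<close> has no component below degree
  \<open>i\<close>.\<close>

lemma rc_mult:
  assumes "a \<in> rgr R i" "x \<in> carrier R"
  shows "rc R n (a \<otimes> x) = (if i \<le> n then a \<otimes> rc R (n - i) x else \<zero>)"
  using assms(2)
proof (induct rule: D.homogeneous_induct)
  case (homogeneous j x)
  have "rc R n (a \<otimes> x) = (if n = i + j then a \<otimes> x else \<zero>)"
    using D.hcomp_component[OF mult_deg[OF assms(1) homogeneous]] .
  moreover have "rc R (n - i) x = (if n - i = j then x else \<zero>)"
    using D.hcomp_component[OF homogeneous] .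
  ultimately show ?case using rgr_closed[OF assms(1)] by auto
next
  case (add x y)
  then show ?case using rgr_closed[OF assms(1)] by (simp add: r_distr D.hcomp_add)
qed

text \<open>Not part of \<open>graded_ring\<close>, but automatic: comparing components of degree
  \<open>i\<close> in \<open>a \<otimes> \<one> = a\<close> for homogeneous \<open>a\<close> shows
  that the degree 0 component of \<open>\<one>\<close> is itself a unit element.\<close>

lemma one_deg0: "\<one> \<in> rgr R 0"
proof -
  let ?e = "rc R 0 \<one>"
  have "a \<otimes> ?e = a" if "a \<in> carrier R" for a
    using that
  proof (induct rule: D.homogeneous_induct)
    case (homogeneous i a)
    show ?case
      using rc_mult[OF homogeneous one_closed, of i] rgr_closed[OF homogeneous]
        D.hcomp_same[OF homogeneous] by simp
  next
    case (add a b)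
    then show ?case by (simp add: l_distr)
  qed
  from this[OF one_closed] have "?e = \<one>" by simp
  then show ?thesis using D.hcomp_props(1)[OF one_closed, of 0] by simp
qed

lemma nat_pow_deg: "a \<in> rgr R i \<Longrightarrow> a [^] (k::nat) \<in> rgr R (k * i)"
proof (induct k)
  case (Suc k)
  then show ?case using mult_deg[of "a [^] k" "k * i" a i] by (simp add: add.commute)
qed (simp add: one_deg0)

text \<open>The graded module usually written \<open>R(-n)\<close>, generated in degree \<open>n\<close>.\<close>

definition shifted :: "int \<Rightarrow> ('a, 'a) gmodule" where
  "shifted n = (regular_gmodule R)\<lparr>gr := (\<lambda>k. if k < n then {\<zero>} else rgr R (nat (k - n)))\<rparr>"

lemma shifted_simps [simp]:
  "carrier (shifted n) = carrier R" "add (shifted n) = add R" "zero (shifted n) = \<zero>"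
  "smult (shifted n) = mult R" "gr (shifted n) k = (if k < n then {\<zero>} else rgr R (nat (k - n)))"
  by (simp_all add: shifted_def regular_gmodule_def)

lemma regular_eq_shifted: "regular_gmodule R = shifted 0"
  by (simp add: shifted_def regular_gmodule_def cong: if_cong)

lemma shifted_module: "module R (shifted n)"
proof (rule moduleI)
  show "abelian_group (shifted n)"
  proof (rule abelian_groupI)
    fix x assume "x \<in> carrier (shifted n)"
    then show "\<exists>y\<in>carrier (shifted n). y \<oplus>\<^bsub>shifted n\<^esub> x = \<zero>\<^bsub>shifted n\<^esub>"
      using l_neg[of x] a_inv_closed[of x] unfolding shifted_simps by blast
  qed (simp_all add: a_assoc, simp add: a_comm)
qed (simp_all add: l_distr r_distr m_assoc is_cring)

lemma shifted_a_inv: "x \<in> carrier R \<Longrightarrow> \<ominus>\<^bsub>shifted n\<^esub> x = \<ominus> x"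
proof -
  interpret S: module R "shifted n" by (rule shifted_module)
  show "x \<in> carrier R \<Longrightarrow> ?thesis"
    using S.M.minus_equality[of "\<ominus> x" x] by (simp add: l_neg)
qed

lemma shifted_graded: "graded_module R (shifted n)"
proof -
  interpret S: module R "shifted n" by (rule shifted_module)
  have "internal_direct_sum (shifted n) (gr (shifted n))"
  proof (rule S.M.internal_direct_sumI[where \<pi> = "\<lambda>k x. if k < n then \<zero> else rc R (nat (k - n)) x"])
    fix k
    have "subgroup (gr (shifted n) k) (add_monoid (shifted n))"
    proof (rule S.M.add.subgroupI)
      have "\<zero> \<in> gr (shifted n) k" by simp
      then show "gr (shifted n) k \<noteq> {}" by blast
      show "gr (shifted n) k \<subseteq> carrier (shifted n)" by (auto simp: rgr_closed)
    next
      fix x assume x: "x \<in> gr (shifted n) k"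
      then have "x \<in> carrier R" by (auto simp: rgr_closed split: if_splits)
      then show "\<ominus>\<^bsub>shifted n\<^esub> x \<in> gr (shifted n) k"
        using x D.component_minus by (auto simp: shifted_a_inv split: if_splits)
    next
      fix x y assume "x \<in> gr (shifted n) k" "y \<in> gr (shifted n) k"
      then show "x \<oplus>\<^bsub>shifted n\<^esub> y \<in> gr (shifted n) k"
        using D.component_add by (auto split: if_splits)
    qed
    then show "additive_subgroup (gr (shifted n) k) (shifted n)" by (rule additive_subgroup.intro)
  next
    fix x assume x: "x \<in> carrier (shifted n)"
    \<comment> \<open>The projection to degree \<open>k \<ge> n\<close> is the ring component of
      degree \<open>k - n\<close>, so the support is that of \<open>x\<close> translated by
      \<open>n\<close>.\<close>
    have "{k. (if k < n then \<zero> else rc R (nat (k - n)) x) \<noteq> \<zero>\<^bsub>shifted n\<^esub>}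
        \<subseteq> (\<lambda>i. int i + n) ` {i. rc R i x \<noteq> \<zero>}"
    proof
      fix k assume "k \<in> {k. (if k < n then \<zero> else rc R (nat (k - n)) x) \<noteq> \<zero>\<^bsub>shifted n\<^esub>}"
      then have "k = int (nat (k - n)) + n" "nat (k - n) \<in> {i. rc R i x \<noteq> \<zero>}"
        by (auto split: if_splits)
      then show "k \<in> (\<lambda>i. int i + n) ` {i. rc R i x \<noteq> \<zero>}" by (rule image_eqI)
    qed
    then show "finite {k. (if k < n then \<zero> else rc R (nat (k - n)) x) \<noteq> \<zero>\<^bsub>shifted n\<^esub>}"
      by (rule finite_subset) (use D.hcomp_props(2)[of x] x in simp)
  next
    fix x assume x: "x \<in> carrier (shifted n)"
      and z: "\<And>k. (if k < n then \<zero> else rc R (nat (k - n)) x) = \<zero>\<^bsub>shifted n\<^esub>"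
    have rz: "rc R i x = \<zero>" for i using z[of "int i + n"] by simp
    have "x = \<zero>" by (rule D.hcomp_all_zero[OF _ rz]) (use x in simp)
    then show "x = \<zero>\<^bsub>shifted n\<^esub>" by simp
  next
    fix i j x assume "x \<in> gr (shifted n) i" "i \<noteq> j"
    then show "(if j < n then \<zero> else rc R (nat (j - n)) x) = \<zero>\<^bsub>shifted n\<^esub>"
      using D.hcomp_component[of x "nat (i - n)" "nat (j - n)"] by (auto split: if_splits)
  qed (auto simp: D.hcomp_add D.hcomp_props split: if_splits)
  moreover have "a \<odot>\<^bsub>shifted n\<^esub> x \<in> gr (shifted n) (int i + k)"
    if "a \<in> rgr R i" "x \<in> gr (shifted n) k" for a x i k
  proof (cases "k < n")
    case True
    then show ?thesis using that rgr_closed D.component_zero by simp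
  next
    case False
    then have "nat (int i + k - n) = i + nat (k - n)" by simp
    then show ?thesis using that False mult_deg[of a i x "nat (k - n)"] by simp
  qed
  ultimately show ?thesis unfolding graded_module_def using S.module_axioms by blast
qed

lemma hc_shifted:
  assumes "x \<in> carrier R"
  shows "hc (shifted n) k x = (if k < n then \<zero> else rc R (nat (k - n)) x)"
proof -
  interpret DS: direct_sum "shifted n" "gr (shifted n)" by (rule graded_moduleD[OF shifted_graded])
  show ?thesis
  proof (rule DS.hcomp_unique)
    fix j x assume "x \<in> gr (shifted n) j"
    then show "(if k < n then \<zero> else rc R (nat (k - n)) x) = (if k = j then x else \<zero>\<^bsub>shifted n\<^esub>)"
      using D.hcomp_component[of x "nat (j - n)" "nat (k - n)"] by (auto split: if_splits)
  qed (use assms in \<open>simp_all add: D.hcomp_add\<close>)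
qed

definition homogeneous_ideal :: "'a set \<Rightarrow> bool" where
  "homogeneous_ideal J \<longleftrightarrow> ideal J R \<and> (\<forall>x\<in>J. \<forall>i. rc R i x \<in> J)"

text \<open>A twist only renames degrees: the components of an element of \<open>shifted n\<close>
  are its ring components. Hence \<open>n\<close> is arbitrary here, and an ideal found to be
  homogeneous in one twist may be used in any other.\<close>

lemma homogeneous_ideal_iff: "homogeneous_ideal J \<longleftrightarrow> homogeneous_submodule R (shifted n) J"
proof
  assume J: "homogeneous_ideal J"
  interpret J: ideal J R using J by (simp add: homogeneous_ideal_def)
  show "homogeneous_submodule R (shifted n) J"
  proof (rule homogeneous_submoduleI[OF shifted_module])
    fix x k assume "x \<in> J"
    then show "hc (shifted n) k x \<in> J" using J by (simp add: hc_shifted homogeneous_ideal_def)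
  qed (auto simp: J.I_l_closed)
next
  assume "homogeneous_submodule R (shifted n) J"
  note J = homogeneous_submoduleD[OF shifted_module this]
  have Jc: "x \<in> carrier R" if "x \<in> J" for x using J(2) that by auto
  have "ideal J R"
  proof (rule idealI)
    show "ring R" by (rule ring_axioms)
    show "subgroup J (add_monoid R)"
    proof (rule add.subgroupI)
      show "\<ominus> x \<in> J" if "x \<in> J" for x using J(4)[OF that] shifted_a_inv[OF Jc[OF that]] by simp
    qed (use J in auto)
    show "x \<otimes> a \<in> J" "a \<otimes> x \<in> J" if "a \<in> J" "x \<in> carrier R" for a x
      using J(6)[OF that(2,1)] m_comm[OF that(2) Jc[OF that(1)]] by simp_all
  qed
  moreover have "rc R i x \<in> J" if "x \<in> J" for x i
    using J(7)[OF that, of "int i + n"] hc_shifted[OF Jc[OF that], of n "int i + n"] by simp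
  ultimately show "homogeneous_ideal J" by (simp add: homogeneous_ideal_def)
qed

lemma zero_submodule: "homogeneous_submodule R X {\<zero>\<^bsub>X\<^esub>}" if "graded_module R X" for X :: "('a, 'm) gmodule"
proof -
  interpret X: module R X by (rule graded_moduleD[OF that])
  interpret DX: direct_sum X "gr X" by (rule graded_moduleD[OF that])
  show ?thesis by (rule homogeneous_submoduleI[OF X.module_axioms]) simp_all
qed

text \<open>The maps \<open>f\<close> on \<open>Z\<close> and \<open>h\<close> on \<open>Q\<close> induce a linear map on \<open>Z + j(Q)\<close>; its homogeneous part of degree
  \<open>n\<close> still extends both, so degrees need not be tracked during the construction.\<close>

lemma glue_maps:
  fixes X :: "('a, 'm) gmodule" and F :: "('a, 'p) gmodule" and Q :: "('a, 'q) gmodule"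
  assumes F: "graded_module R F" and X: "graded_module R X" and Q: "graded_module R Q"
    and Z: "homogeneous_submodule R F Z"
    and f: "f \<in> lin_maps_deg R (sub_gmodule F Z) X n"
    and j: "j \<in> lin_maps_deg R Q F 0" and h: "h \<in> lin_maps_deg R Q X n"
    and compat: "\<And>q. q \<in> carrier Q \<Longrightarrow> j q \<in> Z \<Longrightarrow> f (j q) = h q"
  defines "W \<equiv> {z \<oplus>\<^bsub>F\<^esub> j q |z q. z \<in> Z \<and> q \<in> carrier Q}"
  shows "homogeneous_submodule R F W"
    and "\<exists>g\<in>lin_maps_deg R (sub_gmodule F W) X n.
      (\<forall>z\<in>Z. g z = f z) \<and> (\<forall>q\<in>carrier Q. g (j q) = h q)"
    and "Z \<subseteq> W" "j ` carrier Q \<subseteq> W"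
proof -
  interpret F: module R F by (rule graded_moduleD[OF F])
  interpret X: module R X by (rule graded_moduleD[OF X])
  interpret Q: module R Q by (rule graded_moduleD[OF Q])
  interpret DF: direct_sum F "gr F" by (rule graded_moduleD[OF F])
  interpret DX: direct_sum X "gr X" by (rule graded_moduleD[OF X])
  interpret DQ: direct_sum Q "gr Q" by (rule graded_moduleD[OF Q])
  note Zd = homogeneous_submoduleD[OF F.module_axioms Z]
  have Zc: "z \<in> carrier F" if "z \<in> Z" for z using Zd(2) that by blast
  note jl = lin_maps_degD(1)[OF j] and hl = lin_maps_degD(1)[OF h] and fl = lin_maps_degD(1)[OF f]
  note jd = lin_mapsD[OF jl] and hd = lin_mapsD[OF hl]
  note fd = lin_mapsD[OF fl, unfolded sub_gmodule_simps]
  note j0 = lin_maps_zero[OF jl Q.module_axioms F.module_axioms]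
  note h0 = lin_maps_zero[OF hl Q.module_axioms X.module_axioms]
  have mW: "z \<oplus>\<^bsub>F\<^esub> j q \<in> W" if "z \<in> Z" "q \<in> carrier Q" for z q
    unfolding W_def using that by blast
  have eW: "\<exists>z q. z \<in> Z \<and> q \<in> carrier Q \<and> w = z \<oplus>\<^bsub>F\<^esub> j q" if "w \<in> W" for w
    using that unfolding W_def by blast
  show ZW: "Z \<subseteq> W"
  proof
    fix z assume "z \<in> Z"
    then show "z \<in> W" using mW[of z "\<zero>\<^bsub>Q\<^esub>"] j0 Zc by simp
  qed
  show jW: "j ` carrier Q \<subseteq> W"
  proof (rule image_subsetI)
    fix q assume "q \<in> carrier Q"
    then show "j q \<in> W" using mW[of "\<zero>\<^bsub>F\<^esub>" q] Zd(3) jd(1) by simp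
  qed
  have add_eq: "(z \<oplus>\<^bsub>F\<^esub> j q) \<oplus>\<^bsub>F\<^esub> (z' \<oplus>\<^bsub>F\<^esub> j q') = (z \<oplus>\<^bsub>F\<^esub> z') \<oplus>\<^bsub>F\<^esub> j (q \<oplus>\<^bsub>Q\<^esub> q')"
    if "z \<in> Z" "q \<in> carrier Q" "z' \<in> Z" "q' \<in> carrier Q" for z q z' q'
    using that by (simp add: jd F.M.a_ac Zc)
  have smult_eq: "a \<odot>\<^bsub>F\<^esub> (z \<oplus>\<^bsub>F\<^esub> j q) = a \<odot>\<^bsub>F\<^esub> z \<oplus>\<^bsub>F\<^esub> j (a \<odot>\<^bsub>Q\<^esub> q)"
    if "z \<in> Z" "q \<in> carrier Q" "a \<in> carrier R" for z q a
    using that by (simp add: jd F.smult_r_distr Zc)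
  show W: "homogeneous_submodule R F W"
  proof (rule homogeneous_submoduleI[OF F.module_axioms])
    show "W \<subseteq> carrier F" unfolding W_def using Zc jd(1) by auto
    show "\<zero>\<^bsub>F\<^esub> \<in> W" using ZW Zd(3) by blast
  next
    fix x y assume "x \<in> W" "y \<in> W"
    then obtain z q z' q' where "z \<in> Z" "q \<in> carrier Q" "x = z \<oplus>\<^bsub>F\<^esub> j q"
      "z' \<in> Z" "q' \<in> carrier Q" "y = z' \<oplus>\<^bsub>F\<^esub> j q'" using eW by metis
    then show "x \<oplus>\<^bsub>F\<^esub> y \<in> W" using mW[of "z \<oplus>\<^bsub>F\<^esub> z'" "q \<oplus>\<^bsub>Q\<^esub> q'"] Zd(5) by (simp add: add_eq)
  next
    fix a x assume a: "a \<in> carrier R" and "x \<in> W"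
    then obtain z q where "z \<in> Z" "q \<in> carrier Q" "x = z \<oplus>\<^bsub>F\<^esub> j q" using eW by metis
    then show "a \<odot>\<^bsub>F\<^esub> x \<in> W" using a mW[of "a \<odot>\<^bsub>F\<^esub> z" "a \<odot>\<^bsub>Q\<^esub> q"] Zd(6) by (simp add: smult_eq)
  next
    fix x k assume "x \<in> W"
    then obtain z q where zq: "z \<in> Z" "q \<in> carrier Q" "x = z \<oplus>\<^bsub>F\<^esub> j q" using eW by metis
    have "hc F k x = hc F k z \<oplus>\<^bsub>F\<^esub> j (hc Q k q)"
      using zq lin_maps_deg_hc[OF j Q F zq(2), of k] by (simp add: DF.hcomp_add Zc jd)
    then show "hc F k x \<in> W" using mW[of "hc F k z" "hc Q k q"] Zd(7) zq by simp
  qed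
  \<comment> \<open>Well-definedness: two representations of an element differ by
    \<open>q' - q\<close>, whose image under \<open>j\<close> then lies in \<open>Z\<close>, where
    \<open>compat\<close> identifies \<open>f\<close> with \<open>h\<close>.\<close>
  have wd: "f z \<oplus>\<^bsub>X\<^esub> h q = f z' \<oplus>\<^bsub>X\<^esub> h q'"
    if eq: "z \<oplus>\<^bsub>F\<^esub> j q = z' \<oplus>\<^bsub>F\<^esub> j q'" and zq: "z \<in> Z" "q \<in> carrier Q" "z' \<in> Z" "q' \<in> carrier Q"
    for z q z' q'
  proof -
    let ?q = "q' \<oplus>\<^bsub>Q\<^esub> \<ominus>\<^bsub>Q\<^esub> q"
    have qc: "?q \<in> carrier Q" using zq by simp
    have "q' = q \<oplus>\<^bsub>Q\<^esub> ?q" using zq by (simp add: Q.M.a_ac Q.M.r_neg1 Q.M.r_neg2 Q.M.r_neg)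
    then have jq: "j q' = j q \<oplus>\<^bsub>F\<^esub> j ?q" and hq: "h q' = h q \<oplus>\<^bsub>X\<^esub> h ?q"
      using jd(2)[OF zq(2) qc] hd(2)[OF zq(2) qc] by simp_all
    have c: "z \<in> carrier F" "z' \<in> carrier F" "j q \<in> carrier F" "j ?q \<in> carrier F"
      using zq qc Zc jd by blast+
    have "z \<oplus>\<^bsub>F\<^esub> j q = (z' \<oplus>\<^bsub>F\<^esub> j ?q) \<oplus>\<^bsub>F\<^esub> j q" using eq jq c by (simp add: F.M.a_ac)
    then have z: "z = z' \<oplus>\<^bsub>F\<^esub> j ?q" using c by simp
    then have "j ?q = \<ominus>\<^bsub>F\<^esub> z' \<oplus>\<^bsub>F\<^esub> z" using c by (simp add: F.M.r_neg1)
    then have jZ: "j ?q \<in> Z" using Zd(4,5) zq by simp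
    have "f z = f z' \<oplus>\<^bsub>X\<^esub> h ?q" using fd(2)[OF zq(3) jZ] compat[OF qc jZ] z by simp
    then show ?thesis using hq fd(1) hd(1) zq qc by (simp add: X.M.a_ac)
  qed
  define G where "G w = (THE y. \<exists>z q. z \<in> Z \<and> q \<in> carrier Q \<and> w = z \<oplus>\<^bsub>F\<^esub> j q \<and> y = f z \<oplus>\<^bsub>X\<^esub> h q)" for w
  have G: "G (z \<oplus>\<^bsub>F\<^esub> j q) = f z \<oplus>\<^bsub>X\<^esub> h q" if "z \<in> Z" "q \<in> carrier Q" for z q
    unfolding G_def
  proof (rule the_equality)
    show "\<exists>z' q'. z' \<in> Z \<and> q' \<in> carrier Q \<and> z \<oplus>\<^bsub>F\<^esub> j q = z' \<oplus>\<^bsub>F\<^esub> j q' \<and> f z \<oplus>\<^bsub>X\<^esub> h q = f z' \<oplus>\<^bsub>X\<^esub> h q'"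
      by (intro exI conjI, rule that(1), rule that(2)) (rule refl)+
    show "y = f z \<oplus>\<^bsub>X\<^esub> h q"
      if "\<exists>z' q'. z' \<in> Z \<and> q' \<in> carrier Q \<and> z \<oplus>\<^bsub>F\<^esub> j q = z' \<oplus>\<^bsub>F\<^esub> j q' \<and> y = f z' \<oplus>\<^bsub>X\<^esub> h q'" for y
      using that wd[OF _ \<open>z \<in> Z\<close> \<open>q \<in> carrier Q\<close>] by metis
  qed
  have Gl: "G \<in> lin_maps R (sub_gmodule F W) X"
  proof (rule lin_mapsI; unfold sub_gmodule_simps)
    fix w assume "w \<in> W"
    then obtain z q where zq: "z \<in> Z" "q \<in> carrier Q" "w = z \<oplus>\<^bsub>F\<^esub> j q" using eW by metis
    then show "G w \<in> carrier X" using fd(1) hd(1) by (simp add: G)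
    fix w' assume "w' \<in> W"
    then obtain z' q' where zq': "z' \<in> Z" "q' \<in> carrier Q" "w' = z' \<oplus>\<^bsub>F\<^esub> j q'" using eW by metis
    have "G (w \<oplus>\<^bsub>F\<^esub> w') = f (z \<oplus>\<^bsub>F\<^esub> z') \<oplus>\<^bsub>X\<^esub> h (q \<oplus>\<^bsub>Q\<^esub> q')"
      using zq zq' add_eq G[OF Zd(5)[OF zq(1) zq'(1)], of "q \<oplus>\<^bsub>Q\<^esub> q'"] by simp
    also have "\<dots> = G w \<oplus>\<^bsub>X\<^esub> G w'"
      using zq zq' fd(1) hd(1) by (simp add: G fd(2) hd(2) X.M.a_ac)
    finally show "G (w \<oplus>\<^bsub>F\<^esub> w') = G w \<oplus>\<^bsub>X\<^esub> G w'" .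
  next
    fix a w assume a: "a \<in> carrier R" and "w \<in> W"
    then obtain z q where zq: "z \<in> Z" "q \<in> carrier Q" "w = z \<oplus>\<^bsub>F\<^esub> j q" using eW by metis
    then show "G (a \<odot>\<^bsub>F\<^esub> w) = a \<odot>\<^bsub>X\<^esub> G w"
      using a G[OF Zd(6)[OF a zq(1)], of "a \<odot>\<^bsub>Q\<^esub> q"] fd(1) hd(1)
      by (simp add: G smult_eq fd(3) hd(3) X.smult_r_distr)
  qed
  have GZ: "G z = f z" if "z \<in> Z" for z
    using G[OF that Q.M.zero_closed] that by (simp add: j0 h0 fd(1) Zc)
  have f0: "f \<zero>\<^bsub>F\<^esub> = \<zero>\<^bsub>X\<^esub>" using compat[OF Q.M.zero_closed] j0 h0 Zd(3) by simp
  have Gj: "G (j q) = h q" if "q \<in> carrier Q" for q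
    using G[OF Zd(3) that] that by (simp add: jd(1) hd(1) f0)
  have gW: "graded_module R (sub_gmodule F W)" by (rule homogeneous_sub_gmodule[OF F W graded])
  obtain g where g: "g \<in> lin_maps_deg R (sub_gmodule F W) X n"
    "\<And>k x. x \<in> gr F k \<Longrightarrow> x \<in> W \<Longrightarrow> g x = hc X (k + n) (G x)"
    using homogeneous_part[OF Gl gW X graded, of n] by auto
  note gl = lin_mapsD[OF lin_maps_degD(1)[OF g(1)], unfolded sub_gmodule_simps]
  have "g z = f z" if z: "z \<in> Z" for z
  proof (rule lin_maps_eqI[OF homogeneous_sub_gmodule(1)[OF F Z graded] _ fl])
    show "g \<in> lin_maps R (sub_gmodule F Z) X"
      by (rule lin_mapsI) (simp_all add: gl subsetD[OF ZW])
    fix k x assume "x \<in> gr (sub_gmodule F Z) k"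
    then show "g x = f x"
      using g(2)[of x k] ZW lin_maps_degD(2)[OF f, of x k] by (auto simp: GZ)
  qed (use z in simp)
  moreover have "g (j q) = h q" if q: "q \<in> carrier Q" for q
  proof (rule lin_maps_eqI[OF Q _ hl _ q])
    show "(\<lambda>q. g (j q)) \<in> lin_maps R Q X"
      by (rule lin_mapsI) (simp_all add: gl jd subsetD[OF jW])
    fix k x assume x: "x \<in> gr Q k"
    then have xc: "x \<in> carrier Q" by (rule DQ.component_closed)
    have "j x \<in> gr F k" using lin_maps_degD(2)[OF j x] by simp
    then have "g (j x) = hc X (k + n) (G (j x))" using g(2) jW xc by blast
    then show "g (j x) = h x"
      using lin_maps_degD(2)[OF h x] by (simp add: Gj xc)
  qed
  ultimately show "\<exists>g\<in>lin_maps_deg R (sub_gmodule F W) X n.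
      (\<forall>z\<in>Z. g z = f z) \<and> (\<forall>q\<in>carrier Q. g (j q) = h q)"
    using g(1) by blast
qed

text \<open>Baer's condition in terms of elements: an extension of \<open>f\<close> to
  \<open>shifted n\<close> is determined by the image \<open>e\<close> of \<open>\<one>\<close>,
  which has degree \<open>n\<close> there. Maps of degree 0 cover all degrees because
  \<open>n\<close> ranges over all integers.\<close>

definition graded_baer :: "('a, 'm) gmodule \<Rightarrow> bool" where
  "graded_baer X \<longleftrightarrow> (\<forall>J n. \<forall>f\<in>lin_maps_deg R (sub_gmodule (shifted n) J) X 0.
     homogeneous_ideal J \<longrightarrow> (\<exists>e\<in>gr X n. \<forall>a\<in>J. f a = a \<odot>\<^bsub>X\<^esub> e))"

lemma graded_baerD:
  assumes "graded_baer X" "homogeneous_ideal J"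
    "f \<in> lin_maps_deg R (sub_gmodule (shifted n) J) X 0"
  shows "\<exists>e\<in>gr X n. \<forall>a\<in>J. f a = a \<odot>\<^bsub>X\<^esub> e"
  using assms unfolding graded_baer_def by blast

text \<open>The inclusion of \<open>J\<close> into \<open>shifted n\<close> is one of the test
  monomorphisms, both modules being carried by the type of \<open>R\<close>; \<open>e\<close> is the
  image of \<open>\<one>\<close> under the extension.\<close>

lemma graded_injective_imp_baer:
  assumes "graded_injective R X"
  shows "graded_baer X"
  unfolding graded_baer_def
proof (intro allI ballI impI)
  fix J n f assume f: "f \<in> lin_maps_deg R (sub_gmodule (shifted n) J) X 0" and J: "homogeneous_ideal J"
  have X: "graded_module R X" using assms by (simp add: graded_injective_def)
  interpret X: module R X by (rule graded_moduleD[OF X])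
  have hs: "homogeneous_submodule R (shifted n) J" using J homogeneous_ideal_iff by blast
  note hsd = homogeneous_submoduleD[OF shifted_module hs]
  let ?A = "sub_gmodule (shifted n) J"
  have A: "graded_module R ?A" by (rule homogeneous_sub_gmodule[OF shifted_graded hs graded])
  have h: "(\<lambda>x. x) \<in> lin_maps_deg R ?A (shifted n) 0"
    using hsd(2) by (intro lin_maps_degI lin_mapsI) auto
  have "\<exists>g\<in>lin_maps_deg R (shifted n) X 0. \<forall>x\<in>carrier ?A. g ((\<lambda>x. x) x) = f x"
    using assms A shifted_graded[of n] h f unfolding graded_injective_def inj_on_def by blast
  then obtain g where g: "g \<in> lin_maps_deg R (shifted n) X 0" "\<And>x. x \<in> J \<Longrightarrow> g x = f x" by auto
  have "g \<one> \<in> gr X n" using lin_maps_degD(2)[OF g(1), of \<one> n] one_deg0 by simp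
  moreover have "f a = a \<odot>\<^bsub>X\<^esub> g \<one>" if a: "a \<in> J" for a
  proof -
    have ac: "a \<in> carrier R" using a hsd(2) by auto
    show ?thesis
      using lin_mapsD(3)[OF lin_maps_degD(1)[OF g(1)] ac, of \<one>] g(2)[OF a] ac by simp
  qed
  ultimately show "\<exists>e\<in>gr X n. \<forall>a\<in>J. f a = a \<odot>\<^bsub>X\<^esub> e" by blast
qed

lemma smult_map:
  assumes "graded_module R X" "e \<in> gr X n"
  shows "(\<lambda>a. a \<odot>\<^bsub>X\<^esub> e) \<in> lin_maps_deg R (shifted n) X 0"
proof -
  interpret X: module R X by (rule graded_moduleD[OF assms(1)])
  interpret DX: direct_sum X "gr X" by (rule graded_moduleD[OF assms(1)])
  have e: "e \<in> carrier X" by (rule DX.component_closed[OF assms(2)])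
  show ?thesis
  proof (intro lin_maps_degI lin_mapsI)
    fix k x assume "x \<in> gr (shifted n) k"
    then show "x \<odot>\<^bsub>X\<^esub> e \<in> gr X (k + 0)"
      using graded_moduleD(3)[OF assms(1) _ assms(2), of x "nat (k - n)"] e by (auto split: if_splits)
  qed (use e in \<open>simp_all add: X.smult_l_distr X.smult_assoc1\<close>)
qed

lemma lin_maps_deg_sub:
  assumes "f \<in> lin_maps_deg R A X n" "S \<subseteq> carrier A"
  shows "f \<in> lin_maps_deg R (sub_gmodule A S) X n"
  using lin_maps_degD[OF assms(1)] assms(2)
  by (intro lin_maps_degI lin_mapsI) (auto simp: lin_mapsD subset_iff)

lemma lin_maps_deg_into_sub:
  "f \<in> lin_maps_deg R A (sub_gmodule X S) n \<longleftrightarrow>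
    f \<in> lin_maps_deg R A X n \<and> (\<forall>x\<in>carrier A. f x \<in> S)"
  if "direct_sum A (gr A)" "S \<subseteq> carrier X"
  using that(2) direct_sum.component_closed[OF that(1)]
  by (auto simp: lin_maps_deg_def lin_maps_def Pi_iff)

text \<open>The step of Baer's argument that adjoins one element: on the ideal of those
  \<open>a\<close> with \<open>a b\<close> in \<open>Z\<close>, the map sending \<open>a\<close> to
  \<open>f (a b)\<close> is multiplication by some \<open>e\<close>, and \<open>f\<close> is
  extended by sending \<open>a b\<close> to \<open>a e\<close>.\<close>

lemma extend_to_generator:
  assumes X: "graded_module R X" "graded_baer X" and F: "graded_module R F" "b \<in> gr F k"
    and Z: "homogeneous_submodule R F Z" and f: "f \<in> lin_maps_deg R (sub_gmodule F Z) X n"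
  shows "\<exists>W g. homogeneous_submodule R F W \<and> Z \<subseteq> W \<and> b \<in> W \<and>
    g \<in> lin_maps_deg R (sub_gmodule F W) X n \<and> (\<forall>z\<in>Z. g z = f z)"
proof -
  interpret F: module R F by (rule graded_moduleD[OF F(1)])
  interpret DF: direct_sum F "gr F" by (rule graded_moduleD[OF F(1)])
  interpret X: module R X by (rule graded_moduleD[OF X(1)])
  interpret DX: direct_sum X "gr X" by (rule graded_moduleD[OF X(1)])
  note Zd = homogeneous_submoduleD[OF F.module_axioms Z]
  note fd = lin_mapsD[OF lin_maps_degD(1)[OF f], unfolded sub_gmodule_simps]
  have b: "b \<in> carrier F" by (rule DF.component_closed[OF F(2)])
  define J where "J = {a \<in> carrier R. a \<odot>\<^bsub>F\<^esub> b \<in> Z}"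
  \<comment> \<open>As \<open>b\<close> has degree \<open>k\<close> and \<open>f\<close> has degree
    \<open>n\<close>, the map sending \<open>a\<close> to \<open>f (a b)\<close> has degree 0 on the
    twist by \<open>k + n\<close>.\<close>
  have Jm: "homogeneous_submodule R (shifted (k + n)) J"
  proof (rule homogeneous_submoduleI[OF shifted_module])
    fix x l assume x: "x \<in> J"
    have "hc F j (x \<odot>\<^bsub>F\<^esub> b) = hc (shifted k) j x \<odot>\<^bsub>F\<^esub> b" for j
      using lin_maps_deg_hc[OF smult_map[OF F] shifted_graded F(1), of x j] x by (simp add: J_def)
    then have "hc (shifted k) j x \<odot>\<^bsub>F\<^esub> b \<in> Z" for j
      using Zd(7)[of "x \<odot>\<^bsub>F\<^esub> b" j] x by (simp add: J_def)
    \<comment> \<open>Degree \<open>l\<close> in \<open>shifted (k + n)\<close> is degree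
      \<open>l - n\<close> in \<open>shifted k\<close>.\<close>
    from this[of "l - n"] show "hc (shifted (k + n)) l x \<in> J"
      using x Zd(3) b by (auto simp: hc_shifted J_def algebra_simps split: if_splits)
  qed (use b Zd(3,5,6) in \<open>auto simp: J_def F.smult_l_distr F.smult_assoc1\<close>)
  have J: "homogeneous_ideal J" using Jm homogeneous_ideal_iff by blast
  have "(\<lambda>a. f (a \<odot>\<^bsub>F\<^esub> b)) \<in> lin_maps_deg R (sub_gmodule (shifted (k + n)) J) X 0"
  proof (intro lin_maps_degI lin_mapsI)
    fix l a assume "a \<in> gr (sub_gmodule (shifted (k + n)) J) l"
    then have a: "a \<in> gr (shifted k) (l - n)" "a \<in> J" by (auto simp: algebra_simps split: if_splits)
    then show "f (a \<odot>\<^bsub>F\<^esub> b) \<in> gr X (l + 0)"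
      using lin_maps_degD(2)[OF smult_map[OF F] a(1)] lin_maps_degD(2)[OF f, of "a \<odot>\<^bsub>F\<^esub> b" "l - n"]
      by (auto simp: J_def)
  qed (use b fd in \<open>auto simp: J_def F.smult_l_distr F.smult_assoc1\<close>)
  from graded_baerD[OF X(2) J this] obtain e
    where e: "e \<in> gr X (k + n)" "\<And>a. a \<in> J \<Longrightarrow> f (a \<odot>\<^bsub>F\<^esub> b) = a \<odot>\<^bsub>X\<^esub> e" by auto
  have ec: "e \<in> carrier X" by (rule DX.component_closed[OF e(1)])
  \<comment> \<open>For the gluing, the same multiplication is regarded on \<open>shifted k\<close>,
    where multiplying by \<open>b\<close> has degree 0 and multiplying by \<open>e\<close> has
    degree \<open>n\<close>.\<close>
  have h: "(\<lambda>a. a \<odot>\<^bsub>X\<^esub> e) \<in> lin_maps_deg R (shifted k) X n"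
  proof (intro lin_maps_degI)
    show "(\<lambda>a. a \<odot>\<^bsub>X\<^esub> e) \<in> lin_maps R (shifted k) X"
      by (rule lin_mapsI) (use ec in \<open>simp_all add: X.smult_l_distr X.smult_assoc1\<close>)
    fix l x assume "x \<in> gr (shifted k) l"
    then have "x \<in> gr (shifted (k + n)) (l + n)" by (simp split: if_splits)
    then show "x \<odot>\<^bsub>X\<^esub> e \<in> gr X (l + n)" using lin_maps_degD(2)[OF smult_map[OF X(1) e(1)]] by fastforce
  qed
  let ?W = "{z \<oplus>\<^bsub>F\<^esub> a \<odot>\<^bsub>F\<^esub> b |z a. z \<in> Z \<and> a \<in> carrier (shifted k)}"
  note glue = glue_maps[OF F(1) X(1) shifted_graded Z f smult_map[OF F] h]
  have c: "f (q \<odot>\<^bsub>F\<^esub> b) = q \<odot>\<^bsub>X\<^esub> e" if "q \<in> carrier (shifted k)" "q \<odot>\<^bsub>F\<^esub> b \<in> Z" for q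
    using that e(2) by (simp add: J_def)
  have "b \<in> ?W"
  proof -
    have "\<one> \<odot>\<^bsub>F\<^esub> b \<in> (\<lambda>a. a \<odot>\<^bsub>F\<^esub> b) ` carrier (shifted k)" by (rule imageI) simp
    then show ?thesis using glue(4)[OF c] b by auto
  qed
  then show ?thesis using glue(1-3)[OF c] by blast
qed

text \<open>The basis is finite, so adjoining its elements one after another reaches a submodule
  that contains a basis, and this is all of \<open>F\<close>.\<close>

lemma baer_extend:
  assumes X: "graded_module R X" "graded_baer X" and F: "fin_graded_free R F"
    and Z: "homogeneous_submodule R F Z" and f: "f \<in> lin_maps_deg R (sub_gmodule F Z) X n"
  shows "\<exists>g\<in>lin_maps_deg R F X n. \<forall>z\<in>Z. g z = f z"
proof -
  obtain B where B: "graded_module R F" "finite B" "B \<subseteq> (\<Union>n. gr F n)" "B \<subseteq> carrier F"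
    "\<forall>x\<in>carrier F. \<exists>!c. c \<in> B \<rightarrow>\<^sub>E carrier R \<and> x = (\<Oplus>\<^bsub>F\<^esub>b\<in>B. c b \<odot>\<^bsub>F\<^esub> b)"
    by (rule fin_graded_freeE[OF F])
  interpret F: module R F by (rule graded_moduleD[OF B(1)])
  interpret DF: direct_sum F "gr F" by (rule graded_moduleD[OF B(1)])
  have "\<exists>W g. homogeneous_submodule R F W \<and> Z \<subseteq> W \<and> C \<subseteq> W \<and>
      g \<in> lin_maps_deg R (sub_gmodule F W) X n \<and> (\<forall>z\<in>Z. g z = f z)" if "C \<subseteq> B" for C
    using finite_subset[OF that B(2)] that
  proof induct
    case empty
    show ?case using Z f by blast
  next
    case (insert b C)
    then obtain W g where W: "homogeneous_submodule R F W" "Z \<subseteq> W" "C \<subseteq> W"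
      "g \<in> lin_maps_deg R (sub_gmodule F W) X n" "\<forall>z\<in>Z. g z = f z" by blast
    obtain k where "b \<in> gr F k" using insert(4) B(3) by blast
    from extend_to_generator[OF X B(1) this W(1,4)] obtain W' g' where
      W': "homogeneous_submodule R F W'" "W \<subseteq> W'" "b \<in> W'"
      "g' \<in> lin_maps_deg R (sub_gmodule F W') X n" "\<forall>z\<in>W. g' z = g z" by blast
    have "\<forall>z\<in>Z. g' z = f z" using W'(5) W(2,5) by auto
    moreover have "Z \<subseteq> W'" "insert b C \<subseteq> W'" using W' W by auto
    ultimately show ?case using W'(1,4) by blast
  qed
  from this[OF subset_refl] obtain W g where W: "homogeneous_submodule R F W" "B \<subseteq> W"
    "g \<in> lin_maps_deg R (sub_gmodule F W) X n" "\<forall>z\<in>Z. g z = f z" by blast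
  note Wd = homogeneous_submoduleD[OF F.module_axioms W(1)]
  have "x \<in> W" if x: "x \<in> carrier F" for x
  proof -
    obtain c where c: "c \<in> B \<rightarrow>\<^sub>E carrier R" "x = (\<Oplus>\<^bsub>F\<^esub>b\<in>B. c b \<odot>\<^bsub>F\<^esub> b)"
      using bspec[OF B(5) x] by blast
    have "(\<Oplus>\<^bsub>F\<^esub>b\<in>B. c b \<odot>\<^bsub>F\<^esub> b) \<in> W"
      by (rule finsum_span_induct[OF F.module_axioms B(2,4)])
        (use Wd(3,5,6) W(2) PiE_mem[OF c(1)] in auto)
    then show ?thesis using c(2) by simp
  qed
  then have "W = carrier F" using Wd(2) by blast
  moreover have "g \<in> lin_maps_deg R F X n"
    using W(3) \<open>W = carrier F\<close> DF.component_closed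
    by (auto simp: lin_maps_deg_def lin_maps_def)
  ultimately show ?thesis using W(4) by blast
qed

end

section \<open>Torsion\<close>

lemma (in cring) ideal_pow_ideal:
  assumes "ideal I R"
  shows "ideal (I [^]\<^bsub>ideals_set R\<^esub> (n::nat)) R"
proof -
  interpret S: comm_monoid "ideals_set R" by (rule ideals_set_is_comm_monoid)
  have "I \<in> carrier (ideals_set R)" using assms by (simp add: ideals_set_def)
  then have "I [^]\<^bsub>ideals_set R\<^esub> n \<in> carrier (ideals_set R)" by simp
  then show ?thesis by (simp add: ideals_set_def)
qed

lemma (in cring) ideal_pow_Suc:
  "I [^]\<^bsub>ideals_set R\<^esub> Suc n = ideal_prod R (I [^]\<^bsub>ideals_set R\<^esub> n) I"
proof -
  interpret S: comm_monoid "ideals_set R" by (rule ideals_set_is_comm_monoid)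
  show ?thesis by (simp add: ideals_set_def)
qed

lemma (in cring) ideal_pow_0: "I [^]\<^bsub>ideals_set R\<^esub> (0::nat) = carrier R"
proof -
  interpret S: comm_monoid "ideals_set R" by (rule ideals_set_is_comm_monoid)
  show ?thesis using S.nat_pow_0[of I] by (simp add: ideals_set_def)
qed

lemma (in cring) ideal_pow_antimono:
  fixes m n :: nat
  assumes "ideal I R" "m \<le> n"
  shows "I [^]\<^bsub>ideals_set R\<^esub> n \<subseteq> I [^]\<^bsub>ideals_set R\<^esub> m"
  using assms(2)
proof (induct n rule: dec_induct)
  case (step n)
  have "I [^]\<^bsub>ideals_set R\<^esub> Suc n \<subseteq> I [^]\<^bsub>ideals_set R\<^esub> n"
    using ideal_prod_inter[OF ideal_pow_ideal[OF assms(1)] assms(1)] unfolding ideal_pow_Suc by simp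
  then show ?case using step by blast
qed simp

lemma (in cring) pow_mem_ideal_pow:
  "a \<in> carrier R \<Longrightarrow> a \<in> I \<Longrightarrow> a [^] (n::nat) \<in> I [^]\<^bsub>ideals_set R\<^esub> n"
proof (induct n)
  case (Suc n)
  then show ?case using ideal_prod.prod[of "a [^] n" "I [^]\<^bsub>ideals_set R\<^esub> n" a I R]
    unfolding ideal_pow_Suc by simp
qed (simp add: ideal_pow_0 del: nat_pow_0 Group.nat_pow_0)

definition torsion_set :: "'a gring \<Rightarrow> 'a set \<Rightarrow> ('a, 'm) gmodule \<Rightarrow> 'm set" where
  "torsion_set R I M = {x \<in> carrier M. \<exists>n::nat. \<forall>a \<in> I [^]\<^bsub>ideals_set R\<^esub> n. a \<odot>\<^bsub>M\<^esub> x = \<zero>\<^bsub>M\<^esub>}"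

lemma torsion_gmodule_eq: "torsion_gmodule R I M = sub_gmodule M (torsion_set R I M)"
  by (simp add: torsion_gmodule_def torsion_set_def)

text \<open>Used to pass from generators to ideals: if all generators kill \<open>x\<close>, so does
  the ideal they generate.\<close>

lemma ideal_annihilator:
  assumes "module R X" "x \<in> carrier X"
  shows "ideal {c \<in> carrier R. c \<odot>\<^bsub>X\<^esub> x = \<zero>\<^bsub>X\<^esub>} R"
proof -
  interpret X: module R X by fact
  show ?thesis
  proof (rule idealI)
    show "ring R" by (rule X.R.ring_axioms)
    show "subgroup {c \<in> carrier R. c \<odot>\<^bsub>X\<^esub> x = \<zero>\<^bsub>X\<^esub>} (add_monoid R)"
    proof (rule X.R.add.subgroupI)
      have "\<zero>\<^bsub>R\<^esub> \<in> {c \<in> carrier R. c \<odot>\<^bsub>X\<^esub> x = \<zero>\<^bsub>X\<^esub>}" using assms(2) by simp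
      then show "{c \<in> carrier R. c \<odot>\<^bsub>X\<^esub> x = \<zero>\<^bsub>X\<^esub>} \<noteq> {}" by blast
    qed (use assms(2) in \<open>auto simp: X.smult_l_distr X.smult_l_minus\<close>)
    fix a c assume a: "a \<in> {c \<in> carrier R. c \<odot>\<^bsub>X\<^esub> x = \<zero>\<^bsub>X\<^esub>}" and c: "c \<in> carrier R"
    have "(c \<otimes>\<^bsub>R\<^esub> a) \<odot>\<^bsub>X\<^esub> x = \<zero>\<^bsub>X\<^esub>" using a c assms(2) by (simp add: X.smult_assoc1)
    then show "c \<otimes>\<^bsub>R\<^esub> a \<in> {c \<in> carrier R. c \<odot>\<^bsub>X\<^esub> x = \<zero>\<^bsub>X\<^esub>}"
      "a \<otimes>\<^bsub>R\<^esub> c \<in> {c \<in> carrier R. c \<odot>\<^bsub>X\<^esub> x = \<zero>\<^bsub>X\<^esub>}"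
      using a c X.R.m_comm[of a c] by simp_all
  qed
qed

text \<open>Induction on the total exponent: if powers of all generators kill \<open>x\<close>, then
  \<open>g x\<close> needs one power of \<open>g\<close> less, and once all \<open>g x\<close> are
  torsion, one further factor \<open>I\<close> kills \<open>x\<close>. Testing on single generators
  is what makes torsion compatible with gradings below.\<close>

lemma torsion_set_iff:
  fixes G :: "'a set"
  assumes X: "module R X" and G: "finite G" "G \<subseteq> carrier R" and I: "I = genideal R G"
  shows "x \<in> torsion_set R I X \<longleftrightarrow>
    x \<in> carrier X \<and> (\<forall>g\<in>G. \<exists>k::nat. (g [^]\<^bsub>R\<^esub> k) \<odot>\<^bsub>X\<^esub> x = \<zero>\<^bsub>X\<^esub>)"
proof -
  interpret X: module R X by fact
  have Ii: "ideal I R" unfolding I by (rule X.R.genideal_ideal[OF G(2)])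
  have GI: "G \<subseteq> I" unfolding I by (rule X.R.genideal_self[OF G(2)])
  have Gc: "g \<in> carrier R" if "g \<in> G" for g using G(2) that by blast
  interpret I: ideal I R by (rule Ii)
  have step: "x \<in> torsion_set R I X"
    if x: "x \<in> carrier X" and t: "\<And>g. g \<in> G \<Longrightarrow> g \<odot>\<^bsub>X\<^esub> x \<in> torsion_set R I X" for x
  proof -
    have "\<exists>n. \<forall>a\<in>I [^]\<^bsub>ideals_set R\<^esub> (n::nat). a \<odot>\<^bsub>X\<^esub> (g \<odot>\<^bsub>X\<^esub> x) = \<zero>\<^bsub>X\<^esub>" if "g \<in> G" for g
      using t[OF that] unfolding torsion_set_def by simp
    then obtain n where n: "\<And>g. g \<in> G \<Longrightarrow>
        \<forall>a\<in>I [^]\<^bsub>ideals_set R\<^esub> (n g :: nat). a \<odot>\<^bsub>X\<^esub> (g \<odot>\<^bsub>X\<^esub> x) = \<zero>\<^bsub>X\<^esub>" by metis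
    \<comment> \<open>A common bound for the exponents \<open>n g\<close>.\<close>
    define N where "N = sum n G"
    have pc: "a \<in> carrier R" if "a \<in> I [^]\<^bsub>ideals_set R\<^esub> N" for a
      using additive_subgroup.a_Hcarr[OF ideal.axioms(1)[OF X.R.ideal_pow_ideal[OF Ii]] that] .
    have aG: "a \<odot>\<^bsub>X\<^esub> (g \<odot>\<^bsub>X\<^esub> x) = \<zero>\<^bsub>X\<^esub>" if "a \<in> I [^]\<^bsub>ideals_set R\<^esub> N" "g \<in> G" for a g
    proof -
      have "n g \<le> N" unfolding N_def by (rule member_le_sum[OF that(2) _ G(1)]) simp
      then have "a \<in> I [^]\<^bsub>ideals_set R\<^esub> n g" using X.R.ideal_pow_antimono[OF Ii] that(1) by blast
      then show ?thesis using n[OF that(2)] by blast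
    qed
    \<comment> \<open>From generators to all of \<open>I\<close>: the elements that kill
      \<open>a x\<close> form an ideal, and it contains \<open>G\<close>.\<close>
    have aI: "a \<odot>\<^bsub>X\<^esub> (c \<odot>\<^bsub>X\<^esub> x) = \<zero>\<^bsub>X\<^esub>" if a: "a \<in> I [^]\<^bsub>ideals_set R\<^esub> N" and c: "c \<in> I" for a c
    proof -
      have eq: "c \<odot>\<^bsub>X\<^esub> (a \<odot>\<^bsub>X\<^esub> x) = a \<odot>\<^bsub>X\<^esub> (c \<odot>\<^bsub>X\<^esub> x)" if "c \<in> carrier R" for c
        using that pc[OF a] x by (simp flip: X.smult_assoc1 add: X.R.m_comm)
      have "ideal {c \<in> carrier R. c \<odot>\<^bsub>X\<^esub> (a \<odot>\<^bsub>X\<^esub> x) = \<zero>\<^bsub>X\<^esub>} R"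
        by (rule ideal_annihilator[OF X]) (use x pc[OF a] in simp)
      moreover have "G \<subseteq> {c \<in> carrier R. c \<odot>\<^bsub>X\<^esub> (a \<odot>\<^bsub>X\<^esub> x) = \<zero>\<^bsub>X\<^esub>}"
        using aG[OF a] Gc by (auto simp: eq)
      ultimately have "I \<subseteq> {c \<in> carrier R. c \<odot>\<^bsub>X\<^esub> (a \<odot>\<^bsub>X\<^esub> x) = \<zero>\<^bsub>X\<^esub>}"
        unfolding I by (rule X.R.genideal_minimal)
      then have "c \<odot>\<^bsub>X\<^esub> (a \<odot>\<^bsub>X\<^esub> x) = \<zero>\<^bsub>X\<^esub>" using c by blast
      then show ?thesis using eq[of c] c by simp
    qed
    have "a \<odot>\<^bsub>X\<^esub> x = \<zero>\<^bsub>X\<^esub>" if "a \<in> I [^]\<^bsub>ideals_set R\<^esub> Suc N" for a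
    proof -
      have "a \<in> carrier R \<and> a \<odot>\<^bsub>X\<^esub> x = \<zero>\<^bsub>X\<^esub>"
        using that unfolding X.R.ideal_pow_Suc
      proof (induct rule: ideal_prod.induct)
        case (prod i j)
        then show ?case using aI[OF prod] pc[OF prod(1)] x by (simp add: X.smult_assoc1)
      next
        case (sum a b)
        then show ?case using x by (simp add: X.smult_l_distr)
      qed
      then show ?thesis by simp
    qed
    then show ?thesis using x unfolding torsion_set_def by blast
  qed
  show ?thesis
  proof
    assume x: "x \<in> torsion_set R I X"
    then obtain n where n: "\<forall>a\<in>I [^]\<^bsub>ideals_set R\<^esub> (n::nat). a \<odot>\<^bsub>X\<^esub> x = \<zero>\<^bsub>X\<^esub>" and xc: "x \<in> carrier X"
      unfolding torsion_set_def by blast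
    have "(g [^]\<^bsub>R\<^esub> n) \<odot>\<^bsub>X\<^esub> x = \<zero>\<^bsub>X\<^esub>" if "g \<in> G" for g
      using n X.R.pow_mem_ideal_pow[of g I n] that GI Gc by blast
    then show "x \<in> carrier X \<and> (\<forall>g\<in>G. \<exists>k::nat. (g [^]\<^bsub>R\<^esub> k) \<odot>\<^bsub>X\<^esub> x = \<zero>\<^bsub>X\<^esub>)" using xc by blast
  next
    assume "x \<in> carrier X \<and> (\<forall>g\<in>G. \<exists>k::nat. (g [^]\<^bsub>R\<^esub> k) \<odot>\<^bsub>X\<^esub> x = \<zero>\<^bsub>X\<^esub>)"
    then obtain k where "x \<in> carrier X" "\<And>g. g \<in> G \<Longrightarrow> (g [^]\<^bsub>R\<^esub> (k g :: nat)) \<odot>\<^bsub>X\<^esub> x = \<zero>\<^bsub>X\<^esub>"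
      by metis
    then show "x \<in> torsion_set R I X"
    proof (induct "sum k G" arbitrary: x k rule: less_induct)
      case less
      show ?case
      proof (rule step[OF less(2)])
        fix g assume g: "g \<in> G"
        show "g \<odot>\<^bsub>X\<^esub> x \<in> torsion_set R I X"
        proof (cases "k g")
          case 0
          then have "x = \<zero>\<^bsub>X\<^esub>" using less(3)[OF g] less(2) by simp
          then have "g \<odot>\<^bsub>X\<^esub> x = \<zero>\<^bsub>X\<^esub>" using Gc[OF g] by simp
          moreover have "a \<odot>\<^bsub>X\<^esub> \<zero>\<^bsub>X\<^esub> = \<zero>\<^bsub>X\<^esub>" if "a \<in> I [^]\<^bsub>ideals_set R\<^esub> (0::nat)" for a
            using that unfolding X.R.ideal_pow_0 by simp
          ultimately show ?thesis unfolding torsion_set_def mem_Collect_eq by (metis X.M.zero_closed)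
        next
          case (Suc m)
          define k' where "k' = k(g := m)"
          have "sum k' G < sum k G"
            by (rule sum_strict_mono_ex1[OF G(1)]) (use Suc g in \<open>auto simp: k'_def\<close>)
          then show ?thesis
          proof (rule less(1))
            show "g \<odot>\<^bsub>X\<^esub> x \<in> carrier X" using Gc[OF g] less(2) by simp
            fix h assume h: "h \<in> G"
            note c = Gc[OF g] Gc[OF h] less(2)
            show "(h [^]\<^bsub>R\<^esub> k' h) \<odot>\<^bsub>X\<^esub> (g \<odot>\<^bsub>X\<^esub> x) = \<zero>\<^bsub>X\<^esub>"
            proof (cases "h = g")
              case True
              then have "(h [^]\<^bsub>R\<^esub> k' h) \<odot>\<^bsub>X\<^esub> (g \<odot>\<^bsub>X\<^esub> x) = (g [^]\<^bsub>R\<^esub> k g) \<odot>\<^bsub>X\<^esub> x"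
                using c Suc by (simp add: k'_def X.smult_assoc1)
              then show ?thesis using less(3)[OF g] by simp
            next
              case False
              then have "(h [^]\<^bsub>R\<^esub> k' h) \<odot>\<^bsub>X\<^esub> (g \<odot>\<^bsub>X\<^esub> x) = g \<odot>\<^bsub>X\<^esub> ((h [^]\<^bsub>R\<^esub> k h) \<odot>\<^bsub>X\<^esub> x)"
                using c by (simp add: k'_def X.R.m_comm flip: X.smult_assoc1)
              then show ?thesis using less(3)[OF h] c by simp
            qed
          qed
        qed
      qed
    qed
  qed
qed

section \<open>Graded torsion submodules and their Baer property\<close>

context graded_cring
begin

text \<open>The nonzero components of finitely many generators are finite in number, lie in the
  homogeneous ideal, and recover the original generators as their sums.\<close>

lemma homogeneous_ideal_generators:
  assumes "noetherian_ring R" "homogeneous_ideal I"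
  shows "\<exists>G. finite G \<and> G \<subseteq> carrier R \<and> (\<forall>g\<in>G. \<exists>t. g \<in> rgr R t) \<and> I = Idl G"
proof -
  have I: "ideal I R" using assms(2) by (simp add: homogeneous_ideal_def)
  obtain A where A: "A \<subseteq> carrier R" "finite A" "I = Idl A"
    using noetherian_ring.finetely_gen[OF assms(1) I] by blast
  have AI: "A \<subseteq> I" using genideal_self[OF A(1)] A(3) by simp
  have Ac: "a \<in> carrier R" if "a \<in> A" for a using A(1) that by blast
  define G where "G = (\<Union>a\<in>A. (\<lambda>i. rc R i a) ` {i. rc R i a \<noteq> \<zero>})"
  have fin: "finite G" unfolding G_def using A(2) D.hcomp_props(2)[OF Ac] by blast
  have Gc: "G \<subseteq> carrier R" unfolding G_def using Ac by auto
  have hom: "\<exists>t. g \<in> rgr R t" if "g \<in> G" for g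
    using that D.hcomp_props(1)[OF Ac] unfolding G_def by blast
  have GI: "G \<subseteq> I" using AI assms(2) unfolding G_def homogeneous_ideal_def by blast
  interpret G: ideal "Idl G" R by (rule genideal_ideal[OF Gc])
  have "A \<subseteq> Idl G"
  proof
    fix a assume a: "a \<in> A"
    show "a \<in> Idl G"
    proof (rule D.mem_of_hcomp_mem[OF G.additive_subgroup_axioms Ac[OF a]])
      fix i
      show "rc R i a \<in> Idl G"
      proof (cases "rc R i a = \<zero>")
        case False
        then have "rc R i a \<in> G" using a unfolding G_def by blast
        then show ?thesis using genideal_self[OF Gc] by blast
      qed simp
    qed
  qed
  then have "I \<subseteq> Idl G" unfolding A(3) by (rule genideal_minimal[OF G.ideal_axioms])
  moreover have "Idl G \<subseteq> I" by (rule genideal_minimal[OF I GI])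
  ultimately have "I = Idl G" by (rule subset_antisym)
  then show ?thesis using fin Gc hom by (intro exI[of _ G]) simp
qed

text \<open>Multiplication by a power of a homogeneous generator only translates components, so if
  it kills \<open>x\<close> it kills every component of \<open>x\<close>.\<close>

lemma torsion_set_homogeneous:
  assumes "noetherian_ring R" "homogeneous_ideal I" "graded_module R X"
  shows "homogeneous_submodule R X (torsion_set R I X)"
proof -
  interpret X: module R X by (rule graded_moduleD[OF assms(3)])
  interpret DX: direct_sum X "gr X" by (rule graded_moduleD[OF assms(3)])
  obtain G where G: "finite G" "G \<subseteq> carrier R" "\<forall>g\<in>G. \<exists>t. g \<in> rgr R t" "I = Idl G"
    using homogeneous_ideal_generators[OF assms(1,2)] by blast
  have Gc: "g \<in> carrier R" if "g \<in> G" for g using G(2) that by blast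
  note iff = torsion_set_iff[OF X.module_axioms G(1,2,4)]
  have pow0: "(g [^] (k + l)) \<odot>\<^bsub>X\<^esub> x = \<zero>\<^bsub>X\<^esub>"
    if "(g [^] k) \<odot>\<^bsub>X\<^esub> x = \<zero>\<^bsub>X\<^esub>" "g \<in> carrier R" "x \<in> carrier X" for g x and k l :: nat
  proof -
    have "g [^] (k + l) = g [^] l \<otimes> g [^] k" using that by (simp add: nat_pow_mult add.commute)
    then show ?thesis using that by (simp add: X.smult_assoc1)
  qed
  show ?thesis
  proof (rule homogeneous_submoduleI[OF X.module_axioms])
    show "torsion_set R I X \<subseteq> carrier X" using iff by blast
    show "\<zero>\<^bsub>X\<^esub> \<in> torsion_set R I X" unfolding iff using Gc by simp
  next
    fix x y assume "x \<in> torsion_set R I X" "y \<in> torsion_set R I X"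
    then have x: "x \<in> carrier X" "\<forall>g\<in>G. \<exists>k::nat. (g [^] k) \<odot>\<^bsub>X\<^esub> x = \<zero>\<^bsub>X\<^esub>"
      and y: "y \<in> carrier X" "\<forall>g\<in>G. \<exists>k::nat. (g [^] k) \<odot>\<^bsub>X\<^esub> y = \<zero>\<^bsub>X\<^esub>" unfolding iff by simp_all
    have "\<exists>k::nat. (g [^] k) \<odot>\<^bsub>X\<^esub> (x \<oplus>\<^bsub>X\<^esub> y) = \<zero>\<^bsub>X\<^esub>" if g: "g \<in> G" for g
    proof -
      obtain k l :: nat where k: "(g [^] k) \<odot>\<^bsub>X\<^esub> x = \<zero>\<^bsub>X\<^esub>" "(g [^] l) \<odot>\<^bsub>X\<^esub> y = \<zero>\<^bsub>X\<^esub>" using x y g by blast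
      have "(g [^] (k + l)) \<odot>\<^bsub>X\<^esub> (x \<oplus>\<^bsub>X\<^esub> y) = \<zero>\<^bsub>X\<^esub>"
        using pow0[OF k(1) Gc[OF g] x(1), of l] pow0[OF k(2) Gc[OF g] y(1), of k] Gc[OF g] x(1) y(1)
        by (simp add: X.smult_r_distr add.commute)
      then show ?thesis by blast
    qed
    then show "x \<oplus>\<^bsub>X\<^esub> y \<in> torsion_set R I X" unfolding iff using x y by simp
  next
    fix a x assume a: "a \<in> carrier R" and "x \<in> torsion_set R I X"
    then have x: "x \<in> carrier X" "\<forall>g\<in>G. \<exists>k::nat. (g [^] k) \<odot>\<^bsub>X\<^esub> x = \<zero>\<^bsub>X\<^esub>" unfolding iff by simp_all
    have "\<exists>k::nat. (g [^] k) \<odot>\<^bsub>X\<^esub> (a \<odot>\<^bsub>X\<^esub> x) = \<zero>\<^bsub>X\<^esub>" if g: "g \<in> G" for g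
    proof -
      obtain k :: nat where k: "(g [^] k) \<odot>\<^bsub>X\<^esub> x = \<zero>\<^bsub>X\<^esub>" using x g by blast
      have "(g [^] k) \<odot>\<^bsub>X\<^esub> (a \<odot>\<^bsub>X\<^esub> x) = a \<odot>\<^bsub>X\<^esub> ((g [^] k) \<odot>\<^bsub>X\<^esub> x)"
        using a x(1) Gc[OF g] by (simp add: m_comm flip: X.smult_assoc1)
      then show ?thesis using k a by auto
    qed
    then show "a \<odot>\<^bsub>X\<^esub> x \<in> torsion_set R I X" unfolding iff using a x by simp
  next
    fix x n assume "x \<in> torsion_set R I X"
    then have x: "x \<in> carrier X" "\<forall>g\<in>G. \<exists>k::nat. (g [^] k) \<odot>\<^bsub>X\<^esub> x = \<zero>\<^bsub>X\<^esub>" unfolding iff by simp_all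
    have "\<exists>k::nat. (g [^] k) \<odot>\<^bsub>X\<^esub> hc X n x = \<zero>\<^bsub>X\<^esub>" if g: "g \<in> G" for g
    proof -
      obtain k :: nat where k: "(g [^] k) \<odot>\<^bsub>X\<^esub> x = \<zero>\<^bsub>X\<^esub>" using x g by blast
      obtain t where t: "g \<in> rgr R t" using G(3) g by blast
      \<comment> \<open>\<open>g\<close> has degree \<open>t\<close>, so its power of exponent
        \<open>k\<close> moves degree \<open>n\<close> to degree \<open>n + k t\<close>.\<close>
      have "(g [^] k) \<odot>\<^bsub>X\<^esub> hc X n x = hc X (n + int (k * t)) ((g [^] k) \<odot>\<^bsub>X\<^esub> x)"
        using hc_smult[OF assms(3) nat_pow_deg[OF t] _ x(1), of k "n + int (k * t)"] Gc[OF g] by simp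
      then show ?thesis using k by auto
    qed
    then show "hc X n x \<in> torsion_set R I X" unfolding iff using x by simp
  qed
qed

text \<open>The ideals \<open>(J : g^k)\<close> form an ascending chain, stationary from some
  \<open>k0\<close> on. For \<open>k = m + k0\<close>, \<open>g^k r\<close> in \<open>J\<close>
  forces \<open>g^k0 r\<close> in \<open>J\<close>, and this element is the witness
  \<open>a\<close>. In other words, the intersection of \<open>g^k R\<close> with \<open>J\<close>
  lies in \<open>g^m J\<close>.\<close>

lemma principal_artin_rees:
  fixes m :: nat
  assumes "noetherian_ring R" "ideal J R" "g \<in> carrier R"
  shows "\<exists>k::nat. \<forall>r\<in>carrier R. (g [^] k) \<otimes> r \<in> J \<longrightarrow> (\<exists>a\<in>J. (g [^] k) \<otimes> r = (g [^] m) \<otimes> a)"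
proof -
  interpret J: ideal J R by fact
  define C where "C k = {r \<in> carrier R. (g [^] k) \<otimes> r \<in> J}" for k :: nat
  have Ci: "ideal (C k) R" for k
  proof (rule idealI)
    show "ring R" by (rule ring_axioms)
    show "subgroup (C k) (add_monoid R)"
    proof (rule add.subgroupI)
      have "\<zero> \<in> C k" unfolding C_def using assms(3) by simp
      then show "C k \<noteq> {}" by blast
      show "\<ominus> a \<in> C k" if "a \<in> C k" for a
        using that assms(3) J.a_inv_closed unfolding C_def by (simp add: r_minus)
      show "a \<oplus> b \<in> C k" if "a \<in> C k" "b \<in> C k" for a b
        using that assms(3) unfolding C_def by (simp add: r_distr)
    qed (auto simp: C_def)
    fix a x assume a: "a \<in> C k" and x: "x \<in> carrier R"
    have "(g [^] k) \<otimes> (x \<otimes> a) = x \<otimes> ((g [^] k) \<otimes> a)"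
      using a x assms(3) unfolding C_def by (simp add: m_lcomm)
    then show "x \<otimes> a \<in> C k" using a x J.I_l_closed unfolding C_def by simp
    then show "a \<otimes> x \<in> C k" using a x m_comm[of a x] unfolding C_def by simp
  qed
  have Cs: "C k \<subseteq> C (Suc k)" for k
  proof
    fix r assume r: "r \<in> C k"
    have "(g [^] Suc k) \<otimes> r = g \<otimes> ((g [^] k) \<otimes> r)"
      using r assms(3) unfolding C_def by (simp add: m_ac)
    then show "r \<in> C (Suc k)" using r assms(3) J.I_l_closed unfolding C_def by simp
  qed
  have mono: "C k \<subseteq> C l" if "k \<le> l" for k l
    by (rule lift_Suc_mono_le[of C, OF Cs that])
  have "subset.chain {I. ideal I R} (range C)"
  proof (rule subset.chainI)
    show "range C \<subseteq> {I. ideal I R}" using Ci by auto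
    fix X Y assume "X \<in> range C" "Y \<in> range C"
    then obtain k l where kl: "X = C k" "Y = C l" by auto
    show "(\<subset>)\<^sup>=\<^sup>= X Y \<or> (\<subset>)\<^sup>=\<^sup>= Y X"
    proof (cases "k \<le> l")
      case True
      then show ?thesis using mono[of k l] kl by auto
    next
      case False
      then show ?thesis using mono[of l k] kl by auto
    qed
  qed
  then have "\<Union>(range C) \<in> range C"
    by (intro noetherian_ring.ideal_chain_is_trivial[OF assms(1)]) auto
  then obtain k0 where k0: "\<Union>(range C) = C k0" by auto
  have "\<exists>a\<in>J. (g [^] (m + k0)) \<otimes> r = (g [^] m) \<otimes> a"
    if r: "r \<in> carrier R" "(g [^] (m + k0)) \<otimes> r \<in> J" for r
  proof -
    have "r \<in> C (m + k0)" using r unfolding C_def by simp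
    then have "r \<in> C k0" using k0 by blast
    then have "(g [^] k0) \<otimes> r \<in> J" unfolding C_def by simp
    moreover have "(g [^] (m + k0)) \<otimes> r = (g [^] m) \<otimes> ((g [^] k0) \<otimes> r)"
      using r assms(3) by (simp add: m_assoc flip: nat_pow_mult)
    ultimately show ?thesis by blast
  qed
  then show ?thesis by blast
qed

text \<open>Here \<open>e\<close> represents the map \<open>a \<mapsto> a e\<close> on \<open>J\<close>. By the principal Artin--Rees lemma this map can be
  extended by \<open>0\<close> on \<open>g\<^sup>k R\<close>, and an element representing the extension is killed by \<open>g\<^sup>k\<close>. Treating the
  generators of the ideal one after another avoids the general Artin--Rees lemma.\<close>

lemma baer_torsion_step:
  fixes m :: nat
  assumes noeth: "noetherian_ring R" and X: "graded_module R X" "graded_baer X"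
    and J: "homogeneous_ideal J" and e: "e \<in> gr X n" and g: "g \<in> rgr R t"
    and m: "\<And>a. a \<in> J \<Longrightarrow> (g [^] m) \<odot>\<^bsub>X\<^esub> (a \<odot>\<^bsub>X\<^esub> e) = \<zero>\<^bsub>X\<^esub>"
  shows "\<exists>(k::nat) e' W. e' \<in> gr X n \<and> homogeneous_ideal W \<and> J \<subseteq> W \<and> g [^] k \<in> W \<and>
    (\<forall>a\<in>J. a \<odot>\<^bsub>X\<^esub> e' = a \<odot>\<^bsub>X\<^esub> e) \<and> (g [^] k) \<odot>\<^bsub>X\<^esub> e' = \<zero>\<^bsub>X\<^esub> \<and>
    (\<forall>w\<in>W. \<exists>a\<in>J. w \<odot>\<^bsub>X\<^esub> e' = a \<odot>\<^bsub>X\<^esub> e)"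
proof -
  interpret X: module R X by (rule graded_moduleD[OF X(1)])
  interpret DX: direct_sum X "gr X" by (rule graded_moduleD[OF X(1)])
  have Ji: "ideal J R" using J by (simp add: homogeneous_ideal_def)
  interpret J: ideal J R by (rule Ji)
  have gc: "g \<in> carrier R" by (rule rgr_closed[OF g])
  have ec: "e \<in> carrier X" by (rule DX.component_closed[OF e])
  \<comment> \<open>With this \<open>k\<close>, the map on \<open>J\<close> and the zero map on the
    multiples of \<open>g^k\<close> agree on the overlap: its elements are of the form
    \<open>g^m a\<close> with \<open>a\<close> in \<open>J\<close>, and \<open>g^m\<close> kills
    \<open>a e\<close>.\<close>
  obtain k :: nat where k: "\<forall>r\<in>carrier R. (g [^] k) \<otimes> r \<in> J \<longrightarrow> (\<exists>a\<in>J. (g [^] k) \<otimes> r = (g [^] m) \<otimes> a)"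
    using principal_artin_rees[OF noeth Ji gc] by blast
  have hJ: "homogeneous_submodule R (shifted n) J" using J homogeneous_ideal_iff by blast
  have gk: "g [^] k \<in> gr (shifted n) (n + int (k * t))"
    using nat_pow_deg[OF g, of k] by (simp del: of_nat_mult)
  have gkc: "g [^] k \<in> carrier R" using gc by simp
  \<comment> \<open>The twist on which multiplication by the power of \<open>g\<close>, with values
    in \<open>shifted n\<close>, has degree 0.\<close>
  define Q where "Q = shifted (n + int (k * t))"
  have j: "(\<lambda>r. r \<otimes> g [^] k) \<in> lin_maps_deg R Q (shifted n) 0"
    using smult_map[OF shifted_graded gk] by (simp add: Q_def)
  have h: "(\<lambda>_. \<zero>\<^bsub>X\<^esub>) \<in> lin_maps_deg R Q X 0"
    by (rule lin_maps_degI[OF lin_maps_const_zero[OF X.module_axioms]]) simp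
  have f: "(\<lambda>a. a \<odot>\<^bsub>X\<^esub> e) \<in> lin_maps_deg R (sub_gmodule (shifted n) J) X 0"
    by (rule lin_maps_deg_sub[OF smult_map[OF X(1) e]]) (use J.Icarr in auto)
  have compat: "(q \<otimes> g [^] k) \<odot>\<^bsub>X\<^esub> e = \<zero>\<^bsub>X\<^esub>" if q: "q \<in> carrier Q" "q \<otimes> g [^] k \<in> J" for q
  proof -
    have qc: "q \<in> carrier R" using q(1) by (simp add: Q_def)
    then obtain a where a: "a \<in> J" "(g [^] k) \<otimes> q = (g [^] m) \<otimes> a"
      using k q(2) m_comm[OF qc gkc] by auto
    have "(q \<otimes> g [^] k) \<odot>\<^bsub>X\<^esub> e = (g [^] m) \<odot>\<^bsub>X\<^esub> (a \<odot>\<^bsub>X\<^esub> e)"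
      using a(2) m_comm[OF qc gkc] gc J.Icarr[OF a(1)] ec by (simp add: X.smult_assoc1)
    then show ?thesis using m[OF a(1)] by simp
  qed
  define W where "W = {z \<oplus>\<^bsub>shifted n\<^esub> q \<otimes> g [^] k |z q. z \<in> J \<and> q \<in> carrier Q}"
  have Qg: "graded_module R Q" unfolding Q_def by (rule shifted_graded)
  note glue = glue_maps[OF shifted_graded X(1) Qg hJ f j h compat, folded W_def]
  have W: "homogeneous_ideal W" using glue(1) homogeneous_ideal_iff by blast
  obtain u where u: "u \<in> lin_maps_deg R (sub_gmodule (shifted n) W) X 0"
    "\<forall>z\<in>J. u z = z \<odot>\<^bsub>X\<^esub> e" "\<forall>q\<in>carrier Q. u (q \<otimes> g [^] k) = \<zero>\<^bsub>X\<^esub>"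
    using glue(2) by blast
  from graded_baerD[OF X(2) W u(1)] obtain e' where e': "e' \<in> gr X n" "\<And>a. a \<in> W \<Longrightarrow> u a = a \<odot>\<^bsub>X\<^esub> e'"
    by auto
  have ec': "e' \<in> carrier X" by (rule DX.component_closed[OF e'(1)])
  have JW: "J \<subseteq> W" by (rule glue(3))
  have qW: "q \<otimes> g [^] k \<in> W" if "q \<in> carrier R" for q
  proof -
    have "q \<otimes> g [^] k \<in> (\<lambda>q. q \<otimes> g [^] k) ` carrier Q" by (rule imageI) (use that in \<open>simp add: Q_def\<close>)
    then show ?thesis using glue(4) by blast
  qed
  have gW: "g [^] k \<in> W" using qW[of \<one>] gkc by simp
  have Je: "a \<odot>\<^bsub>X\<^esub> e' = a \<odot>\<^bsub>X\<^esub> e" if "a \<in> J" for a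
    using u(2) e'(2)[OF subsetD[OF JW that]] that by simp
  have qe: "(q \<otimes> g [^] k) \<odot>\<^bsub>X\<^esub> e' = \<zero>\<^bsub>X\<^esub>" if "q \<in> carrier R" for q
    using u(3) e'(2)[OF qW[OF that]] that by (simp add: Q_def)
  have "(g [^] k) \<odot>\<^bsub>X\<^esub> e' = \<zero>\<^bsub>X\<^esub>" using qe[of \<one>] gkc by simp
  \<comment> \<open>All values on \<open>W\<close> already occur on \<open>J\<close>. This hands the
    torsion hypothesis for the remaining generators over to \<open>W\<close> and
    \<open>e'\<close>.\<close>
  moreover have "\<exists>a\<in>J. w \<odot>\<^bsub>X\<^esub> e' = a \<odot>\<^bsub>X\<^esub> e" if "w \<in> W" for w
  proof -
    have "\<exists>z q. w = z \<oplus>\<^bsub>shifted n\<^esub> q \<otimes> g [^] k \<and> z \<in> J \<and> q \<in> carrier Q"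
      using that unfolding W_def by (rule CollectD)
    then obtain z q where zq: "z \<in> J" "q \<in> carrier R" "w = z \<oplus> q \<otimes> g [^] k"
      unfolding Q_def shifted_simps by (elim exE conjE)
    have "w \<odot>\<^bsub>X\<^esub> e' = z \<odot>\<^bsub>X\<^esub> e' \<oplus>\<^bsub>X\<^esub> (q \<otimes> g [^] k) \<odot>\<^bsub>X\<^esub> e'"
      using zq gkc ec' J.Icarr[OF zq(1)] by (simp add: X.smult_l_distr)
    then have "w \<odot>\<^bsub>X\<^esub> e' = z \<odot>\<^bsub>X\<^esub> e"
      using qe[OF zq(2)] Je[OF zq(1)] J.Icarr[OF zq(1)] ec by simp
    then show ?thesis using zq(1) by blast
  qed
  ultimately show ?thesis using e'(1) W JW gW Je
    by (intro exI[of _ k] exI[of _ e'] exI[of _ W] conjI ballI)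
qed

text \<open>Induction on the generators. Each stage adds to \<open>J\<close> a power of
  \<open>g\<close> that kills the current element. Later corrections keep the products with the
  enlarged ideal, hence also this annihilation.\<close>

lemma baer_torsion_element:
  assumes noeth: "noetherian_ring R" and X: "graded_module R X" "graded_baer X"
    and "finite G" "\<forall>g\<in>G. \<exists>t. g \<in> rgr R t"
    and "homogeneous_ideal J" and "e \<in> gr X n"
    and "\<forall>g\<in>G. \<exists>m::nat. \<forall>a\<in>J. (g [^] m) \<odot>\<^bsub>X\<^esub> (a \<odot>\<^bsub>X\<^esub> e) = \<zero>\<^bsub>X\<^esub>"
  shows "\<exists>e'\<in>gr X n. (\<forall>a\<in>J. a \<odot>\<^bsub>X\<^esub> e' = a \<odot>\<^bsub>X\<^esub> e) \<and>
    (\<forall>g\<in>G. \<exists>k::nat. (g [^] k) \<odot>\<^bsub>X\<^esub> e' = \<zero>\<^bsub>X\<^esub>)"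
  using assms(4-8)
proof (induct G arbitrary: J e)
  case empty
  then show ?case by blast
next
  case (insert g G)
  obtain t where t: "g \<in> rgr R t" using insert(4) by blast
  obtain m :: nat where m: "\<And>a. a \<in> J \<Longrightarrow> (g [^] m) \<odot>\<^bsub>X\<^esub> (a \<odot>\<^bsub>X\<^esub> e) = \<zero>\<^bsub>X\<^esub>"
    using insert(7) by blast
  from baer_torsion_step[OF noeth X insert(5,6) t m] obtain k :: nat and e' W where
    e': "e' \<in> gr X n" and W: "homogeneous_ideal W" "J \<subseteq> W" "g [^] k \<in> W"
    and Je: "\<forall>a\<in>J. a \<odot>\<^bsub>X\<^esub> e' = a \<odot>\<^bsub>X\<^esub> e" and ge: "(g [^] k) \<odot>\<^bsub>X\<^esub> e' = \<zero>\<^bsub>X\<^esub>"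
    and We: "\<forall>w\<in>W. \<exists>a\<in>J. w \<odot>\<^bsub>X\<^esub> e' = a \<odot>\<^bsub>X\<^esub> e" by blast
  have tor: "\<forall>h\<in>G. \<exists>m::nat. \<forall>w\<in>W. (h [^] m) \<odot>\<^bsub>X\<^esub> (w \<odot>\<^bsub>X\<^esub> e') = \<zero>\<^bsub>X\<^esub>"
  proof
    fix h assume h: "h \<in> G"
    then obtain m :: nat where hm: "\<forall>a\<in>J. (h [^] m) \<odot>\<^bsub>X\<^esub> (a \<odot>\<^bsub>X\<^esub> e) = \<zero>\<^bsub>X\<^esub>" using insert(7) by blast
    have "(h [^] m) \<odot>\<^bsub>X\<^esub> (w \<odot>\<^bsub>X\<^esub> e') = \<zero>\<^bsub>X\<^esub>" if w: "w \<in> W" for w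
      using bspec[OF We w] hm by auto
    then show "\<exists>m::nat. \<forall>w\<in>W. (h [^] m) \<odot>\<^bsub>X\<^esub> (w \<odot>\<^bsub>X\<^esub> e') = \<zero>\<^bsub>X\<^esub>" by blast
  qed
  have Gd: "\<forall>g\<in>G. \<exists>t. g \<in> rgr R t" using insert(4) by blast
  from insert(3)[OF Gd W(1) e' tor] obtain e'' where e'': "e'' \<in> gr X n"
    "\<forall>w\<in>W. w \<odot>\<^bsub>X\<^esub> e'' = w \<odot>\<^bsub>X\<^esub> e'" "\<forall>g\<in>G. \<exists>k::nat. (g [^] k) \<odot>\<^bsub>X\<^esub> e'' = \<zero>\<^bsub>X\<^esub>" by blast
  have "\<forall>a\<in>J. a \<odot>\<^bsub>X\<^esub> e'' = a \<odot>\<^bsub>X\<^esub> e" using e''(2) Je W(2) by (simp add: subset_iff)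
  moreover have "(g [^] k) \<odot>\<^bsub>X\<^esub> e'' = \<zero>\<^bsub>X\<^esub>" using e''(2) W(3) ge by simp
  then have "\<forall>g\<in>insert g G. \<exists>k::nat. (g [^] k) \<odot>\<^bsub>X\<^esub> e'' = \<zero>\<^bsub>X\<^esub>" using e''(3) by blast
  ultimately show ?case using e''(1) by blast
qed

text \<open>Graded form of the fact that over a Noetherian ring the torsion of an injective module
  is injective. The map is represented by some \<open>e\<close> of \<open>X\<close>, which
  \<open>baer_torsion_element\<close> replaces by a torsion element with the same products on
  \<open>J\<close>.\<close>

lemma torsion_graded_baer:
  assumes noeth: "noetherian_ring R" and I: "homogeneous_ideal I"
    and X: "graded_module R X" "graded_baer X"
  shows "graded_baer (torsion_gmodule R I X)"
  unfolding graded_baer_def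
proof (intro allI ballI impI)
  interpret X: module R X by (rule graded_moduleD[OF X(1)])
  interpret DX: direct_sum X "gr X" by (rule graded_moduleD[OF X(1)])
  fix J n f assume f: "f \<in> lin_maps_deg R (sub_gmodule (shifted n) J) (torsion_gmodule R I X) 0"
    and J: "homogeneous_ideal J"
  let ?T = "torsion_set R I X"
  have Ji: "ideal J R" using J by (simp add: homogeneous_ideal_def)
  obtain G where G: "finite G" "G \<subseteq> carrier R" "\<forall>g\<in>G. \<exists>t. g \<in> rgr R t" "I = Idl G"
    using homogeneous_ideal_generators[OF noeth I] by blast
  have Gc: "g \<in> carrier R" if "g \<in> G" for g using G(2) that by blast
  note iff = torsion_set_iff[OF X.module_axioms G(1,2,4)]
  note T = homogeneous_submoduleD[OF X.module_axioms torsion_set_homogeneous[OF noeth I X(1)]]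
  have hJ: "homogeneous_submodule R (shifted n) J" using J homogeneous_ideal_iff by blast
  have dJ: "direct_sum (sub_gmodule (shifted n) J) (gr (sub_gmodule (shifted n) J))"
    by (rule graded_moduleD(2)[OF homogeneous_sub_gmodule(1)[OF shifted_graded hJ graded]])
  have fX: "f \<in> lin_maps_deg R (sub_gmodule (shifted n) J) X 0" and fT: "\<And>a. a \<in> J \<Longrightarrow> f a \<in> ?T"
    using f lin_maps_deg_into_sub[OF dJ T(2)] by (simp_all add: torsion_gmodule_eq)
  from graded_baerD[OF X(2) J fX] obtain e where e: "e \<in> gr X n" "\<And>a. a \<in> J \<Longrightarrow> f a = a \<odot>\<^bsub>X\<^esub> e" by auto
  have ec: "e \<in> carrier X" by (rule DX.component_closed[OF e(1)])
  obtain A where A: "A \<subseteq> carrier R" "finite A" "J = Idl A"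
    using noetherian_ring.finetely_gen[OF noeth Ji] by blast
  have AJ: "a \<in> J" if "a \<in> A" for a using genideal_self[OF A(1)] A(3) that by blast
  \<comment> \<open>The exponent has to be uniform in \<open>a\<close>. As \<open>J\<close> is
    finitely generated, the sum of the exponents of its generators serves.\<close>
  have "\<exists>m::nat. \<forall>a\<in>J. (g [^] m) \<odot>\<^bsub>X\<^esub> (a \<odot>\<^bsub>X\<^esub> e) = \<zero>\<^bsub>X\<^esub>" if g: "g \<in> G" for g
  proof -
    have "\<exists>m::nat. (g [^] m) \<odot>\<^bsub>X\<^esub> (a \<odot>\<^bsub>X\<^esub> e) = \<zero>\<^bsub>X\<^esub>" if a: "a \<in> A" for a
      using fT[OF AJ[OF a]] e(2)[OF AJ[OF a]] g unfolding iff by simp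
    then obtain m where m: "\<And>a. a \<in> A \<Longrightarrow> (g [^] (m a :: nat)) \<odot>\<^bsub>X\<^esub> (a \<odot>\<^bsub>X\<^esub> e) = \<zero>\<^bsub>X\<^esub>" by metis
    define M where "M = sum m A"
    have gM: "(g [^] M) \<in> carrier R" using Gc[OF g] by simp
    have eq: "a \<odot>\<^bsub>X\<^esub> ((g [^] M) \<odot>\<^bsub>X\<^esub> e) = (g [^] M) \<odot>\<^bsub>X\<^esub> (a \<odot>\<^bsub>X\<^esub> e)" if "a \<in> carrier R" for a
      using that gM ec by (simp add: m_comm flip: X.smult_assoc1)
    have "(g [^] M) \<odot>\<^bsub>X\<^esub> (a \<odot>\<^bsub>X\<^esub> e) = \<zero>\<^bsub>X\<^esub>" if a: "a \<in> A" for a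
    proof -
      have ac: "a \<in> carrier R" using a A(1) by blast
      have "m a \<le> M" unfolding M_def by (rule member_le_sum[OF a _ A(2)]) simp
      then have "g [^] M = g [^] (M - m a) \<otimes> g [^] m a" using Gc[OF g] by (simp add: nat_pow_mult)
      then show ?thesis using m[OF a] Gc[OF g] ac ec by (simp add: X.smult_assoc1)
    qed
    then have "A \<subseteq> {a \<in> carrier R. a \<odot>\<^bsub>X\<^esub> ((g [^] M) \<odot>\<^bsub>X\<^esub> e) = \<zero>\<^bsub>X\<^esub>}" using A(1) eq by auto
    moreover have "ideal {a \<in> carrier R. a \<odot>\<^bsub>X\<^esub> ((g [^] M) \<odot>\<^bsub>X\<^esub> e) = \<zero>\<^bsub>X\<^esub>} R"
      by (rule ideal_annihilator[OF X.module_axioms]) (use gM ec in simp)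
    ultimately have "J \<subseteq> {a \<in> carrier R. a \<odot>\<^bsub>X\<^esub> ((g [^] M) \<odot>\<^bsub>X\<^esub> e) = \<zero>\<^bsub>X\<^esub>}"
      unfolding A(3) by (intro genideal_minimal)
    then show ?thesis using eq by (intro exI[of _ M]) auto
  qed
  then obtain e' where e': "e' \<in> gr X n" "\<forall>a\<in>J. a \<odot>\<^bsub>X\<^esub> e' = a \<odot>\<^bsub>X\<^esub> e"
    "\<forall>g\<in>G. \<exists>k::nat. (g [^] k) \<odot>\<^bsub>X\<^esub> e' = \<zero>\<^bsub>X\<^esub>"
    using baer_torsion_element[OF noeth X G(1,3) J e(1)] by blast
  have "e' \<in> ?T" unfolding iff using e'(3) DX.component_closed[OF e'(1)] by simp
  then have "e' \<in> gr (torsion_gmodule R I X) n" using e'(1) by (simp add: torsion_gmodule_eq)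
  moreover have "\<forall>a\<in>J. f a = a \<odot>\<^bsub>torsion_gmodule R I X\<^esub> e'" using e'(2) e(2) by (simp add: torsion_gmodule_eq)
  ultimately show "\<exists>e\<in>gr (torsion_gmodule R I X) n. \<forall>a\<in>J. f a = a \<odot>\<^bsub>torsion_gmodule R I X\<^esub> e" by blast
qed

end

section \<open>Cochains on a graded free resolution\<close>

lemma ker_of_homogeneous:
  assumes T: "graded_module R T" and T': "graded_module R T'" and \<delta>: "\<delta> \<in> lin_maps_deg R T T' 0"
  shows "homogeneous_submodule R T (ker_of T T' \<delta>)"
proof -
  interpret T: module R T by (rule graded_moduleD[OF T])
  interpret T': module R T' by (rule graded_moduleD[OF T'])
  interpret DT: direct_sum T "gr T" by (rule graded_moduleD[OF T])
  interpret DT': direct_sum T' "gr T'" by (rule graded_moduleD[OF T'])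
  note d = lin_mapsD[OF lin_maps_degD(1)[OF \<delta>]]
  note d0 = lin_maps_zero[OF lin_maps_degD(1)[OF \<delta>] T.module_axioms T'.module_axioms]
  show ?thesis
  proof (rule homogeneous_submoduleI[OF T.module_axioms])
    fix x n assume "x \<in> ker_of T T' \<delta>"
    then have x: "x \<in> carrier T" "\<delta> x = \<zero>\<^bsub>T'\<^esub>" by (simp_all add: ker_of_def)
    have "\<delta> (hc T n x) = \<zero>\<^bsub>T'\<^esub>" using lin_maps_deg_hc[OF \<delta> T T' x(1), of n] x(2) by simp
    then show "hc T n x \<in> ker_of T T' \<delta>" using x(1) by (simp add: ker_of_def)
  qed (auto simp: ker_of_def d d0)
qed

lemma image_homogeneous:
  assumes T: "graded_module R T" and T': "graded_module R T'" and \<delta>: "\<delta> \<in> lin_maps_deg R T T' 0"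
  shows "homogeneous_submodule R T' (\<delta> ` carrier T)"
proof -
  interpret T: module R T by (rule graded_moduleD[OF T])
  interpret T': module R T' by (rule graded_moduleD[OF T'])
  interpret DT: direct_sum T "gr T" by (rule graded_moduleD[OF T])
  note d = lin_mapsD[OF lin_maps_degD(1)[OF \<delta>]]
  note d0 = lin_maps_zero[OF lin_maps_degD(1)[OF \<delta>] T.module_axioms T'.module_axioms]
  show ?thesis
  proof (rule homogeneous_submoduleI[OF T'.module_axioms])
    show "\<delta> ` carrier T \<subseteq> carrier T'" using d(1) by auto
    show "\<zero>\<^bsub>T'\<^esub> \<in> \<delta> ` carrier T" using d0 by (intro image_eqI[of _ _ "\<zero>\<^bsub>T\<^esub>"]) simp_all
  next
    fix x y assume "x \<in> \<delta> ` carrier T" "y \<in> \<delta> ` carrier T"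
    then obtain x' y' where "x' \<in> carrier T" "x = \<delta> x'" "y' \<in> carrier T" "y = \<delta> y'" by auto
    then show "x \<oplus>\<^bsub>T'\<^esub> y \<in> \<delta> ` carrier T" by (intro image_eqI[of _ _ "x' \<oplus>\<^bsub>T\<^esub> y'"]) (simp_all add: d)
  next
    fix a x assume a: "a \<in> carrier R" "x \<in> \<delta> ` carrier T"
    then obtain x' where "x' \<in> carrier T" "x = \<delta> x'" by auto
    then show "a \<odot>\<^bsub>T'\<^esub> x \<in> \<delta> ` carrier T" using a by (intro image_eqI[of _ _ "a \<odot>\<^bsub>T\<^esub> x'"]) (simp_all add: d)
  next
    fix x n assume "x \<in> \<delta> ` carrier T"
    then obtain x' where "x' \<in> carrier T" "x = \<delta> x'" by auto
    then show "hc T' n x \<in> \<delta> ` carrier T"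
      using lin_maps_deg_hc[OF \<delta> T T', of x' n] by (intro image_eqI[of _ _ "hc T n x'"]) simp_all
  qed
qed

text \<open>One degree \<open>n\<close> is fixed as a parameter, because the vanishing hypotheses
  are used one degree at a time. The map onto the resolved module is added in
  \<open>augmented_free_complex\<close>.\<close>

locale free_complex = graded_cring R for R :: "'a gring" (structure) +
  fixes P :: "nat \<Rightarrow> ('a, 'p) gmodule" and d :: "nat \<Rightarrow> 'p \<Rightarrow> 'p" and n :: int
  assumes free: "fin_graded_free R (P i)"
    and d_deg: "d i \<in> lin_maps_deg R (P (Suc i)) (P i) 0"
    and resolution_exact: "ker_of (P (Suc i)) (P i) (d i) = d (Suc i) ` carrier (P (Suc (Suc i)))"
begin

lemma P_graded: "graded_module R (P i)"
  using free by (simp add: fin_graded_free_def)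

lemma P_module: "module R (P i)"
  by (rule graded_moduleD[OF P_graded])

lemma P_direct_sum: "direct_sum (P i) (gr (P i))"
  by (rule graded_moduleD[OF P_graded])

lemma d_closed: "x \<in> carrier (P (Suc i)) \<Longrightarrow> d i x \<in> carrier (P i)"
  by (rule lin_mapsD(1)[OF lin_maps_degD(1)[OF d_deg]])

lemma d_d: "x \<in> carrier (P (Suc (Suc i))) \<Longrightarrow> d i (d (Suc i) x) = \<zero>\<^bsub>P i\<^esub>"
  using resolution_exact[of i] by (auto simp: ker_of_def)

abbreviation cochains :: "nat \<Rightarrow> ('a, 'm) gmodule \<Rightarrow> ('p \<Rightarrow> 'm) set" where
  "cochains i X \<equiv> lin_maps_deg R (P i) X n"

text \<open>Cochains are constrained on the carrier only, so that lambda terms are cochains as they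
  stand; extensional functions return when \<open>Ext_gmodule\<close> itself is treated.\<close>

definition cocycles :: "nat \<Rightarrow> ('a, 'm) gmodule \<Rightarrow> ('p \<Rightarrow> 'm) set" where
  "cocycles i X = {f \<in> cochains i X. \<forall>x\<in>carrier (P (Suc i)). f (d i x) = \<zero>\<^bsub>X\<^esub>}"

text \<open>For a resolution \<open>P\<close> of \<open>N\<close>, this says \<open>Ext\<^sup>i\<^sup>+\<^sup>1(N, X)\<^sub>n = 0\<close>: note the shift of the index.\<close>

definition exact_at :: "nat \<Rightarrow> ('a, 'm) gmodule \<Rightarrow> bool" where
  "exact_at i X \<longleftrightarrow> (\<forall>f\<in>cocycles (Suc i) X. \<exists>g\<in>cochains i X. \<forall>x\<in>carrier (P (Suc i)). f x = g (d i x))"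

lemma cochain_comp_d: "g \<in> cochains i X \<Longrightarrow> (\<lambda>x. g (d i x)) \<in> cochains (Suc i) X"
  by (rule lin_maps_deg_comp[OF d_deg]) simp_all

lemma cochain_closed: "f \<in> cochains i X \<Longrightarrow> x \<in> carrier (P i) \<Longrightarrow> f x \<in> carrier X"
  by (rule lin_mapsD(1)[OF lin_maps_degD(1)])

lemma cochain_zero: "f \<in> cochains i X \<Longrightarrow> graded_module R X \<Longrightarrow> f \<zero>\<^bsub>P i\<^esub> = \<zero>\<^bsub>X\<^esub>"
  by (rule lin_maps_zero[OF lin_maps_degD(1) P_module graded_moduleD(1)])

lemma cochain_d_d:
  "g \<in> cochains i X \<Longrightarrow> graded_module R X \<Longrightarrow> x \<in> carrier (P (Suc (Suc i))) \<Longrightarrow>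
    g (d i (d (Suc i) x)) = \<zero>\<^bsub>X\<^esub>"
  by (simp add: d_d cochain_zero)

lemma coboundary_cocycle:
  "g \<in> cochains i X \<Longrightarrow> graded_module R X \<Longrightarrow> (\<lambda>x. g (d i x)) \<in> cocycles (Suc i) X"
  by (simp add: cocycles_def cochain_comp_d cochain_d_d)

lemma cochains_sub:
  assumes "S \<subseteq> carrier X"
  shows "f \<in> cochains i (sub_gmodule X S) \<longleftrightarrow> f \<in> cochains i X \<and> (\<forall>x\<in>carrier (P i). f x \<in> S)"
  by (rule lin_maps_deg_into_sub[OF P_direct_sum assms])

lemma cocycles_sub:
  assumes "S \<subseteq> carrier X"
  shows "f \<in> cocycles i (sub_gmodule X S) \<longleftrightarrow> f \<in> cocycles i X \<and> (\<forall>x\<in>carrier (P i). f x \<in> S)"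
  using cochains_sub[OF assms] by (auto simp: cocycles_def)

lemma exact_atD:
  assumes "exact_at i X" "f \<in> cocycles (Suc i) X"
  obtains g where "g \<in> cochains i X" "\<And>x. x \<in> carrier (P (Suc i)) \<Longrightarrow> f x = g (d i x)"
  using assms unfolding exact_at_def by blast

text \<open>A cocycle vanishes on the kernel of \<open>d i\<close>, hence induces a map on the image
  of \<open>d i\<close>, and \<open>baer_extend\<close> extends this map to the free module
  \<open>P i\<close>.\<close>

lemma graded_baer_exact:
  assumes X: "graded_module R X" "graded_baer X"
  shows "exact_at i X"
  unfolding exact_at_def
proof
  interpret X: module R X by (rule graded_moduleD[OF X(1)])
  interpret Pi: module R "P i" by (rule P_module)
  fix f assume "f \<in> cocycles (Suc i) X"
  then have f: "f \<in> cochains (Suc i) X" "\<And>x. x \<in> carrier (P (Suc (Suc i))) \<Longrightarrow> f (d (Suc i) x) = \<zero>\<^bsub>X\<^esub>"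
    by (simp_all add: cocycles_def)
  have zero: "(\<lambda>_. \<zero>\<^bsub>X\<^esub>) \<in> lin_maps_deg R (sub_gmodule (P i) {\<zero>\<^bsub>P i\<^esub>}) X n"
    by (rule lin_maps_degI[OF lin_maps_const_zero[OF X.module_axioms]])
      (rule direct_sum.component_zero[OF graded_moduleD(2)[OF X(1)]])
  have compat: "\<zero>\<^bsub>X\<^esub> = f q" if "q \<in> carrier (P (Suc i))" "d i q \<in> {\<zero>\<^bsub>P i\<^esub>}" for q
  proof -
    have "q \<in> ker_of (P (Suc i)) (P i) (d i)" using that by (simp add: ker_of_def)
    then show ?thesis using f(2) unfolding resolution_exact by auto
  qed
  \<comment> \<open>The image of \<open>d i\<close>: the induced map arises by gluing the zero map
    on the zero submodule with \<open>f\<close> along \<open>d i\<close>.\<close>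
  let ?W = "{z \<oplus>\<^bsub>P i\<^esub> d i q |z q. z \<in> {\<zero>\<^bsub>P i\<^esub>} \<and> q \<in> carrier (P (Suc i))}"
  note glue = glue_maps[OF P_graded X(1) P_graded zero_submodule[OF P_graded] zero d_deg f(1) compat]
  obtain g where g: "g \<in> lin_maps_deg R (sub_gmodule (P i) ?W) X n"
    "\<forall>q\<in>carrier (P (Suc i)). g (d i q) = f q" using glue(2) by blast
  from baer_extend[OF X free glue(1) g(1)] obtain h where
    h: "h \<in> cochains i X" "\<forall>z\<in>?W. h z = g z" by blast
  have "f x = h (d i x)" if x: "x \<in> carrier (P (Suc i))" for x
  proof -
    have "d i x \<in> ?W" using glue(4) imageI[OF x, of "d i"] by (rule subsetD)
    then show ?thesis using h(2) g(2) x by simp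
  qed
  then show "\<exists>h\<in>cochains i X. \<forall>x\<in>carrier (P (Suc i)). f x = h (d i x)" using h(1) by blast
qed

text \<open>The vanishing of \<open>Ext\<^sup>i\<^sup>+\<^sup>1(-, X/N)\<^sub>n\<close>, expressed by cochains with values in \<open>X\<close>.\<close>

definition exact_mod :: "nat \<Rightarrow> ('a, 'm) gmodule \<Rightarrow> 'm set \<Rightarrow> bool" where
  "exact_mod i X N \<longleftrightarrow> (\<forall>f\<in>cochains (Suc i) X.
     (\<forall>x\<in>carrier (P (Suc (Suc i))). f (d (Suc i) x) \<in> N) \<longrightarrow>
     (\<exists>g\<in>cochains i X. \<forall>x\<in>carrier (P (Suc i)). f x \<ominus>\<^bsub>X\<^esub> g (d i x) \<in> N))"

text \<open>The middle term of a long exact sequence: a cocycle is a coboundary modulo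
  \<open>N\<close>, and what remains is an \<open>N\<close>-valued cocycle, which is a coboundary by
  \<open>sub\<close>.\<close>

lemma exact_extension:
  assumes X: "graded_module R X" and N: "homogeneous_submodule R X N"
    and sub: "exact_at i (sub_gmodule X N)" and quot: "exact_mod i X N"
  shows "exact_at i X"
  unfolding exact_at_def
proof
  interpret X: module R X by (rule graded_moduleD[OF X])
  note Nd = homogeneous_submoduleD[OF X.module_axioms N]
  fix f assume "f \<in> cocycles (Suc i) X"
  then have f: "f \<in> cochains (Suc i) X" "\<And>x. x \<in> carrier (P (Suc (Suc i))) \<Longrightarrow> f (d (Suc i) x) = \<zero>\<^bsub>X\<^esub>"
    by (simp_all add: cocycles_def)
  obtain g where g: "g \<in> cochains i X" "\<forall>x\<in>carrier (P (Suc i)). f x \<ominus>\<^bsub>X\<^esub> g (d i x) \<in> N"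
    using quot f Nd(3) unfolding exact_mod_def by auto
  let ?u = "\<lambda>x. f x \<ominus>\<^bsub>X\<^esub> g (d i x)"
  have "?u \<in> cochains (Suc i) X" by (rule lin_maps_deg_minus[OF f(1) cochain_comp_d[OF g(1)] X])
  moreover have "?u (d (Suc i) x) = \<zero>\<^bsub>X\<^esub>" if "x \<in> carrier (P (Suc (Suc i)))" for x
    using f(2)[OF that] cochain_d_d[OF g(1) X that] by (simp add: a_minus_def X.M.r_neg)
  ultimately have "?u \<in> cocycles (Suc i) (sub_gmodule X N)"
    unfolding cocycles_sub[OF Nd(2)] using g(2) by (simp add: cocycles_def)
  from exact_atD[OF sub this] obtain h where h: "h \<in> cochains i (sub_gmodule X N)"
    "\<And>x. x \<in> carrier (P (Suc i)) \<Longrightarrow> ?u x = h (d i x)" by blast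
  have hX: "h \<in> cochains i X" using h(1) cochains_sub[OF Nd(2)] by blast
  have "(\<lambda>x. h x \<oplus>\<^bsub>X\<^esub> g x) \<in> cochains i X" by (rule lin_maps_deg_add[OF hX g(1) X])
  moreover have "f x = h (d i x) \<oplus>\<^bsub>X\<^esub> g (d i x)" if x: "x \<in> carrier (P (Suc i))" for x
    using h(2)[OF x, symmetric] cochain_closed[OF f(1) x] cochain_closed[OF g(1) d_closed[OF x]]
    by (simp add: a_minus_def X.M.a_assoc X.M.l_neg)
  ultimately show "\<exists>g\<in>cochains i X. \<forall>x\<in>carrier (P (Suc i)). f x = g (d i x)"
    by (intro bexI ballI)
qed

text \<open>\<open>P i\<close> is projective and \<open>\<delta>\<close> maps \<open>T\<close> onto
  its image.\<close>

lemma lift_cochain: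
  assumes T: "graded_module R T" and T': "graded_module R T'" and \<delta>: "\<delta> \<in> lin_maps_deg R T T' 0"
    and f: "f \<in> cochains i (sub_gmodule T' (\<delta> ` carrier T))"
  obtains g where "g \<in> cochains i T" "\<And>x. x \<in> carrier (P i) \<Longrightarrow> \<delta> (g x) = f x"
proof -
  interpret T': module R T' by (rule graded_moduleD[OF T'])
  note im = image_homogeneous[OF T T' \<delta>]
  have "\<delta> \<in> lin_maps_deg R T (sub_gmodule T' (\<delta> ` carrier T)) 0"
    unfolding lin_maps_deg_into_sub[OF graded_moduleD(2)[OF T] homogeneous_submoduleD(2)[OF T'.module_axioms im]]
    using \<delta> by simp
  from graded_free_projective[OF free graded T homogeneous_sub_gmodule(1)[OF T' im graded] f this]
  show ?thesis using that by auto
qed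

text \<open>From the long exact sequence of kernel, \<open>T\<close> and image: vanishing for the
  kernel is assumed one index higher. A lift \<open>g\<close> of the cocycle \<open>f\<close> has a
  kernel-valued coboundary; correcting \<open>g\<close> by a kernel-valued \<open>h\<close> gives a
  cocycle of \<open>T\<close>, hence a coboundary there.\<close>

lemma exact_at_image:
  assumes T: "graded_module R T" and T': "graded_module R T'" and \<delta>: "\<delta> \<in> lin_maps_deg R T T' 0"
    and ker: "exact_at (Suc i) (sub_gmodule T (ker_of T T' \<delta>))" and exT: "exact_at i T"
  shows "exact_at i (sub_gmodule T' (\<delta> ` carrier T))"
  unfolding exact_at_def
proof
  interpret T: module R T by (rule graded_moduleD[OF T])
  interpret T': module R T' by (rule graded_moduleD[OF T'])
  note im = homogeneous_submoduleD[OF T'.module_axioms image_homogeneous[OF T T' \<delta>]]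
  note kr = homogeneous_submoduleD[OF T.module_axioms ker_of_homogeneous[OF T T' \<delta>]]
  note \<delta>d = lin_mapsD[OF lin_maps_degD(1)[OF \<delta>]]
  fix f assume "f \<in> cocycles (Suc i) (sub_gmodule T' (\<delta> ` carrier T))"
  then have f: "f \<in> cochains (Suc i) (sub_gmodule T' (\<delta> ` carrier T))"
    "\<And>x. x \<in> carrier (P (Suc (Suc i))) \<Longrightarrow> f (d (Suc i) x) = \<zero>\<^bsub>T'\<^esub>"
    by (simp_all add: cocycles_def)
  obtain g where g: "g \<in> cochains (Suc i) T" "\<And>x. x \<in> carrier (P (Suc i)) \<Longrightarrow> \<delta> (g x) = f x"
    using lift_cochain[OF T T' \<delta> f(1)] by blast
  have "(\<lambda>x. g (d (Suc i) x)) \<in> cocycles (Suc (Suc i)) (sub_gmodule T (ker_of T T' \<delta>))"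
    unfolding cocycles_sub[OF kr(2)]
    using coboundary_cocycle[OF g(1) T] cochain_closed[OF g(1) d_closed] g(2)[OF d_closed] f(2)
    by (simp add: ker_of_def)
  from exact_atD[OF ker this] obtain h where h: "h \<in> cochains (Suc i) (sub_gmodule T (ker_of T T' \<delta>))"
    "\<And>x. x \<in> carrier (P (Suc (Suc i))) \<Longrightarrow> g (d (Suc i) x) = h (d (Suc i) x)" by blast
  have hT: "h \<in> cochains (Suc i) T" and hk: "\<And>x. x \<in> carrier (P (Suc i)) \<Longrightarrow> \<delta> (h x) = \<zero>\<^bsub>T'\<^esub>"
    using h(1) cochains_sub[OF kr(2)] by (simp_all add: ker_of_def)
  let ?u = "\<lambda>x. g x \<ominus>\<^bsub>T\<^esub> h x"
  have "?u \<in> cochains (Suc i) T" by (rule lin_maps_deg_minus[OF g(1) hT T])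
  moreover have "?u (d (Suc i) x) = \<zero>\<^bsub>T\<^esub>" if "x \<in> carrier (P (Suc (Suc i)))" for x
    using h(2)[OF that] cochain_closed[OF hT d_closed[OF that]] by (simp add: a_minus_def T.M.r_neg)
  ultimately have "?u \<in> cocycles (Suc i) T" by (simp add: cocycles_def)
  from exact_atD[OF exT this] obtain v where v: "v \<in> cochains i T"
    "\<And>x. x \<in> carrier (P (Suc i)) \<Longrightarrow> ?u x = v (d i x)" by blast
  have "(\<lambda>x. \<delta> (v x)) \<in> cochains i T'" by (rule lin_maps_deg_comp[OF v(1) \<delta>]) simp
  then have "(\<lambda>x. \<delta> (v x)) \<in> cochains i (sub_gmodule T' (\<delta> ` carrier T))"
    unfolding cochains_sub[OF im(2)] using cochain_closed[OF v(1)] by simp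
  moreover have "f x = \<delta> (v (d i x))" if x: "x \<in> carrier (P (Suc i))" for x
  proof -
    have c: "g x \<in> carrier T" "h x \<in> carrier T" "v (d i x) \<in> carrier T"
      using cochain_closed g(1) hT v(1) d_closed x by blast+
    have "g x = v (d i x) \<oplus>\<^bsub>T\<^esub> h x"
      using v(2)[OF x, symmetric] c by (simp add: a_minus_def T.M.a_assoc T.M.l_neg)
    then have "f x = \<delta> (v (d i x)) \<oplus>\<^bsub>T'\<^esub> \<delta> (h x)" using g(2)[OF x] \<delta>d(2)[OF c(3,2)] by simp
    then show ?thesis using hk[OF x] \<delta>d(1)[OF c(3)] by simp
  qed
  ultimately show "\<exists>w\<in>cochains i (sub_gmodule T' (\<delta> ` carrier T)). \<forall>x\<in>carrier (P (Suc i)). f x = w (d i x)"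
    by (intro bexI ballI)
qed

text \<open>The annihilators of the elements of \<open>Ext\<^sup>i\<^sup>+\<^sup>1(-, X)\<^sub>n\<close>.\<close>

definition Ext_annihilators :: "nat \<Rightarrow> ('a, 'm) gmodule \<Rightarrow> 'a set set" where
  "Ext_annihilators i X =
     (\<lambda>f. {a \<in> rgr R 0. \<exists>g\<in>cochains i X. \<forall>x\<in>carrier (P (Suc i)). a \<odot>\<^bsub>X\<^esub> f x = g (d i x)}) `
       cocycles (Suc i) X"

text \<open>Cocycles with values in the image of \<open>\<delta>\<close>, taken modulo the images of
  cocycles of \<open>T\<close>. This is the common description through which Ext of the image is
  compared with Ext of the kernel, one index higher.\<close>

definition image_annihilators ::
    "nat \<Rightarrow> ('a, 'm) gmodule \<Rightarrow> ('a, 'k) gmodule \<Rightarrow> ('m \<Rightarrow> 'k) \<Rightarrow> 'a set set" where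
  "image_annihilators i T T' \<delta> =
     (\<lambda>f. {a \<in> rgr R 0. \<exists>g\<in>cocycles i T. \<forall>x\<in>carrier (P i). a \<odot>\<^bsub>T'\<^esub> f x = \<delta> (g x)}) `
       cocycles i (sub_gmodule T' (\<delta> ` carrier T))"

text \<open>For image-valued cocycles, coboundaries and images of cocycles of \<open>T\<close>
  coincide: a bounding cochain lifts to \<open>T\<close>, and conversely every cocycle of
  \<open>T\<close> bounds by \<open>exT\<close>.\<close>

lemma Ext_annihilators_image:
  assumes T: "graded_module R T" and T': "graded_module R T'" and \<delta>: "\<delta> \<in> lin_maps_deg R T T' 0"
    and exT: "exact_at i T"
  shows "Ext_annihilators i (sub_gmodule T' (\<delta> ` carrier T)) = image_annihilators (Suc i) T T' \<delta>"
proof -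
  interpret T': module R T' by (rule graded_moduleD[OF T'])
  note im = homogeneous_submoduleD[OF T'.module_axioms image_homogeneous[OF T T' \<delta>]]
  have "(\<exists>g\<in>cochains i (sub_gmodule T' (\<delta> ` carrier T)). \<forall>x\<in>carrier (P (Suc i)). u x = g (d i x)) \<longleftrightarrow>
      (\<exists>g\<in>cocycles (Suc i) T. \<forall>x\<in>carrier (P (Suc i)). u x = \<delta> (g x))" for u
  proof
    assume "\<exists>g\<in>cochains i (sub_gmodule T' (\<delta> ` carrier T)). \<forall>x\<in>carrier (P (Suc i)). u x = g (d i x)"
    then obtain g where g: "g \<in> cochains i (sub_gmodule T' (\<delta> ` carrier T))"
      "\<forall>x\<in>carrier (P (Suc i)). u x = g (d i x)" by blast
    obtain h where h: "h \<in> cochains i T" "\<And>x. x \<in> carrier (P i) \<Longrightarrow> \<delta> (h x) = g x"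
      using lift_cochain[OF T T' \<delta> g(1)] by blast
    have "\<forall>x\<in>carrier (P (Suc i)). u x = \<delta> (h (d i x))" using g(2) h(2)[OF d_closed] by simp
    then show "\<exists>g\<in>cocycles (Suc i) T. \<forall>x\<in>carrier (P (Suc i)). u x = \<delta> (g x)"
      by (rule bexI[OF _ coboundary_cocycle[OF h(1) T]])
  next
    assume "\<exists>g\<in>cocycles (Suc i) T. \<forall>x\<in>carrier (P (Suc i)). u x = \<delta> (g x)"
    then obtain g where g: "g \<in> cocycles (Suc i) T" "\<forall>x\<in>carrier (P (Suc i)). u x = \<delta> (g x)" by blast
    obtain h where h: "h \<in> cochains i T" "\<And>x. x \<in> carrier (P (Suc i)) \<Longrightarrow> g x = h (d i x)"
      using exact_atD[OF exT g(1)] by blast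
    have "(\<lambda>x. \<delta> (h x)) \<in> cochains i T'" by (rule lin_maps_deg_comp[OF h(1) \<delta>]) simp
    then have "(\<lambda>x. \<delta> (h x)) \<in> cochains i (sub_gmodule T' (\<delta> ` carrier T))"
      unfolding cochains_sub[OF im(2)] using cochain_closed[OF h(1)] by simp
    moreover have "\<forall>x\<in>carrier (P (Suc i)). u x = \<delta> (h (d i x))" using g(2) h(2) by simp
    ultimately show "\<exists>g\<in>cochains i (sub_gmodule T' (\<delta> ` carrier T)). \<forall>x\<in>carrier (P (Suc i)). u x = g (d i x)"
      by (intro bexI)
  qed
  then show ?thesis unfolding Ext_annihilators_def image_annihilators_def by simp
qed

text \<open>The connecting homomorphism as a correspondence: a cochain \<open>g\<close> of
  \<open>T\<close> links the image-valued cocycle \<open>\<delta> (g x)\<close> with the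
  kernel-valued cocycle \<open>g (d i x)\<close>. By \<open>AB\<close>, linked cocycles have the
  same annihilator.\<close>

lemma Ext_annihilators_kernel:
  assumes T: "graded_module R T" and T': "graded_module R T'" and \<delta>: "\<delta> \<in> lin_maps_deg R T T' 0"
    and exT: "exact_at i T"
  shows "Ext_annihilators i (sub_gmodule T (ker_of T T' \<delta>)) = image_annihilators i T T' \<delta>"
proof -
  interpret T: module R T by (rule graded_moduleD[OF T])
  interpret T': module R T' by (rule graded_moduleD[OF T'])
  note im = homogeneous_submoduleD[OF T'.module_axioms image_homogeneous[OF T T' \<delta>]]
  note kr = homogeneous_submoduleD[OF T.module_axioms ker_of_homogeneous[OF T T' \<delta>]]
  note \<delta>d = lin_mapsD[OF lin_maps_degD(1)[OF \<delta>]]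
  have \<delta>m: "\<delta> (x \<ominus>\<^bsub>T\<^esub> y) = \<delta> x \<ominus>\<^bsub>T'\<^esub> \<delta> y" if "x \<in> carrier T" "y \<in> carrier T" for x y
    using that lin_maps_minus[OF lin_maps_degD(1)[OF \<delta>] T.module_axioms T'.module_axioms]
    by (simp add: a_minus_def \<delta>d)
  let ?K = "sub_gmodule T (ker_of T T' \<delta>)" and ?I = "sub_gmodule T' (\<delta> ` carrier T)"
  let ?A = "\<lambda>F. {a \<in> rgr R 0. \<exists>g\<in>cochains i ?K. \<forall>x\<in>carrier (P (Suc i)). a \<odot>\<^bsub>?K\<^esub> F x = g (d i x)}"
  let ?B = "\<lambda>f. {a \<in> rgr R 0. \<exists>g\<in>cocycles i T. \<forall>x\<in>carrier (P i). a \<odot>\<^bsub>T'\<^esub> f x = \<delta> (g x)}"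
  have AB: "?A F = ?B f"
    if g: "g \<in> cochains i T" and F: "\<And>x. x \<in> carrier (P (Suc i)) \<Longrightarrow> F x = g (d i x)"
      and f: "\<And>x. x \<in> carrier (P i) \<Longrightarrow> f x = \<delta> (g x)" for F f g
  proof -
    have "(\<exists>k\<in>cochains i ?K. \<forall>x\<in>carrier (P (Suc i)). a \<odot>\<^bsub>T\<^esub> F x = k (d i x)) \<longleftrightarrow>
        (\<exists>h\<in>cocycles i T. \<forall>x\<in>carrier (P i). a \<odot>\<^bsub>T'\<^esub> f x = \<delta> (h x))"
      if a: "a \<in> rgr R 0" for a
    proof -
      have ac: "a \<in> carrier R" by (rule rgr_closed[OF a])
      have ag: "(\<lambda>x. a \<odot>\<^bsub>T\<^esub> g x) \<in> cochains i T" by (rule lin_maps_deg_smult[OF g a ac T])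
      have \<delta>ag: "a \<odot>\<^bsub>T'\<^esub> f x = \<delta> (a \<odot>\<^bsub>T\<^esub> g x)" if "x \<in> carrier (P i)" for x
        using f[OF that] \<delta>d(3)[OF ac cochain_closed[OF g that]] by simp
      have diff: "(\<lambda>x. a \<odot>\<^bsub>T\<^esub> g x \<ominus>\<^bsub>T\<^esub> h x) \<in> cochains i T" if "h \<in> cochains i T" for h
        by (rule lin_maps_deg_minus[OF ag that T])
      show ?thesis
      proof
        assume "\<exists>k\<in>cochains i ?K. \<forall>x\<in>carrier (P (Suc i)). a \<odot>\<^bsub>T\<^esub> F x = k (d i x)"
        then obtain k where k: "k \<in> cochains i ?K" "\<And>x. x \<in> carrier (P (Suc i)) \<Longrightarrow> a \<odot>\<^bsub>T\<^esub> F x = k (d i x)"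
          by blast
        have kT: "k \<in> cochains i T" and kk: "\<And>x. x \<in> carrier (P i) \<Longrightarrow> \<delta> (k x) = \<zero>\<^bsub>T'\<^esub>"
          using k(1) cochains_sub[OF kr(2)] by (simp_all add: ker_of_def)
        \<comment> \<open>If \<open>k\<close> bounds the multiple of \<open>F\<close>, subtracting
          \<open>k\<close> turns the multiple of \<open>g\<close> into a cocycle; as
          \<open>k\<close> is kernel-valued, the image under \<open>\<delta>\<close> is
          unchanged.\<close>
        let ?h = "\<lambda>x. a \<odot>\<^bsub>T\<^esub> g x \<ominus>\<^bsub>T\<^esub> k x"
        have "?h (d i x) = \<zero>\<^bsub>T\<^esub>" if x: "x \<in> carrier (P (Suc i))" for x
          using k(2)[OF x] F[OF x] cochain_closed[OF kT d_closed[OF x]] by (simp add: a_minus_def T.M.r_neg)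
        then have "?h \<in> cocycles i T" using diff[OF kT] by (simp add: cocycles_def)
        moreover have "a \<odot>\<^bsub>T'\<^esub> f x = \<delta> (?h x)" if x: "x \<in> carrier (P i)" for x
          using \<delta>m[OF cochain_closed[OF ag x] cochain_closed[OF kT x]] \<delta>ag[OF x] kk[OF x]
            \<delta>d(1)[OF cochain_closed[OF ag x]] by (simp add: a_minus_def)
        ultimately show "\<exists>h\<in>cocycles i T. \<forall>x\<in>carrier (P i). a \<odot>\<^bsub>T'\<^esub> f x = \<delta> (h x)"
          by (intro bexI ballI)
      next
        assume "\<exists>h\<in>cocycles i T. \<forall>x\<in>carrier (P i). a \<odot>\<^bsub>T'\<^esub> f x = \<delta> (h x)"
        then obtain h where "h \<in> cocycles i T" and fh: "\<And>x. x \<in> carrier (P i) \<Longrightarrow> a \<odot>\<^bsub>T'\<^esub> f x = \<delta> (h x)"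
          by blast
        then have h: "h \<in> cochains i T" "\<And>x. x \<in> carrier (P (Suc i)) \<Longrightarrow> h (d i x) = \<zero>\<^bsub>T\<^esub>"
          by (simp_all add: cocycles_def)
        let ?k = "\<lambda>x. a \<odot>\<^bsub>T\<^esub> g x \<ominus>\<^bsub>T\<^esub> h x"
        have "?k x \<in> ker_of T T' \<delta>" if x: "x \<in> carrier (P i)" for x
          using \<delta>m[OF cochain_closed[OF ag x] cochain_closed[OF h(1) x]] \<delta>ag[OF x] fh[OF x]
            cochain_closed[OF ag x] cochain_closed[OF h(1) x] \<delta>d(1)
          by (simp add: a_minus_def ker_of_def T'.M.r_neg)
        then have "?k \<in> cochains i ?K" using diff[OF h(1)] cochains_sub[OF kr(2)] by blast
        moreover have "a \<odot>\<^bsub>T\<^esub> F x = ?k (d i x)" if x: "x \<in> carrier (P (Suc i))" for x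
          using F[OF x] h(2)[OF x] cochain_closed[OF ag d_closed[OF x]] by (simp add: a_minus_def)
        ultimately show "\<exists>k\<in>cochains i ?K. \<forall>x\<in>carrier (P (Suc i)). a \<odot>\<^bsub>T\<^esub> F x = k (d i x)"
          by (intro bexI ballI)
      qed
    qed
    then show ?thesis by auto
  qed
  have "?A F \<in> ?B ` cocycles i ?I" if FK: "F \<in> cocycles (Suc i) ?K" for F
  proof -
    have FT: "F \<in> cocycles (Suc i) T" and Fk: "\<And>x. x \<in> carrier (P (Suc i)) \<Longrightarrow> \<delta> (F x) = \<zero>\<^bsub>T'\<^esub>"
      using FK cocycles_sub[OF kr(2)] by (simp_all add: ker_of_def)
    obtain g where g: "g \<in> cochains i T" "\<And>x. x \<in> carrier (P (Suc i)) \<Longrightarrow> F x = g (d i x)"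
      using exact_atD[OF exT FT] by blast
    have "(\<lambda>x. \<delta> (g x)) \<in> cochains i T'" by (rule lin_maps_deg_comp[OF g(1) \<delta>]) simp
    moreover have "\<delta> (g (d i x)) = \<zero>\<^bsub>T'\<^esub>" if "x \<in> carrier (P (Suc i))" for x
      using Fk[OF that] g(2)[OF that] by simp
    ultimately have "(\<lambda>x. \<delta> (g x)) \<in> cocycles i ?I"
      unfolding cocycles_sub[OF im(2)] using cochain_closed[OF g(1)] by (simp add: cocycles_def)
    then show ?thesis by (rule image_eqI[rotated]) (rule AB[OF g], simp_all)
  qed
  moreover have "?B f \<in> ?A ` cocycles (Suc i) ?K" if fI: "f \<in> cocycles i ?I" for f
  proof -
    have f: "f \<in> cochains i ?I" "\<And>x. x \<in> carrier (P (Suc i)) \<Longrightarrow> f (d i x) = \<zero>\<^bsub>T'\<^esub>"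
      using fI by (simp_all add: cocycles_def)
    obtain g where g: "g \<in> cochains i T" "\<And>x. x \<in> carrier (P i) \<Longrightarrow> \<delta> (g x) = f x"
      using lift_cochain[OF T T' \<delta> f(1)] by blast
    have "(\<lambda>x. g (d i x)) \<in> cocycles (Suc i) ?K"
      unfolding cocycles_sub[OF kr(2)]
      using coboundary_cocycle[OF g(1) T] cochain_closed[OF g(1) d_closed] g(2)[OF d_closed] f(2)
      by (simp add: ker_of_def)
    then show ?thesis by (rule image_eqI[rotated]) (rule AB[OF g(1), symmetric], simp_all add: g(2))
  qed
  ultimately show ?thesis unfolding Ext_annihilators_def image_annihilators_def by blast
qed

end

section \<open>Annihilators of Ext and Hom\<close>

lemma ker_of_submodule:
  assumes "module R A" "module R B" "f \<in> lin_maps R A B"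
  shows "submodule (ker_of A B f) R A"
proof -
  interpret A: module R A by fact
  interpret B: module R B by fact
  note f = lin_mapsD[OF assms(3)] lin_maps_zero[OF assms(3,1,2)] lin_maps_minus[OF assms(3,1,2)]
  show ?thesis
    by (rule A.submoduleI) (auto simp: ker_of_def f)
qed

lemma image_submodule:
  assumes "module R A" "module R B" "f \<in> lin_maps R A B"
  shows "submodule (f ` carrier A) R B"
proof -
  interpret A: module R A by fact
  interpret B: module R B by fact
  note f = lin_mapsD[OF assms(3)]
  note f0 = lin_maps_zero[OF assms(3,1,2)] and fm = lin_maps_minus[OF assms(3,1,2)]
  show ?thesis
  proof (rule B.submoduleI)
    show "f ` carrier A \<subseteq> carrier B" using f(1) by auto
    show "\<zero>\<^bsub>B\<^esub> \<in> f ` carrier A" using f0 by (intro image_eqI[of _ _ "\<zero>\<^bsub>A\<^esub>"]) simp_all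
  next
    fix x assume "x \<in> f ` carrier A"
    then obtain x' where "x' \<in> carrier A" "x = f x'" by auto
    then show "\<ominus>\<^bsub>B\<^esub> x \<in> f ` carrier A" by (intro image_eqI[of _ _ "\<ominus>\<^bsub>A\<^esub> x'"]) (simp_all add: fm)
  next
    fix x y assume "x \<in> f ` carrier A" "y \<in> f ` carrier A"
    then obtain x' y' where "x' \<in> carrier A" "x = f x'" "y' \<in> carrier A" "y = f y'" by auto
    then show "x \<oplus>\<^bsub>B\<^esub> y \<in> f ` carrier A" by (intro image_eqI[of _ _ "x' \<oplus>\<^bsub>A\<^esub> y'"]) (simp_all add: f)
  next
    fix a x assume a: "a \<in> carrier R" "x \<in> f ` carrier A"
    then obtain x' where "x' \<in> carrier A" "x = f x'" by auto
    then show "a \<odot>\<^bsub>B\<^esub> x \<in> f ` carrier A" using a by (intro image_eqI[of _ _ "a \<odot>\<^bsub>A\<^esub> x'"]) (simp_all add: f)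
  qed
qed

lemma singleton_zero_submodule:
  assumes "module R A"
  shows "submodule {\<zero>\<^bsub>A\<^esub>} R A"
proof -
  interpret A: module R A by fact
  show ?thesis by (rule A.submoduleI) simp_all
qed

lemma submodule_of_sub:
  assumes "module R A" "submodule S R A" "submodule N R A" "N \<subseteq> S"
  shows "submodule N R (sub_gmodule A S)"
proof -
  interpret S: module R "sub_gmodule A S" by (rule submodule_module[OF assms(1,2)])
  note N = submoduleD[OF assms(1,3)]
  show ?thesis
  proof (rule S.submoduleI)
    show "\<ominus>\<^bsub>sub_gmodule A S\<^esub> x \<in> N" if "x \<in> N" for x
      using a_inv_sub[OF assms(1,2) subsetD[OF assms(4) that]] N(3)[OF that] by simp
  qed (simp_all add: assms(4) N)
qed

text \<open>What the support and the vanishing of \<open>X_n\<close> require of \<open>X\<close>.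
  Being weaker than \<open>graded_module\<close>, it can be verified for Ext and Hom without
  decomposing them into components.\<close>

definition deg0_stable :: "'a gring \<Rightarrow> ('a, 'm) gmodule \<Rightarrow> int \<Rightarrow> bool" where
  "deg0_stable R X n \<longleftrightarrow> module R X \<and> gr X n \<subseteq> carrier X \<and> \<zero>\<^bsub>X\<^esub> \<in> gr X n \<and>
     (\<forall>a\<in>rgr R 0. \<forall>x\<in>gr X n. a \<odot>\<^bsub>X\<^esub> x \<in> gr X n)"

lemma eventually_constant_cong:
  fixes f g :: "int \<Rightarrow> 'b"
  assumes "\<And>n. n \<le> N \<Longrightarrow> f n = g n"
  shows "(\<exists>n0. \<forall>n\<le>n0. f n = f n0) \<longleftrightarrow> (\<exists>n0. \<forall>n\<le>n0. g n = g n0)"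
proof -
  have *: "\<exists>n0. \<forall>n\<le>n0. v n = v n0"
    if eq: "\<And>n. n \<le> N \<Longrightarrow> u n = v n" and ex: "\<exists>n0. \<forall>n\<le>n0. u n = u n0" for u v :: "int \<Rightarrow> 'b"
  proof -
    obtain n0 where n0: "\<forall>n\<le>n0. u n = u n0" using ex by blast
    \<comment> \<open>The reference index moves to \<open>min N n0\<close>, where \<open>u\<close>
      and \<open>v\<close> agree and \<open>u\<close> is already constant.\<close>
    have "v n = v (min N n0)" if "n \<le> min N n0" for n
    proof -
      have "u n = u n0" by (rule n0[rule_format]) (use that in simp)
      moreover have "u (min N n0) = u n0" by (rule n0[rule_format]) simp
      ultimately have "u n = u (min N n0)" by simp
      then show ?thesis using eq[of n] eq[of "min N n0"] that by simp
    qed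
    then show ?thesis by blast
  qed
  show ?thesis using *[of f g] *[of g f] assms by metis
qed

lemma eventually_cong_le:
  fixes p q :: "int \<Rightarrow> bool"
  assumes "\<And>n. n \<le> N \<Longrightarrow> p n = q n"
  shows "(\<exists>n0. \<forall>n\<le>n0. p n) \<longleftrightarrow> (\<exists>n0. \<forall>n\<le>n0. q n)"
proof -
  have *: "\<exists>n0. \<forall>n\<le>n0. v n"
    if eq: "\<And>n. n \<le> N \<Longrightarrow> u n = v n" and ex: "\<exists>n0. \<forall>n\<le>n0. u n" for u v :: "int \<Rightarrow> bool"
  proof -
    obtain n0 where "\<forall>n\<le>n0. u n" using ex by blast
    then have "\<forall>n\<le>min N n0. v n" using eq by auto
    then show ?thesis by blast
  qed
  show ?thesis using *[of p q] *[of q p] assms by metis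
qed

lemma (in graded_cring) asymptotic_properties_cong:
  fixes X :: "('a, 'm) gmodule" and Y :: "('a, 'k) gmodule"
  assumes ann: "\<And>n. n \<le> N \<Longrightarrow> annihilators R X n = annihilators R Y n"
    and X: "\<And>n. deg0_stable R X n" and Y: "\<And>n. deg0_stable R Y n"
  shows "(asymptotic_stability_Ass R X \<longleftrightarrow> asymptotic_stability_Ass R Y) \<and>
    (asymptotic_stability_Supp R X \<longleftrightarrow> asymptotic_stability_Supp R Y) \<and> (tame X \<longleftrightarrow> tame Y)"
proof (intro conjI)
  show "asymptotic_stability_Ass R X \<longleftrightarrow> asymptotic_stability_Ass R Y"
    unfolding asymptotic_stability_Ass_def
    by (rule eventually_constant_cong[where N = N]) (simp add: Ass_gr_part ann)
  have R0: "rgr R 0 \<subseteq> carrier R" using rgr_closed by blast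
  have SX: "Supp (deg0_ring R) (gr_part X n) =
      {p. primeideal p (deg0_ring R) \<and> (\<exists>A\<in>annihilators R X n. A \<subseteq> p)}" for n
    using X[of n] unfolding deg0_stable_def by (intro Supp_gr_part R0) blast+
  have SY: "Supp (deg0_ring R) (gr_part Y n) =
      {p. primeideal p (deg0_ring R) \<and> (\<exists>A\<in>annihilators R Y n. A \<subseteq> p)}" for n
    using Y[of n] unfolding deg0_stable_def by (intro Supp_gr_part R0) blast+
  show "asymptotic_stability_Supp R X \<longleftrightarrow> asymptotic_stability_Supp R Y"
    unfolding asymptotic_stability_Supp_def
    by (rule eventually_constant_cong[where N = N]) (simp add: SX SY ann)
  have zX: "gr X n = {\<zero>\<^bsub>X\<^esub>} \<longleftrightarrow> (\<forall>A\<in>annihilators R X n. \<one> \<in> A)" for n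
    using X[of n] unfolding deg0_stable_def by (intro gr_zero_iff_annihilators one_deg0) blast+
  have zY: "gr Y n = {\<zero>\<^bsub>Y\<^esub>} \<longleftrightarrow> (\<forall>A\<in>annihilators R Y n. \<one> \<in> A)" for n
    using Y[of n] unfolding deg0_stable_def by (intro gr_zero_iff_annihilators one_deg0) blast+
  have eq: "gr X n = {\<zero>\<^bsub>X\<^esub>} \<longleftrightarrow> gr Y n = {\<zero>\<^bsub>Y\<^esub>}" if "n \<le> N" for n
    unfolding zX zY ann[OF that] by (rule refl)
  show "tame X \<longleftrightarrow> tame Y"
    unfolding tame_def
    using eventually_cong_le[of N "\<lambda>n. gr X n = {\<zero>\<^bsub>X\<^esub>}", OF eq]
      eventually_cong_le[of N "\<lambda>n. gr X n \<noteq> {\<zero>\<^bsub>X\<^esub>}" "\<lambda>n. gr Y n \<noteq> {\<zero>\<^bsub>Y\<^esub>}"] eq by simp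
qed

section \<open>Ext in one degree, computed with homogeneous cochains\<close>

context free_complex
begin

definition coboundary_map :: "nat \<Rightarrow> ('p \<Rightarrow> 'm) \<Rightarrow> 'p \<Rightarrow> 'm" where
  "coboundary_map k f = (\<lambda>x\<in>carrier (P (Suc k)). f (d k x))"

definition Ext_cocycles :: "nat \<Rightarrow> ('a, 'm) gmodule \<Rightarrow> ('p \<Rightarrow> 'm) set" where
  "Ext_cocycles i X =
     ker_of (hom_gmodule R (P i) X) (hom_gmodule R (P (Suc i)) X) (coboundary_map i)"

definition Ext_coboundaries :: "nat \<Rightarrow> ('a, 'm) gmodule \<Rightarrow> ('p \<Rightarrow> 'm) set" where
  "Ext_coboundaries i X = (case i of 0 \<Rightarrow> {\<zero>\<^bsub>hom_gmodule R (P 0) X\<^esub>}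
     | Suc k \<Rightarrow> coboundary_map k ` carrier (hom_gmodule R (P k) X))"

lemma Ext_gmodule_eq:
  "Ext_gmodule R P d i X =
     quot_gmodule (sub_gmodule (hom_gmodule R (P i) X) (Ext_cocycles i X)) (Ext_coboundaries i X)"
  unfolding Ext_gmodule_def cohomology_def Ext_cocycles_def Ext_coboundaries_def coboundary_map_def
  by (rule refl)

lemma coboundary_map_linear:
  assumes "module R X"
  shows "coboundary_map k \<in> lin_maps R (hom_gmodule R (P k) X) (hom_gmodule R (P (Suc k)) X)"
proof (rule lin_mapsI)
  fix f assume "f \<in> carrier (hom_gmodule R (P k) X)"
  then have f: "f \<in> lin_maps R (P k) X" by simp
  show "coboundary_map k f \<in> carrier (hom_gmodule R (P (Suc k)) X)"
    using lin_maps_restrict[OF P_module lin_maps_comp[OF lin_maps_degD(1)[OF d_deg] f]]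
    by (simp add: coboundary_map_def)
qed (auto simp: coboundary_map_def d_closed)

lemma mem_Ext_cocycles:
  "f \<in> Ext_cocycles i X \<longleftrightarrow> f \<in> lin_maps R (P i) X \<and> f \<in> extensional (carrier (P i)) \<and>
     (\<forall>x\<in>carrier (P (Suc i)). f (d i x) = \<zero>\<^bsub>X\<^esub>)"
proof -
  have "coboundary_map i f = \<zero>\<^bsub>hom_gmodule R (P (Suc i)) X\<^esub> \<longleftrightarrow>
      (\<forall>x\<in>carrier (P (Suc i)). f (d i x) = \<zero>\<^bsub>X\<^esub>)"
    unfolding coboundary_map_def hom_gmodule_simps restrict_def fun_eq_iff by auto
  then show ?thesis by (simp add: Ext_cocycles_def ker_of_def)
qed

lemma Ext_submodules:
  assumes X: "module R X"
  shows "module R (sub_gmodule (hom_gmodule R (P i) X) (Ext_cocycles i X))"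
    "submodule (Ext_coboundaries i X) R (sub_gmodule (hom_gmodule R (P i) X) (Ext_cocycles i X))"
proof -
  note H = hom_module[OF P_module X]
  have Z: "submodule (Ext_cocycles i X) R (hom_gmodule R (P i) X)"
    unfolding Ext_cocycles_def by (rule ker_of_submodule[OF H H coboundary_map_linear[OF X]])
  show "module R (sub_gmodule (hom_gmodule R (P i) X) (Ext_cocycles i X))"
    by (rule submodule_module[OF H Z])
  have "submodule (Ext_coboundaries i X) R (hom_gmodule R (P i) X) \<and> Ext_coboundaries i X \<subseteq> Ext_cocycles i X"
  proof (cases i)
    case 0
    have "\<zero>\<^bsub>hom_gmodule R (P 0) X\<^esub> \<in> Ext_cocycles 0 X" by (rule submoduleD(2)[OF H]) (use Z 0 in simp)
    then show ?thesis using singleton_zero_submodule[OF H, of 0] 0 by (simp add: Ext_coboundaries_def)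
  next
    case (Suc k)
    have "coboundary_map k f \<in> Ext_cocycles (Suc k) X" if f: "f \<in> carrier (hom_gmodule R (P k) X)" for f
    proof -
      have fl: "f \<in> lin_maps R (P k) X" using f by simp
      have "f (d k (d (Suc k) x)) = \<zero>\<^bsub>X\<^esub>" if "x \<in> carrier (P (Suc (Suc k)))" for x
        using d_d[OF that] lin_maps_zero[OF fl P_module X] by simp
      then show ?thesis
        using lin_mapsD(1)[OF coboundary_map_linear[OF X] f]
        by (simp add: mem_Ext_cocycles) (simp add: coboundary_map_def d_closed)
    qed
    then show ?thesis
      using image_submodule[OF H H coboundary_map_linear[OF X], of k] Suc
      by (auto simp: Ext_coboundaries_def)
  qed
  then show "submodule (Ext_coboundaries i X) R (sub_gmodule (hom_gmodule R (P i) X) (Ext_cocycles i X))"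
    using submodule_of_sub[OF H Z] by blast
qed

text \<open>Equality of extensional functions is a condition on the carrier, so any linear map may
  serve as the bounding map, extensional or not.\<close>

lemma mem_Ext_coboundaries:
  assumes f: "f \<in> extensional (carrier (P i))"
  shows "f \<in> Ext_coboundaries i X \<longleftrightarrow> (case i of 0 \<Rightarrow> \<forall>x\<in>carrier (P 0). f x = \<zero>\<^bsub>X\<^esub>
    | Suc k \<Rightarrow> \<exists>g\<in>lin_maps R (P k) X. \<forall>x\<in>carrier (P (Suc k)). f x = g (d k x))"
proof (cases i)
  case 0
  then show ?thesis
    using f by (auto simp: Ext_coboundaries_def intro: extensionalityI)
next
  case (Suc k)
  have "(\<exists>g\<in>carrier (hom_gmodule R (P k) X). f = coboundary_map k g) \<longleftrightarrow>
      (\<exists>g\<in>lin_maps R (P k) X. \<forall>x\<in>carrier (P (Suc k)). f x = g (d k x))"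
  proof
    assume "\<exists>g\<in>carrier (hom_gmodule R (P k) X). f = coboundary_map k g"
    then show "\<exists>g\<in>lin_maps R (P k) X. \<forall>x\<in>carrier (P (Suc k)). f x = g (d k x)"
      by (auto simp: coboundary_map_def)
  next
    assume "\<exists>g\<in>lin_maps R (P k) X. \<forall>x\<in>carrier (P (Suc k)). f x = g (d k x)"
    then obtain g where g: "g \<in> lin_maps R (P k) X" "\<forall>x\<in>carrier (P (Suc k)). f x = g (d k x)" by blast
    have "f = coboundary_map k (restrict g (carrier (P k)))"
      by (rule extensionalityI[of _ "carrier (P (Suc k))"])
        (use f g(2) Suc in \<open>simp_all add: coboundary_map_def d_closed\<close>)
    moreover have "restrict g (carrier (P k)) \<in> carrier (hom_gmodule R (P k) X)"
      using lin_maps_restrict[OF P_module g(1)] by simp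
    ultimately show "\<exists>g\<in>carrier (hom_gmodule R (P k) X). f = coboundary_map k g" by blast
  qed
  then show ?thesis using Suc by (simp add: Ext_coboundaries_def image_iff)
qed

text \<open>In index 0 the only coboundary is zero, hence a separate formula;
  \<open>Ext_annihilators\<close> starts at Ext of index 1.\<close>

definition Ext0_annihilators :: "('a, 'm) gmodule \<Rightarrow> 'a set set" where
  "Ext0_annihilators X =
     (\<lambda>f. {a \<in> rgr R 0. \<forall>x\<in>carrier (P 0). a \<odot>\<^bsub>X\<^esub> f x = \<zero>\<^bsub>X\<^esub>}) ` cocycles 0 X"

text \<open>The coboundaries in \<open>Ext_gmodule\<close> come from arbitrary linear maps. If
  \<open>g\<close> bounds a cochain of degree \<open>n\<close>, then so does the part of
  \<open>g\<close> of degree \<open>n\<close>, because \<open>d\<close> has degree 0.\<close>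

lemma coboundary_homogeneous:
  assumes X: "graded_module R X" and f: "f \<in> cochains (Suc k) X" and g: "g \<in> lin_maps R (P k) X"
    and eq: "\<And>x. x \<in> carrier (P (Suc k)) \<Longrightarrow> f x = g (d k x)"
  shows "\<exists>g\<in>cochains k X. \<forall>x\<in>carrier (P (Suc k)). f x = g (d k x)"
proof -
  interpret DX: direct_sum X "gr X" by (rule graded_moduleD[OF X])
  interpret DP: direct_sum "P (Suc k)" "gr (P (Suc k))" by (rule P_direct_sum)
  obtain h where h: "h \<in> cochains k X" "\<forall>l. \<forall>x\<in>gr (P k) l. h x = hc X (l + n) (g x)"
    using homogeneous_part[OF g P_graded X graded] by blast
  have "f x = h (d k x)" if x: "x \<in> carrier (P (Suc k))" for x
  proof (rule lin_maps_eqI[OF P_graded lin_maps_degD(1)[OF f] lin_maps_degD(1)[OF cochain_comp_d[OF h(1)]] _ x])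
    fix l x assume x: "x \<in> gr (P (Suc k)) l"
    have "d k x \<in> gr (P k) l" using lin_maps_degD(2)[OF d_deg x] by simp
    then have "h (d k x) = hc X (l + n) (f x)" using h(2) eq[OF DP.component_closed[OF x]] by simp
    then show "f x = h (d k x)" using DX.hcomp_same[OF lin_maps_degD(2)[OF f x]] by simp
  qed
  then show ?thesis using h(1) by blast
qed

lemma Ext_smult_zero_iff:
  assumes X: "module R X" and a: "a \<in> carrier R" and f: "f \<in> Ext_cocycles i X"
  defines "M \<equiv> sub_gmodule (hom_gmodule R (P i) X) (Ext_cocycles i X)"
  shows "a \<odot>\<^bsub>Ext_gmodule R P d i X\<^esub> (Ext_coboundaries i X +>\<^bsub>M\<^esub> f) = \<zero>\<^bsub>Ext_gmodule R P d i X\<^esub> \<longleftrightarrow>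
    (case i of 0 \<Rightarrow> \<forall>x\<in>carrier (P 0). a \<odot>\<^bsub>X\<^esub> f x = \<zero>\<^bsub>X\<^esub>
    | Suc k \<Rightarrow> \<exists>g\<in>lin_maps R (P k) X. \<forall>x\<in>carrier (P (Suc k)). a \<odot>\<^bsub>X\<^esub> f x = g (d k x))"
proof -
  note sub = Ext_submodules[OF X, of i, folded M_def]
  note q = quot_gmodule_simps[OF sub]
  have fM: "f \<in> carrier M" using f by (simp add: M_def)
  have af: "a \<odot>\<^bsub>M\<^esub> f = (\<lambda>x\<in>carrier (P i). a \<odot>\<^bsub>X\<^esub> f x)" by (simp add: M_def)
  have afM: "a \<odot>\<^bsub>M\<^esub> f \<in> carrier M" by (rule module.smult_closed[OF sub(1) a fM])
  have "a \<odot>\<^bsub>Ext_gmodule R P d i X\<^esub> (Ext_coboundaries i X +>\<^bsub>M\<^esub> f) = \<zero>\<^bsub>Ext_gmodule R P d i X\<^esub> \<longleftrightarrow>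
      a \<odot>\<^bsub>M\<^esub> f \<in> Ext_coboundaries i X"
    using q(5)[OF a fM] q(2) coset_zero_iff[OF sub afM] unfolding Ext_gmodule_eq M_def[symmetric] by simp
  also have "\<dots> \<longleftrightarrow> (case i of 0 \<Rightarrow> \<forall>x\<in>carrier (P 0). a \<odot>\<^bsub>X\<^esub> f x = \<zero>\<^bsub>X\<^esub>
    | Suc k \<Rightarrow> \<exists>g\<in>lin_maps R (P k) X. \<forall>x\<in>carrier (P (Suc k)). a \<odot>\<^bsub>X\<^esub> f x = g (d k x))"
    unfolding af by (subst mem_Ext_coboundaries) (simp_all split: nat.split)
  finally show ?thesis .
qed

lemma Ext_gr:
  fixes i :: nat
  assumes X: "module R X"
  defines "M \<equiv> sub_gmodule (hom_gmodule R (P i) X) (Ext_cocycles i X)"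
  shows "gr (Ext_gmodule R P d i X) n =
    (\<lambda>f. Ext_coboundaries i X +>\<^bsub>M\<^esub> restrict f (carrier (P i))) ` cocycles i X"
proof -
  have "gr M n = (\<lambda>f. restrict f (carrier (P i))) ` cocycles i X"
  proof
    show "gr M n \<subseteq> (\<lambda>f. restrict f (carrier (P i))) ` cocycles i X"
    proof
      fix f assume "f \<in> gr M n"
      then have "f \<in> cocycles i X" "f = restrict f (carrier (P i))"
        by (simp_all add: M_def cocycles_def mem_Ext_cocycles extensional_restrict)
      then show "f \<in> (\<lambda>f. restrict f (carrier (P i))) ` cocycles i X" by blast
    qed
    show "(\<lambda>f. restrict f (carrier (P i))) ` cocycles i X \<subseteq> gr M n"
    proof (rule image_subsetI)
      fix f assume f: "f \<in> cocycles i X"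
      then have "restrict f (carrier (P i)) \<in> cochains i X"
        by (intro lin_maps_deg_restrict[OF P_graded]) (simp add: cocycles_def)
      then show "restrict f (carrier (P i)) \<in> gr M n"
        using f lin_maps_degD(1) by (simp add: M_def mem_Ext_cocycles cocycles_def d_closed)
    qed
  qed
  then show ?thesis
    using quot_gmodule_simps(3)[OF Ext_submodules[OF X, of i, folded M_def], of n]
    unfolding Ext_gmodule_eq M_def[symmetric] by auto
qed

lemma cocycle_restrict:
  assumes "f \<in> cocycles i X"
  shows "restrict f (carrier (P i)) \<in> Ext_cocycles i X"
proof -
  have f: "f \<in> cochains i X" "\<forall>x\<in>carrier (P (Suc i)). f (d i x) = \<zero>\<^bsub>X\<^esub>"
    using assms by (simp_all add: cocycles_def)
  show ?thesis
    using lin_maps_restrict[OF P_module lin_maps_degD(1)[OF f(1)]] f(2)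
    by (simp add: mem_Ext_cocycles d_closed)
qed

text \<open>The bridge from the record \<open>Ext_gmodule\<close> to cochains. The inhomogeneous
  bounding maps allowed by the record are made homogeneous by
  \<open>coboundary_homogeneous\<close>.\<close>

lemma annihilators_Ext:
  assumes X: "graded_module R X"
  shows "annihilators R (Ext_gmodule R P d i X) n =
    (case i of 0 \<Rightarrow> Ext0_annihilators X | Suc k \<Rightarrow> Ext_annihilators k X)"
proof -
  let ?M = "sub_gmodule (hom_gmodule R (P i) X) (Ext_cocycles i X)"
  let ?E = "Ext_gmodule R P d i X"
  have ann: "{a \<in> rgr R 0. a \<odot>\<^bsub>?E\<^esub> (Ext_coboundaries i X +>\<^bsub>?M\<^esub> restrict f (carrier (P i))) = \<zero>\<^bsub>?E\<^esub>} =
      (case i of 0 \<Rightarrow> {a \<in> rgr R 0. \<forall>x\<in>carrier (P 0). a \<odot>\<^bsub>X\<^esub> f x = \<zero>\<^bsub>X\<^esub>}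
      | Suc k \<Rightarrow> {a \<in> rgr R 0. \<exists>g\<in>cochains k X. \<forall>x\<in>carrier (P (Suc k)). a \<odot>\<^bsub>X\<^esub> f x = g (d k x)})"
    if f: "f \<in> cocycles i X" for f
  proof (cases i)
    case 0
    then show ?thesis
      using Ext_smult_zero_iff[OF graded_moduleD(1)[OF X] rgr_closed cocycle_restrict[OF f]] by auto
  next
    case (Suc k)
    have "(\<exists>g\<in>lin_maps R (P k) X. \<forall>x\<in>carrier (P (Suc k)). a \<odot>\<^bsub>X\<^esub> restrict f (carrier (P (Suc k))) x = g (d k x)) \<longleftrightarrow>
        (\<exists>g\<in>cochains k X. \<forall>x\<in>carrier (P (Suc k)). a \<odot>\<^bsub>X\<^esub> f x = g (d k x))" if a: "a \<in> rgr R 0" for a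
    proof
      have "(\<lambda>x. a \<odot>\<^bsub>X\<^esub> f x) \<in> cochains (Suc k) X"
        using f Suc by (intro lin_maps_deg_smult a rgr_closed[OF a] X) (simp add: cocycles_def)
      note ch = coboundary_homogeneous[OF X this]
      assume "\<exists>g\<in>lin_maps R (P k) X. \<forall>x\<in>carrier (P (Suc k)). a \<odot>\<^bsub>X\<^esub> restrict f (carrier (P (Suc k))) x = g (d k x)"
      then obtain g where "g \<in> lin_maps R (P k) X"
        "\<And>x. x \<in> carrier (P (Suc k)) \<Longrightarrow> a \<odot>\<^bsub>X\<^esub> f x = g (d k x)" by auto
      then show "\<exists>g\<in>cochains k X. \<forall>x\<in>carrier (P (Suc k)). a \<odot>\<^bsub>X\<^esub> f x = g (d k x)" by (rule ch)
    next
      assume "\<exists>g\<in>cochains k X. \<forall>x\<in>carrier (P (Suc k)). a \<odot>\<^bsub>X\<^esub> f x = g (d k x)"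
      then obtain g where "g \<in> cochains k X"
        "\<forall>x\<in>carrier (P (Suc k)). a \<odot>\<^bsub>X\<^esub> restrict f (carrier (P (Suc k))) x = g (d k x)" by auto
      then show "\<exists>g\<in>lin_maps R (P k) X. \<forall>x\<in>carrier (P (Suc k)). a \<odot>\<^bsub>X\<^esub> restrict f (carrier (P (Suc k))) x = g (d k x)"
        using lin_maps_degD(1) by (intro bexI)
    qed
    then show ?thesis
      using Ext_smult_zero_iff[OF graded_moduleD(1)[OF X] rgr_closed cocycle_restrict[OF f]] Suc
      by (simp cong: conj_cong)
  qed
  have "annihilators R ?E n = (\<lambda>f. case i of 0 \<Rightarrow> {a \<in> rgr R 0. \<forall>x\<in>carrier (P 0). a \<odot>\<^bsub>X\<^esub> f x = \<zero>\<^bsub>X\<^esub>}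
      | Suc k \<Rightarrow> {a \<in> rgr R 0. \<exists>g\<in>cochains k X. \<forall>x\<in>carrier (P (Suc k)). a \<odot>\<^bsub>X\<^esub> f x = g (d k x)}) ` cocycles i X"
    unfolding annihilators_def Ext_gr[OF graded_moduleD(1)[OF X]] image_image by (rule image_cong[OF refl ann])
  then show ?thesis
    by (simp add: Ext0_annihilators_def Ext_annihilators_def split: nat.split)
qed

lemma Ext_deg0_stable:
  assumes X: "graded_module R X"
  shows "deg0_stable R (Ext_gmodule R P d i X) n"
proof -
  interpret X: module R X by (rule graded_moduleD[OF X])
  interpret DX: direct_sum X "gr X" by (rule graded_moduleD[OF X])
  let ?M = "sub_gmodule (hom_gmodule R (P i) X) (Ext_cocycles i X)"
  let ?E = "Ext_gmodule R P d i X"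
  note sub = Ext_submodules[OF X.module_axioms, of i]
  interpret M: module R ?M by (rule sub(1))
  note q = quot_gmodule_simps[OF sub, folded Ext_gmodule_eq]
  note gr = Ext_gr[OF X.module_axioms, of i]
  have "module R ?E" unfolding Ext_gmodule_eq by (rule quot_module[OF sub])
  moreover have "gr ?E n \<subseteq> carrier ?E"
    unfolding gr q(1) using cocycle_restrict by (intro image_subsetI) (auto simp del: restrict_apply)
  moreover have "\<zero>\<^bsub>?E\<^esub> \<in> gr ?E n"
  proof -
    have "(\<lambda>_. \<zero>\<^bsub>X\<^esub>) \<in> cocycles i X"
      using lin_maps_degI[OF lin_maps_const_zero[OF X.module_axioms], of "P i" n] by (simp add: cocycles_def)
    then have "Ext_coboundaries i X +>\<^bsub>?M\<^esub> (\<lambda>x\<in>carrier (P i). \<zero>\<^bsub>X\<^esub>) \<in> gr ?E n"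
      unfolding gr by (rule image_eqI[OF refl])
    moreover have "Ext_coboundaries i X +>\<^bsub>?M\<^esub> (\<lambda>x\<in>carrier (P i). \<zero>\<^bsub>X\<^esub>) = \<zero>\<^bsub>?E\<^esub>"
      using M.a_coset_add_zero[OF submoduleD(1)[OF sub]] q(2) by simp
    ultimately show ?thesis by simp
  qed
  moreover have "a \<odot>\<^bsub>?E\<^esub> Y \<in> gr ?E n" if a: "a \<in> rgr R 0" and Y: "Y \<in> gr ?E n" for a Y
  proof -
    obtain f where f: "f \<in> cocycles i X" "Y = Ext_coboundaries i X +>\<^bsub>?M\<^esub> restrict f (carrier (P i))"
      using Y unfolding gr by blast
    have ac: "a \<in> carrier R" by (rule rgr_closed[OF a])
    have fc: "f \<in> cochains i X" "\<forall>x\<in>carrier (P (Suc i)). f (d i x) = \<zero>\<^bsub>X\<^esub>"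
      using f(1) by (simp_all add: cocycles_def)
    have "(\<lambda>x. a \<odot>\<^bsub>X\<^esub> f x) \<in> cocycles i X"
      using fc(2) lin_maps_deg_smult[OF fc(1) a ac X] ac by (simp add: cocycles_def)
    then have "Ext_coboundaries i X +>\<^bsub>?M\<^esub> (\<lambda>x\<in>carrier (P i). a \<odot>\<^bsub>X\<^esub> f x) \<in> gr ?E n"
      unfolding gr by (rule image_eqI[OF refl])
    moreover have "a \<odot>\<^bsub>?M\<^esub> restrict f (carrier (P i)) = (\<lambda>x\<in>carrier (P i). a \<odot>\<^bsub>X\<^esub> f x)"
      by (simp add: restrict_def fun_eq_iff)
    ultimately show ?thesis
      using q(5)[OF ac, of "restrict f (carrier (P i))"] cocycle_restrict[OF f(1)] f(2) by simp
  qed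
  ultimately show ?thesis unfolding deg0_stable_def by blast
qed

end

lemma sub_sub_gmodule:
  assumes "N \<subseteq> S"
  shows "sub_gmodule (sub_gmodule X S) N = sub_gmodule X N"
proof -
  have "gr X n \<inter> S \<inter> N = gr X n \<inter> N" for n using assms by blast
  then show ?thesis by (simp add: sub_gmodule_def)
qed

lemma homogeneous_submodule_sub:
  assumes "graded_module R X" "graded_ring R" "homogeneous_submodule R X S" "homogeneous_submodule R X N" "N \<subseteq> S"
  shows "homogeneous_submodule R (sub_gmodule X S) N"
  using homogeneous_sub_gmodule(2)[OF assms(1,3,2)] assms(4,5)
    submodule_of_sub[OF graded_moduleD(1)[OF assms(1)], of S N] assms(3)
  by (simp add: homogeneous_submodule_def subset_iff)

lemma quot_map:
  assumes "module R M" "submodule N R M"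
  shows "(\<lambda>x. N +>\<^bsub>M\<^esub> x) \<in> lin_maps R M (quot_gmodule M N)"
    "(\<lambda>x. N +>\<^bsub>M\<^esub> x) ` carrier M = carrier (quot_gmodule M N)"
proof -
  note q = quot_gmodule_simps[OF assms]
  show "(\<lambda>x. N +>\<^bsub>M\<^esub> x) ` carrier M = carrier (quot_gmodule M N)" unfolding q(1) by blast
  show "(\<lambda>x. N +>\<^bsub>M\<^esub> x) \<in> lin_maps R M (quot_gmodule M N)"
    by (rule lin_mapsI) (simp_all add: q(4,5), auto simp: q(1))
qed

section \<open>Quotients, isomorphic copies and Hom in terms of cochains\<close>

context free_complex
begin

lemma cocycle_cochain: "f \<in> cocycles i X \<Longrightarrow> f \<in> cochains i X"
  by (simp add: cocycles_def)

text \<open>Composition with the quotient map makes \<open>f\<close> a cocycle with values in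
  \<open>Z/B\<close>, hence a coboundary; the bounding map lifts to \<open>Z\<close> because
  \<open>P i\<close> is free.\<close>

lemma exact_mod_of_Ext_zero:
  assumes Z: "graded_module R Z" and B: "homogeneous_submodule R Z B"
    and zero: "gr (Ext_gmodule R P d (Suc i) (quot_gmodule Z B)) n =
      {\<zero>\<^bsub>Ext_gmodule R P d (Suc i) (quot_gmodule Z B)\<^esub>}"
  shows "exact_mod i Z B"
  unfolding exact_mod_def
proof (intro ballI impI)
  interpret Z: module R Z by (rule graded_moduleD[OF Z])
  interpret DP: direct_sum "P (Suc i)" "gr (P (Suc i))" by (rule P_direct_sum)
  interpret DZ: direct_sum Z "gr Z" by (rule graded_moduleD[OF Z])
  note Bd = homogeneous_submoduleD[OF Z.module_axioms B]
  let ?H = "quot_gmodule Z B" and ?q = "\<lambda>x. B +>\<^bsub>Z\<^esub> x"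
  have H: "module R ?H" by (rule quot_module[OF Z.module_axioms Bd(1)])
  note q = quot_gmodule_simps[OF Z.module_axioms Bd(1)]
  note qm = quot_map[OF Z.module_axioms Bd(1)]
  fix f assume f: "f \<in> cochains (Suc i) Z" and fB: "\<forall>x\<in>carrier (P (Suc (Suc i))). f (d (Suc i) x) \<in> B"
  let ?F = "\<lambda>x. ?q (f x)"
  have F: "?F \<in> cocycles (Suc i) ?H"
  proof -
    have "?F \<in> cochains (Suc i) ?H"
      by (rule lin_maps_degI[OF lin_maps_comp[OF lin_maps_degD(1)[OF f] qm(1)]])
        (use lin_maps_degD(2)[OF f] in \<open>auto simp: q(3)\<close>)
    moreover have "?F (d (Suc i) x) = \<zero>\<^bsub>?H\<^esub>" if "x \<in> carrier (P (Suc (Suc i)))" for x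
      using coset_zero_iff[OF Z.module_axioms Bd(1)] bspec[OF fB that] Bd(2) q(2) by (simp add: subset_iff)
    ultimately show ?thesis by (simp add: cocycles_def)
  qed
  let ?M = "sub_gmodule (hom_gmodule R (P (Suc i)) ?H) (Ext_cocycles (Suc i) ?H)"
  let ?r = "restrict ?F (carrier (P (Suc i)))"
  have "Ext_coboundaries (Suc i) ?H +>\<^bsub>?M\<^esub> ?r \<in> gr (Ext_gmodule R P d (Suc i) ?H) n"
    unfolding Ext_gr[OF H] by (rule imageI[OF F])
  then have "Ext_coboundaries (Suc i) ?H +>\<^bsub>?M\<^esub> ?r = Ext_coboundaries (Suc i) ?H"
    using zero quot_gmodule_simps(2)[OF Ext_submodules[OF H, of "Suc i"]] unfolding Ext_gmodule_eq by simp
  then have "?r \<in> Ext_coboundaries (Suc i) ?H"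
    using coset_zero_iff[OF Ext_submodules[OF H, of "Suc i"], of ?r] cocycle_restrict[OF F] by simp
  then obtain G where G: "G \<in> lin_maps R (P i) ?H" "\<forall>x\<in>carrier (P (Suc i)). ?F x = G (d i x)"
    unfolding mem_Ext_coboundaries[OF restrict_extensional] by auto
  \<comment> \<open>The lift is taken without degrees, as only \<open>Z\<close> and not the quotient
    is known to be a graded module; its part \<open>h\<close> of degree \<open>n\<close> is then
    formed inside \<open>Z\<close>.\<close>
  from free_module_projective[OF free Z.module_axioms H G(1) qm] obtain g where
    g: "g \<in> lin_maps R (P i) Z" "\<forall>x\<in>carrier (P i). ?q (g x) = G x" by auto
  obtain h where h: "h \<in> cochains i Z" "\<forall>l. \<forall>x\<in>gr (P i) l. h x = hc Z (l + n) (g x)"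
    using homogeneous_part[OF g(1) P_graded Z graded] by blast
  have fg: "f x \<ominus>\<^bsub>Z\<^esub> g (d i x) \<in> B" if x: "x \<in> carrier (P (Suc i))" for x
  proof -
    have "?q (f x) = ?q (g (d i x))" using G(2) g(2) x d_closed[OF x] by simp
    then show ?thesis
      using coset_eq_iff[OF Z.module_axioms Bd(1) cochain_closed[OF f x] lin_mapsD(1)[OF g(1) d_closed[OF x]]]
      by simp
  qed
  have u: "(\<lambda>x. f x \<ominus>\<^bsub>Z\<^esub> h (d i x)) \<in> cochains (Suc i) Z"
    by (rule lin_maps_deg_minus[OF f cochain_comp_d[OF h(1)] Z])
  \<comment> \<open>On \<open>x\<close> of degree \<open>l\<close> this is the component of degree
    \<open>l + n\<close> of the difference in \<open>fg\<close>, and \<open>B\<close> contains the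
    components of its elements.\<close>
  have "f x \<ominus>\<^bsub>Z\<^esub> h (d i x) \<in> B" if "x \<in> carrier (P (Suc i))" for x
    using that
  proof (induct rule: DP.homogeneous_induct)
    case (homogeneous l x)
    have xc: "x \<in> carrier (P (Suc i))" by (rule DP.component_closed[OF homogeneous])
    have c: "f x \<in> carrier Z" "g (d i x) \<in> carrier Z"
      by (rule cochain_closed[OF f xc], rule lin_mapsD(1)[OF g(1) d_closed[OF xc]])
    have "d i x \<in> gr (P i) l" using lin_maps_degD(2)[OF d_deg homogeneous] by simp
    then have hx: "h (d i x) = hc Z (l + n) (g (d i x))" using h(2) by simp
    have m: "hc Z (l + n) (\<ominus>\<^bsub>Z\<^esub> g (d i x)) = \<ominus>\<^bsub>Z\<^esub> hc Z (l + n) (g (d i x))"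
    proof -
      have "hc Z (l + n) (\<ominus>\<^bsub>Z\<^esub> g (d i x)) \<oplus>\<^bsub>Z\<^esub> hc Z (l + n) (g (d i x)) = \<zero>\<^bsub>Z\<^esub>"
        using c(2) by (simp add: Z.M.l_neg flip: DZ.hcomp_add)
      then show ?thesis
        using Z.M.minus_equality[of "hc Z (l + n) (\<ominus>\<^bsub>Z\<^esub> g (d i x))" "hc Z (l + n) (g (d i x))"] c(2) by simp
    qed
    have "hc Z (l + n) (f x \<ominus>\<^bsub>Z\<^esub> g (d i x)) = f x \<ominus>\<^bsub>Z\<^esub> h (d i x)"
      using c m DZ.hcomp_same[OF lin_maps_degD(2)[OF f homogeneous]] hx
      by (simp add: a_minus_def DZ.hcomp_add)
    then show ?case using Bd(7)[OF fg[OF xc], of "l + n"] by simp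
  next
    case (add x y)
    then show ?case using lin_mapsD(2)[OF lin_maps_degD(1)[OF u] add(1,2)] Bd(5) by simp
  qed
  then show "\<exists>g\<in>cochains i Z. \<forall>x\<in>carrier (P (Suc i)). f x \<ominus>\<^bsub>Z\<^esub> g (d i x) \<in> B"
    using h(1) by (intro bexI ballI)
qed

text \<open>\<open>\<iota>\<close> identifies \<open>M\<close> with its image: cochains are pushed
  forward by composition and pulled back by lifting. This moves the computation from the type of
  \<open>M\<close> to the type of the resolution.\<close>

lemma Ext_annihilators_inj:
  assumes M: "graded_module R M" and X: "graded_module R X" and \<iota>: "\<iota> \<in> lin_maps_deg R M X 0"
    and inj: "inj_on \<iota> (carrier M)"
  shows "Ext_annihilators k M = Ext_annihilators k (sub_gmodule X (\<iota> ` carrier M))"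
    and "Ext0_annihilators M = Ext0_annihilators (sub_gmodule X (\<iota> ` carrier M))"
proof -
  interpret M: module R M by (rule graded_moduleD[OF M])
  interpret X: module R X by (rule graded_moduleD[OF X])
  note im = homogeneous_submoduleD[OF X.module_axioms image_homogeneous[OF M X \<iota>]]
  let ?S = "sub_gmodule X (\<iota> ` carrier M)"
  note \<iota>d = lin_mapsD[OF lin_maps_degD(1)[OF \<iota>]]
  note \<iota>0 = lin_maps_zero[OF lin_maps_degD(1)[OF \<iota>] M.module_axioms X.module_axioms]
  have \<iota>eq: "\<iota> x = \<iota> y \<longleftrightarrow> x = y" if "x \<in> carrier M" "y \<in> carrier M" for x y
    using inj_on_eq_iff[OF inj that] .
  have \<iota>z: "\<iota> x = \<zero>\<^bsub>X\<^esub> \<longleftrightarrow> x = \<zero>\<^bsub>M\<^esub>" if "x \<in> carrier M" for x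
    using \<iota>eq[OF that M.M.zero_closed] \<iota>0 by simp
  have push: "(\<lambda>x. \<iota> (f x)) \<in> cochains i ?S" if "f \<in> cochains i M" for f i
  proof -
    have "(\<lambda>x. \<iota> (f x)) \<in> cochains i X" by (rule lin_maps_deg_comp[OF that \<iota>]) simp
    then show ?thesis unfolding cochains_sub[OF im(2)] using cochain_closed[OF that] by simp
  qed
  have pushc: "(\<lambda>x. \<iota> (f x)) \<in> cocycles i ?S" if "f \<in> cocycles i M" for f i
    using that push[of f i] \<iota>0 by (simp add: cocycles_def)
  have pull: "\<exists>g\<in>cocycles i M. \<forall>x\<in>carrier (P i). f x = \<iota> (g x)" if f: "f \<in> cocycles i ?S" for f i
  proof -
    have fc: "f \<in> cochains i ?S" "\<And>x. x \<in> carrier (P (Suc i)) \<Longrightarrow> f (d i x) = \<zero>\<^bsub>X\<^esub>"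
      using f by (simp_all add: cocycles_def)
    obtain g where g: "g \<in> cochains i M" "\<And>x. x \<in> carrier (P i) \<Longrightarrow> \<iota> (g x) = f x"
      using lift_cochain[OF M X \<iota> fc(1)] by blast
    have "g (d i x) = \<zero>\<^bsub>M\<^esub>" if x: "x \<in> carrier (P (Suc i))" for x
      using \<iota>z[OF cochain_closed[OF g(1) d_closed[OF x]]] g(2)[OF d_closed[OF x]] fc(2)[OF x] by simp
    then have "g \<in> cocycles i M" using g(1) by (simp add: cocycles_def)
    then show ?thesis using g(2) by (intro bexI ballI) simp_all
  qed
  let ?A = "\<lambda>f. {a \<in> rgr R 0. \<exists>g\<in>cochains k M. \<forall>x\<in>carrier (P (Suc k)). a \<odot>\<^bsub>M\<^esub> f x = g (d k x)}"
  let ?B = "\<lambda>f. {a \<in> rgr R 0. \<exists>g\<in>cochains k ?S. \<forall>x\<in>carrier (P (Suc k)). a \<odot>\<^bsub>?S\<^esub> f x = g (d k x)}"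
  have AB: "?A g = ?B f"
    if g: "g \<in> cocycles (Suc k) M" and f: "\<And>x. x \<in> carrier (P (Suc k)) \<Longrightarrow> f x = \<iota> (g x)" for f g
  proof -
    have gc: "g x \<in> carrier M" if "x \<in> carrier (P (Suc k))" for x
      by (rule cochain_closed[OF cocycle_cochain[OF g] that])
    have "(\<exists>h\<in>cochains k M. \<forall>x\<in>carrier (P (Suc k)). a \<odot>\<^bsub>M\<^esub> g x = h (d k x)) \<longleftrightarrow>
        (\<exists>h\<in>cochains k ?S. \<forall>x\<in>carrier (P (Suc k)). a \<odot>\<^bsub>X\<^esub> f x = h (d k x))" if a: "a \<in> rgr R 0" for a
    proof -
      have ac: "a \<in> carrier R" by (rule rgr_closed[OF a])
      have af: "a \<odot>\<^bsub>X\<^esub> f x = \<iota> (a \<odot>\<^bsub>M\<^esub> g x)" if "x \<in> carrier (P (Suc k))" for x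
        using f[OF that] \<iota>d(3)[OF ac gc[OF that]] by simp
      show ?thesis
      proof
        assume "\<exists>h\<in>cochains k M. \<forall>x\<in>carrier (P (Suc k)). a \<odot>\<^bsub>M\<^esub> g x = h (d k x)"
        then obtain h where h: "h \<in> cochains k M" "\<forall>x\<in>carrier (P (Suc k)). a \<odot>\<^bsub>M\<^esub> g x = h (d k x)" by blast
        have "\<forall>x\<in>carrier (P (Suc k)). a \<odot>\<^bsub>X\<^esub> f x = \<iota> (h (d k x))" using h(2) af by simp
        then show "\<exists>h\<in>cochains k ?S. \<forall>x\<in>carrier (P (Suc k)). a \<odot>\<^bsub>X\<^esub> f x = h (d k x)"
          by (rule bexI[OF _ push[OF h(1)]])
      next
        assume "\<exists>h\<in>cochains k ?S. \<forall>x\<in>carrier (P (Suc k)). a \<odot>\<^bsub>X\<^esub> f x = h (d k x)"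
        then obtain h where h: "h \<in> cochains k ?S" "\<forall>x\<in>carrier (P (Suc k)). a \<odot>\<^bsub>X\<^esub> f x = h (d k x)" by blast
        obtain h' where h': "h' \<in> cochains k M" "\<And>x. x \<in> carrier (P k) \<Longrightarrow> \<iota> (h' x) = h x"
          using lift_cochain[OF M X \<iota> h(1)] by blast
        have "a \<odot>\<^bsub>M\<^esub> g x = h' (d k x)" if x: "x \<in> carrier (P (Suc k))" for x
        proof -
          have "\<iota> (a \<odot>\<^bsub>M\<^esub> g x) = \<iota> (h' (d k x))"
            using af[OF x] h(2) h'(2)[OF d_closed[OF x]] x by simp
          then show ?thesis
            using \<iota>eq[OF _ cochain_closed[OF h'(1) d_closed[OF x]]] gc[OF x] ac by simp
        qed
        then show "\<exists>h\<in>cochains k M. \<forall>x\<in>carrier (P (Suc k)). a \<odot>\<^bsub>M\<^esub> g x = h (d k x)"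
          using h'(1) by (intro bexI ballI)
      qed
    qed
    then show ?thesis by auto
  qed
  have "?A g \<in> ?B ` cocycles (Suc k) ?S" if "g \<in> cocycles (Suc k) M" for g
    by (rule image_eqI[rotated], rule pushc[OF that], rule AB[OF that refl])
  moreover have "?B f \<in> ?A ` cocycles (Suc k) M" if fS: "f \<in> cocycles (Suc k) ?S" for f
  proof -
    obtain g where g: "g \<in> cocycles (Suc k) M" "\<And>x. x \<in> carrier (P (Suc k)) \<Longrightarrow> f x = \<iota> (g x)"
      using pull[OF fS] by blast
    show ?thesis by (rule image_eqI[rotated], rule g(1), rule AB[OF g, symmetric])
  qed
  ultimately show "Ext_annihilators k M = Ext_annihilators k ?S" unfolding Ext_annihilators_def by blast
  let ?A0 = "\<lambda>f. {a \<in> rgr R 0. \<forall>x\<in>carrier (P 0). a \<odot>\<^bsub>M\<^esub> f x = \<zero>\<^bsub>M\<^esub>}"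
  let ?B0 = "\<lambda>f. {a \<in> rgr R 0. \<forall>x\<in>carrier (P 0). a \<odot>\<^bsub>?S\<^esub> f x = \<zero>\<^bsub>?S\<^esub>}"
  have AB0: "?A0 g = ?B0 f"
    if g: "g \<in> cocycles 0 M" and f: "\<And>x. x \<in> carrier (P 0) \<Longrightarrow> f x = \<iota> (g x)" for f g
  proof -
    have "a \<odot>\<^bsub>X\<^esub> f x = \<zero>\<^bsub>X\<^esub> \<longleftrightarrow> a \<odot>\<^bsub>M\<^esub> g x = \<zero>\<^bsub>M\<^esub>" if a: "a \<in> rgr R 0" and x: "x \<in> carrier (P 0)" for a x
    proof -
      have ac: "a \<in> carrier R" by (rule rgr_closed[OF a])
      have gc: "g x \<in> carrier M" by (rule cochain_closed[OF cocycle_cochain[OF g] x])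
      show ?thesis using f[OF x] \<iota>d(3)[OF ac gc] \<iota>z[of "a \<odot>\<^bsub>M\<^esub> g x"] ac gc by simp
    qed
    then show ?thesis by auto
  qed
  have "?A0 g \<in> ?B0 ` cocycles 0 ?S" if "g \<in> cocycles 0 M" for g
    by (rule image_eqI[rotated], rule pushc[OF that], rule AB0[OF that refl])
  moreover have "?B0 f \<in> ?A0 ` cocycles 0 M" if fS: "f \<in> cocycles 0 ?S" for f
  proof -
    obtain g where g: "g \<in> cocycles 0 M" "\<And>x. x \<in> carrier (P 0) \<Longrightarrow> f x = \<iota> (g x)"
      using pull[OF fS] by blast
    show ?thesis by (rule image_eqI[rotated], rule g(1), rule AB0[OF g, symmetric])
  qed
  ultimately show "Ext0_annihilators M = Ext0_annihilators ?S" unfolding Ext0_annihilators_def by blast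
qed

text \<open>A homomorphism from the module resolved by \<open>P\<close> to \<open>Z/B\<close> is
  represented by a lift to \<open>P 0\<close>, that is, by a \<open>Z\<close>-valued cochain that
  sends boundaries into \<open>B\<close>; it is zero iff all its values lie in
  \<open>B\<close>.\<close>

definition Hom_annihilators :: "('a, 'm) gmodule \<Rightarrow> 'm set \<Rightarrow> 'a set set" where
  "Hom_annihilators Z B =
     (\<lambda>f. {a \<in> rgr R 0. \<forall>x\<in>carrier (P 0). a \<odot>\<^bsub>Z\<^esub> f x \<in> B}) `
       {f \<in> cochains 0 Z. \<forall>x\<in>carrier (P (Suc 0)). f (d 0 x) \<in> B}"

lemma Hom_annihilators_zero:
  "Hom_annihilators Z {\<zero>\<^bsub>Z\<^esub>} = Ext0_annihilators Z"
  unfolding Hom_annihilators_def Ext0_annihilators_def cocycles_def by simp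

text \<open>The two vanishing conditions have separate tasks. \<open>exB\<close> turns a cochain
  that sends boundaries into the image of \<open>\<delta>\<close> into a cocycle, by subtracting an
  image-valued cochain, which does not affect the annihilator. \<open>exK\<close> lifts an
  image-valued cocycle to a cocycle of \<open>T\<close>.\<close>

lemma Hom_annihilators_compare:
  assumes T: "graded_module R T" and T': "graded_module R T'" and \<delta>: "\<delta> \<in> lin_maps_deg R T T' 0"
    and Z: "homogeneous_submodule R T' Z" and BZ: "\<delta> ` carrier T \<subseteq> Z"
    and exB: "exact_at 0 (sub_gmodule T' (\<delta> ` carrier T))"
    and exK: "exact_at 0 (sub_gmodule T (ker_of T T' \<delta>))"
  shows "Hom_annihilators (sub_gmodule T' Z) (\<delta> ` carrier T) =
    (\<lambda>f. {a \<in> rgr R 0. \<exists>g\<in>cocycles 0 T. \<forall>x\<in>carrier (P 0). a \<odot>\<^bsub>T'\<^esub> f x = \<delta> (g x)}) `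
      cocycles 0 (sub_gmodule T' Z)"
proof -
  interpret T: module R T by (rule graded_moduleD[OF T])
  interpret T': module R T' by (rule graded_moduleD[OF T'])
  note im = homogeneous_submoduleD[OF T'.module_axioms image_homogeneous[OF T T' \<delta>]]
  note kr = homogeneous_submoduleD[OF T.module_axioms ker_of_homogeneous[OF T T' \<delta>]]
  note Zd = homogeneous_submoduleD[OF T'.module_axioms Z]
  note \<delta>d = lin_mapsD[OF lin_maps_degD(1)[OF \<delta>]]
  have \<delta>m: "\<delta> (x \<ominus>\<^bsub>T\<^esub> y) = \<delta> x \<ominus>\<^bsub>T'\<^esub> \<delta> y" if "x \<in> carrier T" "y \<in> carrier T" for x y
    using that lin_maps_minus[OF lin_maps_degD(1)[OF \<delta>] T.module_axioms T'.module_axioms]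
    by (simp add: a_minus_def \<delta>d)
  let ?B = "\<delta> ` carrier T" and ?Z = "sub_gmodule T' Z"
  let ?L = "\<lambda>f. {a \<in> rgr R 0. \<forall>x\<in>carrier (P 0). a \<odot>\<^bsub>?Z\<^esub> f x \<in> ?B}"
  let ?R = "\<lambda>f. {a \<in> rgr R 0. \<exists>g\<in>cocycles 0 T. \<forall>x\<in>carrier (P 0). a \<odot>\<^bsub>T'\<^esub> f x = \<delta> (g x)}"
  have lift: "\<exists>g\<in>cocycles 0 T. \<forall>x\<in>carrier (P 0). f x = \<delta> (g x)"
    if f: "f \<in> cocycles 0 T'" and fB: "\<And>x. x \<in> carrier (P 0) \<Longrightarrow> f x \<in> ?B" for f
  proof -
    have fc: "f \<in> cochains 0 T'" "\<And>x. x \<in> carrier (P (Suc 0)) \<Longrightarrow> f (d 0 x) = \<zero>\<^bsub>T'\<^esub>"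
      using f by (simp_all add: cocycles_def)
    have "f \<in> cochains 0 (sub_gmodule T' ?B)" using fc(1) fB cochains_sub[OF im(2)] by simp
    from lift_cochain[OF T T' \<delta> this] obtain g where
      g: "g \<in> cochains 0 T" "\<And>x. x \<in> carrier (P 0) \<Longrightarrow> \<delta> (g x) = f x" by blast
    have "(\<lambda>x. g (d 0 x)) \<in> cocycles (Suc 0) (sub_gmodule T (ker_of T T' \<delta>))"
      unfolding cocycles_sub[OF kr(2)]
      using coboundary_cocycle[OF g(1) T] cochain_closed[OF g(1) d_closed] g(2)[OF d_closed] fc(2)
      by (simp add: ker_of_def)
    from exact_atD[OF exK this] obtain h where h: "h \<in> cochains 0 (sub_gmodule T (ker_of T T' \<delta>))"
      "\<And>x. x \<in> carrier (P (Suc 0)) \<Longrightarrow> g (d 0 x) = h (d 0 x)" by blast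
    have hT: "h \<in> cochains 0 T" and hk: "\<And>x. x \<in> carrier (P 0) \<Longrightarrow> \<delta> (h x) = \<zero>\<^bsub>T'\<^esub>"
      using h(1) cochains_sub[OF kr(2)] by (simp_all add: ker_of_def)
    \<comment> \<open>The lift \<open>g\<close> is a cocycle only up to kernel values. Subtracting
      the kernel-valued \<open>h\<close> repairs this without changing the image under
      \<open>\<delta>\<close>.\<close>
    let ?u = "\<lambda>x. g x \<ominus>\<^bsub>T\<^esub> h x"
    have "?u \<in> cochains 0 T" by (rule lin_maps_deg_minus[OF g(1) hT T])
    moreover have "?u (d 0 x) = \<zero>\<^bsub>T\<^esub>" if "x \<in> carrier (P (Suc 0))" for x
      using h(2)[OF that] cochain_closed[OF hT d_closed[OF that]] by (simp add: a_minus_def T.M.r_neg)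
    ultimately have "?u \<in> cocycles 0 T" by (simp add: cocycles_def)
    moreover have "f x = \<delta> (?u x)" if x: "x \<in> carrier (P 0)" for x
      using \<delta>m[OF cochain_closed[OF g(1) x] cochain_closed[OF hT x]] g(2)[OF x] hk[OF x]
        cochain_closed[OF fc(1) x] by (simp add: a_minus_def)
    ultimately show ?thesis by (intro bexI ballI)
  qed
  have LR: "?L f = ?R f" if f: "f \<in> cocycles 0 ?Z" for f
  proof -
    have fT: "f \<in> cochains 0 T'" "\<forall>x\<in>carrier (P (Suc 0)). f (d 0 x) = \<zero>\<^bsub>T'\<^esub>"
      using f unfolding cocycles_sub[OF Zd(2)] by (simp_all add: cocycles_def)
    have "(\<forall>x\<in>carrier (P 0). a \<odot>\<^bsub>T'\<^esub> f x \<in> ?B) \<longleftrightarrow>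
        (\<exists>g\<in>cocycles 0 T. \<forall>x\<in>carrier (P 0). a \<odot>\<^bsub>T'\<^esub> f x = \<delta> (g x))" if a: "a \<in> rgr R 0" for a
    proof
      assume "\<forall>x\<in>carrier (P 0). a \<odot>\<^bsub>T'\<^esub> f x \<in> ?B"
      moreover have "(\<lambda>x. a \<odot>\<^bsub>T'\<^esub> f x) \<in> cocycles 0 T'"
        using lin_maps_deg_smult[OF fT(1) a rgr_closed[OF a] T'] fT(2) rgr_closed[OF a]
        by (simp add: cocycles_def)
      ultimately show "\<exists>g\<in>cocycles 0 T. \<forall>x\<in>carrier (P 0). a \<odot>\<^bsub>T'\<^esub> f x = \<delta> (g x)"
        by (intro lift) simp_all
    next
      assume "\<exists>g\<in>cocycles 0 T. \<forall>x\<in>carrier (P 0). a \<odot>\<^bsub>T'\<^esub> f x = \<delta> (g x)"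
      then obtain g where g: "g \<in> cochains 0 T" "\<forall>x\<in>carrier (P 0). a \<odot>\<^bsub>T'\<^esub> f x = \<delta> (g x)"
        by (auto simp: cocycles_def)
      show "\<forall>x\<in>carrier (P 0). a \<odot>\<^bsub>T'\<^esub> f x \<in> ?B" using g(2) cochain_closed[OF g(1)] by simp
    qed
    then show ?thesis by auto
  qed
  have "?L f \<in> ?R ` cocycles 0 ?Z" if f: "f \<in> {f \<in> cochains 0 ?Z. \<forall>x\<in>carrier (P (Suc 0)). f (d 0 x) \<in> ?B}" for f
  proof -
    have fc: "f \<in> cochains 0 T'" "\<And>x. x \<in> carrier (P 0) \<Longrightarrow> f x \<in> Z"
      and fB: "\<And>x. x \<in> carrier (P (Suc 0)) \<Longrightarrow> f (d 0 x) \<in> ?B"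
      using f cochains_sub[OF Zd(2)] by simp_all
    have "(\<lambda>x. f (d 0 x)) \<in> cocycles (Suc 0) (sub_gmodule T' ?B)"
      unfolding cocycles_sub[OF im(2)] using coboundary_cocycle[OF fc(1) T'] fB by simp
    from exact_atD[OF exB this] obtain k where k: "k \<in> cochains 0 (sub_gmodule T' ?B)"
      "\<And>x. x \<in> carrier (P (Suc 0)) \<Longrightarrow> f (d 0 x) = k (d 0 x)" by blast
    have kT: "k \<in> cochains 0 T'" and kB: "\<And>x. x \<in> carrier (P 0) \<Longrightarrow> k x \<in> ?B"
      using k(1) cochains_sub[OF im(2)] by simp_all
    let ?f = "\<lambda>x. f x \<ominus>\<^bsub>T'\<^esub> k x"
    have "?f \<in> cochains 0 T'" by (rule lin_maps_deg_minus[OF fc(1) kT T'])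
    moreover have "?f (d 0 x) = \<zero>\<^bsub>T'\<^esub>" if "x \<in> carrier (P (Suc 0))" for x
      using k(2)[OF that] cochain_closed[OF kT d_closed[OF that]] by (simp add: a_minus_def T'.M.r_neg)
    moreover have "?f x \<in> Z" if "x \<in> carrier (P 0)" for x
      using fc(2)[OF that] Zd(4)[OF subsetD[OF BZ kB[OF that]]] Zd(5) by (simp add: a_minus_def)
    ultimately have f': "?f \<in> cocycles 0 ?Z" unfolding cocycles_sub[OF Zd(2)] by (simp add: cocycles_def)
    have "a \<odot>\<^bsub>T'\<^esub> f x \<in> ?B \<longleftrightarrow> a \<odot>\<^bsub>T'\<^esub> ?f x \<in> ?B" if a: "a \<in> rgr R 0" and x: "x \<in> carrier (P 0)" for a x
    proof -
      have ac: "a \<in> carrier R" by (rule rgr_closed[OF a])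
      have c: "f x \<in> carrier T'" "k x \<in> carrier T'" "?f x \<in> carrier T'"
        using cochain_closed[OF fc(1) x] cochain_closed[OF kT x] by simp_all
      have "f x = ?f x \<oplus>\<^bsub>T'\<^esub> k x" using c by (simp add: a_minus_def T'.M.a_assoc T'.M.l_neg)
      then have 1: "a \<odot>\<^bsub>T'\<^esub> f x = a \<odot>\<^bsub>T'\<^esub> ?f x \<oplus>\<^bsub>T'\<^esub> a \<odot>\<^bsub>T'\<^esub> k x"
        using T'.smult_r_distr[OF ac c(3,2)] by simp
      have 2: "a \<odot>\<^bsub>T'\<^esub> ?f x = a \<odot>\<^bsub>T'\<^esub> f x \<oplus>\<^bsub>T'\<^esub> \<ominus>\<^bsub>T'\<^esub> (a \<odot>\<^bsub>T'\<^esub> k x)"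
        using c ac by (simp add: a_minus_def T'.smult_r_distr T'.smult_r_minus)
      have 3: "a \<odot>\<^bsub>T'\<^esub> k x \<in> ?B" by (rule im(6)[OF ac kB[OF x]])
      show ?thesis
      proof
        assume "a \<odot>\<^bsub>T'\<^esub> f x \<in> ?B"
        then show "a \<odot>\<^bsub>T'\<^esub> ?f x \<in> ?B" unfolding 2 by (rule im(5)[OF _ im(4)[OF 3]])
      next
        assume "a \<odot>\<^bsub>T'\<^esub> ?f x \<in> ?B"
        then show "a \<odot>\<^bsub>T'\<^esub> f x \<in> ?B" unfolding 1 by (rule im(5)[OF _ 3])
      qed
    qed
    then have "?L f = ?L ?f" by auto
    then show ?thesis using LR[OF f'] f' by (intro image_eqI[of _ _ ?f]) simp_all
  qed
  moreover have "?R f \<in> ?L ` {f \<in> cochains 0 ?Z. \<forall>x\<in>carrier (P (Suc 0)). f (d 0 x) \<in> ?B}"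
    if f: "f \<in> cocycles 0 ?Z" for f
    by (rule image_eqI[rotated, of f]) (use f im(3) LR[OF f] in \<open>simp_all add: cocycles_def\<close>)
  ultimately show ?thesis unfolding Hom_annihilators_def by blast
qed

end

section \<open>The irrelevant ideal and the main theorem\<close>

text \<open>Seen as the kernel of the projection to degree 0, the ideal gets its closure properties
  and its homogeneity from the rules for components.\<close>

lemma (in graded_cring) irrelevant_ideal_eq:
  "irrelevant_ideal R = {a \<in> carrier R. rc R 0 a = \<zero>}"
proof
  have "(\<Oplus>i\<in>F. c i) \<in> carrier R \<and> rc R 0 (\<Oplus>i\<in>F. c i) = \<zero>"
    if "finite F" "\<forall>i\<in>F. 1 \<le> i \<and> c i \<in> rgr R i" for F c
    using that
  proof induct
    case (insert i F)
    have ci: "c i \<in> rgr R i" "1 \<le> i" using insert(4) by simp_all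
    have cF: "c \<in> F \<rightarrow> carrier R" using insert(4) rgr_closed by blast
    have "rc R 0 (c i) = \<zero>" using D.hcomp_component[OF ci(1), of 0] ci(2) by simp
    then show ?case
      using insert finsum_insert[OF insert(1,2) cF rgr_closed[OF ci(1)]] rgr_closed[OF ci(1)]
      by (simp add: D.hcomp_add)
  qed simp
  then show "irrelevant_ideal R \<subseteq> {a \<in> carrier R. rc R 0 a = \<zero>}"
    unfolding irrelevant_ideal_def by blast
  show "{a \<in> carrier R. rc R 0 a = \<zero>} \<subseteq> irrelevant_ideal R"
  proof
    fix a assume "a \<in> {a \<in> carrier R. rc R 0 a = \<zero>}"
    then have a: "a \<in> carrier R" "rc R 0 a = \<zero>" by simp_all
    let ?F = "{i. rc R i a \<noteq> \<zero>}"
    have "1 \<le> i" if "i \<in> ?F" for i using that a(2) by (cases i) simp_all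
    then have "\<forall>i\<in>?F. 1 \<le> i \<and> rc R i a \<in> rgr R i" using D.hcomp_props(1)[OF a(1)] by blast
    moreover note D.hcomp_props(2,3)[OF a(1)]
    ultimately show "a \<in> irrelevant_ideal R" unfolding irrelevant_ideal_def
      by (intro CollectI exI[of _ ?F] exI[of _ "\<lambda>i. rc R i a"] conjI)
  qed
qed

lemma (in graded_cring) irrelevant_ideal_homogeneous: "homogeneous_ideal (irrelevant_ideal R)"
proof -
  \<comment> \<open>Splitting \<open>a\<close> into homogeneous parts suffices: a factor of positive
    degree leaves nothing in degree 0, and a factor of degree 0 multiplies the degree 0 component of
    \<open>x\<close>.\<close>
  have sm: "rc R 0 (a \<otimes> x) = \<zero>" if "a \<in> carrier R" "x \<in> carrier R" "rc R 0 x = \<zero>" for a x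
    using that(1)
  proof (induct rule: D.homogeneous_induct)
    case (homogeneous i a)
    show ?case using rc_mult[OF homogeneous that(2), of 0] that(3) rgr_closed[OF homogeneous] by simp
  next
    case (add a b)
    then show ?case using that(2) by (simp add: l_distr D.hcomp_add)
  qed
  have "homogeneous_submodule R (shifted 0) {a \<in> carrier R. rc R 0 a = \<zero>}"
  proof (rule homogeneous_submoduleI[OF shifted_module])
    fix x k assume "x \<in> {a \<in> carrier R. rc R 0 a = \<zero>}"
    then have x: "x \<in> carrier R" "rc R 0 x = \<zero>" by simp_all
    have "rc R 0 (rc R (nat k) x) = \<zero>"
      using D.hcomp_component[OF D.hcomp_props(1)[OF x(1)], of 0 "nat k"] x(2) by (auto split: if_splits)
    then show "hc (shifted 0) k x \<in> {a \<in> carrier R. rc R 0 a = \<zero>}"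
      using x(1) by (simp add: hc_shifted)
  qed (auto simp: sm D.hcomp_add)
  then show ?thesis unfolding irrelevant_ideal_eq using homogeneous_ideal_iff by blast
qed

lemma (in graded_cring) positive_degree_irrelevant:
  "1 \<le> i \<Longrightarrow> r \<in> rgr R i \<Longrightarrow> r \<in> irrelevant_ideal R"
  unfolding irrelevant_ideal_eq using rgr_closed D.hcomp_component[of r i 0] by simp

lemma quot_deg0_stable:
  assumes R: "graded_ring R" and Z: "graded_module R Z" and B: "homogeneous_submodule R Z B"
  shows "deg0_stable R (quot_gmodule Z B) n"
proof -
  interpret Z: module R Z by (rule graded_moduleD[OF Z])
  interpret DZ: direct_sum Z "gr Z" by (rule graded_moduleD[OF Z])
  interpret R: graded_cring R by (rule graded_cringI[OF R])
  note Bd = homogeneous_submoduleD[OF Z.module_axioms B]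
  note q = quot_gmodule_simps[OF Z.module_axioms Bd(1)]
  have "B = B +>\<^bsub>Z\<^esub> \<zero>\<^bsub>Z\<^esub>" using Z.M.a_coset_add_zero[OF Bd(2)] by simp
  then have "\<zero>\<^bsub>quot_gmodule Z B\<^esub> \<in> gr (quot_gmodule Z B) n"
    unfolding q(2,3) using DZ.component_zero by blast
  moreover have "gr (quot_gmodule Z B) n \<subseteq> carrier (quot_gmodule Z B)"
    unfolding q(1,3) using DZ.component_closed by blast
  moreover have "a \<odot>\<^bsub>quot_gmodule Z B\<^esub> Y \<in> gr (quot_gmodule Z B) n"
    if a: "a \<in> rgr R 0" and Y: "Y \<in> gr (quot_gmodule Z B) n" for a Y
  proof -
    obtain z where z: "z \<in> gr Z n" "Y = B +>\<^bsub>Z\<^esub> z" using Y unfolding q(3) by blast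
    have "a \<odot>\<^bsub>Z\<^esub> z \<in> gr Z n" using graded_moduleD(3)[OF Z a z(1)] by simp
    moreover have "a \<odot>\<^bsub>quot_gmodule Z B\<^esub> Y = B +>\<^bsub>Z\<^esub> (a \<odot>\<^bsub>Z\<^esub> z)"
      using q(5)[OF R.rgr_closed[OF a] DZ.component_closed[OF z(1)]] z(2) by simp
    ultimately show ?thesis unfolding q(3) by blast
  qed
  ultimately show ?thesis unfolding deg0_stable_def using quot_module[OF Z.module_axioms Bd(1)] by blast
qed

lemma hom_deg0_stable:
  assumes A: "module R A" "\<And>k. gr A k \<subseteq> carrier A" and H: "\<And>k. deg0_stable R H k" and R: "graded_ring R"
  shows "deg0_stable R (hom_gmodule R A H) n"
proof -
  interpret R: graded_cring R by (rule graded_cringI[OF R])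
  have Hm: "module R H" using H[of 0] by (simp add: deg0_stable_def)
  have Hz: "\<zero>\<^bsub>H\<^esub> \<in> gr H k" for k using H[of k] by (simp add: deg0_stable_def)
  have Hs: "a \<odot>\<^bsub>H\<^esub> y \<in> gr H k" if "a \<in> rgr R 0" "y \<in> gr H k" for a y k
    using H[of k] that by (simp add: deg0_stable_def)
  have Ac: "x \<in> carrier A" if "x \<in> gr A k" for x k using A(2) that by blast
  have rd: "restrict f (carrier A) \<in> gr (hom_gmodule R A H) n" if f: "f \<in> lin_maps_deg R A H n" for f
    using lin_maps_degI[OF lin_maps_restrict[OF A(1) lin_maps_degD(1)[OF f]]] lin_maps_degD(2)[OF f] Ac by simp
  have "\<zero>\<^bsub>hom_gmodule R A H\<^esub> \<in> gr (hom_gmodule R A H) n"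
    using rd[OF lin_maps_degI[OF lin_maps_const_zero[OF Hm] Hz]] by simp
  moreover have "gr (hom_gmodule R A H) n \<subseteq> carrier (hom_gmodule R A H)"
    by (auto simp: lin_maps_deg_def)
  moreover have "a \<odot>\<^bsub>hom_gmodule R A H\<^esub> f \<in> gr (hom_gmodule R A H) n"
    if a: "a \<in> rgr R 0" and f: "f \<in> gr (hom_gmodule R A H) n" for a f
  proof -
    have fl: "f \<in> lin_maps_deg R A H n" using f by simp
    have "(\<lambda>x. a \<odot>\<^bsub>H\<^esub> f x) \<in> lin_maps_deg R A H n"
      by (rule lin_maps_degI[OF lin_maps_smult[OF lin_maps_degD(1)[OF fl] R.rgr_closed[OF a] Hm]])
        (rule Hs[OF a lin_maps_degD(2)[OF fl]])
    from rd[OF this] show ?thesis by simp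
  qed
  ultimately show ?thesis unfolding deg0_stable_def using hom_module[OF A(1) Hm] by blast
qed

text \<open>Two properties of the irrelevant ideal enter: it is homogeneous, and it contains all
  elements of positive degree. The second makes \<open>A\<close> vanish outside degree 0.\<close>

locale augmented_free_complex = free_complex R P d n
  for R :: "'a gring" (structure) and P :: "nat \<Rightarrow> ('a, 'p) gmodule" and d n +
  fixes I :: "'a set" and \<epsilon> :: "'p \<Rightarrow> 'a set" and A :: "('a, 'a set) gmodule"
  assumes I_homogeneous: "homogeneous_ideal I"
    and I_positive: "1 \<le> i \<Longrightarrow> r \<in> rgr R i \<Longrightarrow> r \<in> I"
    and A_def: "A = quot_gmodule (shifted 0) I"
    and \<epsilon>_deg: "\<epsilon> \<in> lin_maps_deg R (P 0) A 0"
    and \<epsilon>_surj: "\<epsilon> ` carrier (P 0) = carrier A"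
    and \<epsilon>_ker: "ker_of (P 0) A \<epsilon> = d 0 ` carrier (P (Suc 0))"
begin

lemma I_submodule: "submodule I R (shifted 0)"
  using I_homogeneous homogeneous_ideal_iff[of I 0] by (simp add: homogeneous_submodule_def)

lemma A_module: "module R A"
  unfolding A_def by (rule quot_module[OF shifted_module I_submodule])

lemmas A_simps = quot_gmodule_simps[OF shifted_module I_submodule, folded A_def]
lemmas \<epsilon>D = lin_mapsD[OF lin_maps_degD(1)[OF \<epsilon>_deg]]

lemma A_gr_closed: "gr A k \<subseteq> carrier A"
  using direct_sum.component_closed[OF graded_moduleD(2)[OF shifted_graded[of 0]]]
  unfolding A_simps(1,3) by blast

lemma \<epsilon>_zero: "\<epsilon> \<zero>\<^bsub>P 0\<^esub> = \<zero>\<^bsub>A\<^esub>"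
  by (rule lin_maps_zero[OF lin_maps_degD(1)[OF \<epsilon>_deg] P_module A_module])

text \<open>\<open>I\<close> annihilates \<open>A\<close>, so the multiple of \<open>x\<close> goes
  to zero under \<open>\<epsilon>\<close> and is a boundary by exactness.\<close>

lemma ideal_mult_boundary:
  assumes "a \<in> I" "x \<in> carrier (P 0)"
  shows "a \<odot>\<^bsub>P 0\<^esub> x \<in> d 0 ` carrier (P (Suc 0))"
proof -
  interpret P0: module R "P 0" by (rule P_module)
  interpret I: ideal I R using I_homogeneous by (simp add: homogeneous_ideal_def)
  have ac: "a \<in> carrier R" by (rule I.Icarr[OF assms(1)])
  obtain r where r: "r \<in> carrier R" "\<epsilon> x = I +>\<^bsub>shifted 0\<^esub> r"
    using \<epsilon>D(1)[OF assms(2)] unfolding A_simps(1) by auto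
  have "\<epsilon> (a \<odot>\<^bsub>P 0\<^esub> x) = I +>\<^bsub>shifted 0\<^esub> (a \<otimes> r)"
    using \<epsilon>D(3)[OF ac assms(2)] A_simps(5)[OF ac, of r] r by simp
  also have "\<dots> = I"
    using coset_zero_iff[OF shifted_module I_submodule, of "a \<otimes> r"] I.I_r_closed[OF assms(1) r(1)] ac r(1) by simp
  finally have "a \<odot>\<^bsub>P 0\<^esub> x \<in> ker_of (P 0) A \<epsilon>"
    using ac assms(2) A_simps(2) by (simp add: ker_of_def)
  then show ?thesis unfolding \<epsilon>_ker .
qed

text \<open>A cocycle on \<open>P 0\<close> vanishes on boundaries, so by
  \<open>ideal_mult_boundary\<close> its values are killed by \<open>I\<close> itself and are
  torsion with exponent 1.\<close>

lemma cocycle_torsion: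
  assumes X: "module R X" and f: "f \<in> cocycles 0 X" and x: "x \<in> carrier (P 0)"
  shows "f x \<in> torsion_set R I X"
proof -
  have fc: "f \<in> cochains 0 X" "\<And>x. x \<in> carrier (P (Suc 0)) \<Longrightarrow> f (d 0 x) = \<zero>\<^bsub>X\<^esub>"
    using f by (simp_all add: cocycles_def)
  have I: "ideal I R" using I_homogeneous by (simp add: homogeneous_ideal_def)
  interpret I: ideal I R by (rule I)
  have "a \<odot>\<^bsub>X\<^esub> f x = \<zero>\<^bsub>X\<^esub>" if "a \<in> I [^]\<^bsub>ideals_set R\<^esub> Suc 0" for a
  proof -
    have a: "a \<in> I"
      using that ideal_prod_inter[OF ideal_pow_ideal[OF I, of 0] I] unfolding ideal_pow_Suc by blast
    have "f (a \<odot>\<^bsub>P 0\<^esub> x) = \<zero>\<^bsub>X\<^esub>" using ideal_mult_boundary[OF a x] fc(2) by auto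
    then show ?thesis using lin_mapsD(3)[OF lin_maps_degD(1)[OF fc(1)] I.Icarr[OF a] x] by simp
  qed
  then show ?thesis unfolding torsion_set_def using cochain_closed[OF fc(1) x] by blast
qed

lemma cocycles_torsion_gmodule:
  assumes "noetherian_ring R" "graded_module R X"
  shows "cocycles 0 (torsion_gmodule R I X) = cocycles 0 X"
proof -
  note T = homogeneous_submoduleD[OF graded_moduleD(1)[OF assms(2)]
      torsion_set_homogeneous[OF assms(1) I_homogeneous assms(2)]]
  show ?thesis
    unfolding torsion_gmodule_eq
    using cocycles_sub[OF T(2)] cocycle_torsion[OF graded_moduleD(1)[OF assms(2)]] by blast
qed

text \<open>\<open>A\<close> is concentrated in degree 0: in other degrees zero is a lift, and in
  degree 0 the degree 0 component of any preimage works, the other components being sent to zero.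
  With this, a map induced on \<open>A\<close> by a cochain is seen to have degree
  \<open>n\<close>.\<close>

lemma \<epsilon>_homogeneous_lift:
  assumes "y \<in> gr A k"
  shows "\<exists>x\<in>gr (P 0) k. \<epsilon> x = y"
proof -
  interpret P0: module R "P 0" by (rule P_module)
  interpret DP: direct_sum "P 0" "gr (P 0)" by (rule P_direct_sum)
  interpret A: module R A by (rule A_module)
  interpret I: ideal I R using I_homogeneous by (simp add: homogeneous_ideal_def)
  have zero: "y = \<zero>\<^bsub>A\<^esub>" if yl: "y \<in> gr A l" "l \<noteq> 0" for y l
  proof -
    obtain r where r: "r \<in> gr (shifted 0) l" "y = I +>\<^bsub>shifted 0\<^esub> r" using yl(1) unfolding A_simps(3) by blast
    have "r \<in> I"
      using r(1) yl(2) I_positive[of "nat l" r] by (cases "l < 0") auto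
    then show ?thesis
      using coset_zero_iff[OF shifted_module I_submodule, of r] r(2) I.Icarr A_simps(2) by simp
  qed
  show ?thesis
  proof (cases "k = 0")
    case False
    then show ?thesis using zero[OF assms False] \<epsilon>_zero DP.component_zero by blast
  next
    case True
    have "y \<in> \<epsilon> ` carrier (P 0)" unfolding \<epsilon>_surj by (rule subsetD[OF A_gr_closed assms])
    then obtain x where x: "x \<in> carrier (P 0)" "\<epsilon> x = y" by auto
    have "\<epsilon> (hc (P 0) 0 x) = \<epsilon> x"
      using x(1)
    proof (induct rule: DP.homogeneous_induct)
      case (homogeneous l x)
      show ?case
      proof (cases "l = 0")
        case True
        then show ?thesis using homogeneous by simp
      next
        case False
        have "\<epsilon> x \<in> gr A l" using lin_maps_degD(2)[OF \<epsilon>_deg homogeneous] by simp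
        from zero[OF this False] show ?thesis
          using DP.hcomp_component[OF homogeneous, of 0] False \<epsilon>_zero by simp
      qed
    next
      case (add x y)
      then show ?case by (simp add: DP.hcomp_add \<epsilon>D(2))
    qed
    then show ?thesis using DP.hcomp_props(1)[OF x(1), of 0] x(2) True by blast
  qed
qed

text \<open>A map from \<open>A\<close> to \<open>Z/B\<close>, composed with
  \<open>\<epsilon>\<close>, lifts to \<open>Z\<close> because \<open>P 0\<close> is free;
  conversely, a cochain that sends boundaries into \<open>B\<close> descends to \<open>A\<close>. By
  \<open>LR\<close> both passages preserve annihilators.\<close>

lemma annihilators_Hom:
  assumes Z: "graded_module R Z" and B: "homogeneous_submodule R Z B"
  shows "annihilators R (hom_gmodule R A (quot_gmodule Z B)) n = Hom_annihilators Z B"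
proof -
  interpret P0: module R "P 0" by (rule P_module)
  interpret DP: direct_sum "P 0" "gr (P 0)" by (rule P_direct_sum)
  interpret A: module R A by (rule A_module)
  interpret Z: module R Z by (rule graded_moduleD[OF Z])
  interpret DZ: direct_sum Z "gr Z" by (rule graded_moduleD[OF Z])
  note Bd = homogeneous_submoduleD[OF Z.module_axioms B]
  let ?H = "quot_gmodule Z B" and ?q = "\<lambda>x. B +>\<^bsub>Z\<^esub> x"
  have H: "module R ?H" by (rule quot_module[OF Z.module_axioms Bd(1)])
  interpret H: module R ?H by (rule H)
  note q = quot_gmodule_simps[OF Z.module_axioms Bd(1)]
  note qm = quot_map[OF Z.module_axioms Bd(1)]
  note qz = coset_zero_iff[OF Z.module_axioms Bd(1)]
  let ?L = "\<lambda>\<phi>. {a \<in> rgr R 0. a \<odot>\<^bsub>hom_gmodule R A ?H\<^esub> \<phi> = \<zero>\<^bsub>hom_gmodule R A ?H\<^esub>}"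
  let ?R = "\<lambda>f. {a \<in> rgr R 0. \<forall>x\<in>carrier (P 0). a \<odot>\<^bsub>Z\<^esub> f x \<in> B}"
  let ?C = "{f \<in> cochains 0 Z. \<forall>x\<in>carrier (P (Suc 0)). f (d 0 x) \<in> B}"
  have LR: "?L \<phi> = ?R f"
    if f: "f \<in> cochains 0 Z" and \<phi>: "\<And>x. x \<in> carrier (P 0) \<Longrightarrow> \<phi> (\<epsilon> x) = ?q (f x)" for \<phi> f
  proof -
    have "a \<odot>\<^bsub>hom_gmodule R A ?H\<^esub> \<phi> = \<zero>\<^bsub>hom_gmodule R A ?H\<^esub> \<longleftrightarrow>
        (\<forall>x\<in>carrier (P 0). a \<odot>\<^bsub>Z\<^esub> f x \<in> B)" if a: "a \<in> rgr R 0" for a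
    proof -
      have ac: "a \<in> carrier R" by (rule rgr_closed[OF a])
      have "a \<odot>\<^bsub>hom_gmodule R A ?H\<^esub> \<phi> = \<zero>\<^bsub>hom_gmodule R A ?H\<^esub> \<longleftrightarrow>
          (\<forall>y\<in>carrier A. a \<odot>\<^bsub>?H\<^esub> \<phi> y = \<zero>\<^bsub>?H\<^esub>)"
        unfolding hom_gmodule_simps restrict_def fun_eq_iff by auto
      also have "\<dots> \<longleftrightarrow> (\<forall>x\<in>carrier (P 0). a \<odot>\<^bsub>?H\<^esub> \<phi> (\<epsilon> x) = \<zero>\<^bsub>?H\<^esub>)"
        unfolding \<epsilon>_surj[symmetric] by simp
      also have "\<dots> \<longleftrightarrow> (\<forall>x\<in>carrier (P 0). a \<odot>\<^bsub>Z\<^esub> f x \<in> B)"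
      proof (rule ball_cong[OF refl])
        fix x assume x: "x \<in> carrier (P 0)"
        have fx: "f x \<in> carrier Z" by (rule cochain_closed[OF f x])
        show "a \<odot>\<^bsub>?H\<^esub> \<phi> (\<epsilon> x) = \<zero>\<^bsub>?H\<^esub> \<longleftrightarrow> a \<odot>\<^bsub>Z\<^esub> f x \<in> B"
          using q(5)[OF ac fx] \<phi>[OF x] q(2) qz[of "a \<odot>\<^bsub>Z\<^esub> f x"] ac fx by simp
      qed
      finally show ?thesis .
    qed
    then show ?thesis by auto
  qed
  have "?L \<phi> \<in> ?R ` ?C" if \<phi>: "\<phi> \<in> gr (hom_gmodule R A ?H) n" for \<phi>
  proof -
    have \<phi>d: "\<phi> \<in> lin_maps_deg R A ?H n" using \<phi> by simp
    note \<phi>l = lin_maps_degD(1)[OF \<phi>d]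
    have comp: "(\<lambda>x. \<phi> (\<epsilon> x)) \<in> lin_maps R (P 0) ?H"
      by (rule lin_maps_comp[OF lin_maps_degD(1)[OF \<epsilon>_deg] \<phi>l])
    from free_module_projective[OF free Z.module_axioms H comp qm] obtain g where
      g: "g \<in> lin_maps R (P 0) Z" "\<And>x. x \<in> carrier (P 0) \<Longrightarrow> ?q (g x) = \<phi> (\<epsilon> x)" by auto
    obtain h where h: "h \<in> cochains 0 Z" "\<forall>l. \<forall>x\<in>gr (P 0) l. h x = hc Z (l + n) (g x)"
      using homogeneous_part[OF g(1) P_graded Z graded] by blast
    \<comment> \<open>The part \<open>h\<close> of degree \<open>n\<close> is still a lift: modulo
      \<open>B\<close>, \<open>g x\<close> equals a homogeneous \<open>z\<close>, and the component
      of degree \<open>l + n\<close> of their difference again lies in \<open>B\<close>.\<close>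
    have hq: "?q (h x) = \<phi> (\<epsilon> x)" if x: "x \<in> carrier (P 0)" for x
    proof (rule lin_maps_eqI[OF P_graded lin_maps_comp[OF lin_maps_degD(1)[OF h(1)] qm(1)] comp _ x])
      fix l x assume x: "x \<in> gr (P 0) l"
      have xc: "x \<in> carrier (P 0)" by (rule DP.component_closed[OF x])
      have gx: "g x \<in> carrier Z" by (rule lin_mapsD(1)[OF g(1) xc])
      have "\<epsilon> x \<in> gr A l" using lin_maps_degD(2)[OF \<epsilon>_deg x] by simp
      then have "\<phi> (\<epsilon> x) \<in> gr ?H (l + n)" by (rule lin_maps_degD(2)[OF \<phi>d])
      then obtain z where z: "z \<in> gr Z (l + n)" "\<phi> (\<epsilon> x) = ?q z" unfolding q(3) by blast
      have zc: "z \<in> carrier Z" by (rule DZ.component_closed[OF z(1)])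
      have b: "g x \<ominus>\<^bsub>Z\<^esub> z \<in> B"
        using coset_eq_iff[OF Z.module_axioms Bd(1) gx zc] g(2)[OF xc] z(2) by simp
      have "hc Z (l + n) (g x \<ominus>\<^bsub>Z\<^esub> z) = h x \<ominus>\<^bsub>Z\<^esub> z"
        using h(2) x gx zc DZ.hcomp_same[OF DZ.component_minus[OF z(1)]]
        by (simp add: a_minus_def DZ.hcomp_add)
      then have "h x \<ominus>\<^bsub>Z\<^esub> z \<in> B" using Bd(7)[OF b, of "l + n"] by simp
      then show "?q (h x) = \<phi> (\<epsilon> x)"
        using coset_eq_iff[OF Z.module_axioms Bd(1) cochain_closed[OF h(1) xc] zc] z(2) by simp
    qed
    have "h (d 0 x) \<in> B" if x: "x \<in> carrier (P (Suc 0))" for x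
    proof -
      have "d 0 x \<in> ker_of (P 0) A \<epsilon>" unfolding \<epsilon>_ker using x by (rule imageI)
      then have "\<epsilon> (d 0 x) = \<zero>\<^bsub>A\<^esub>" by (simp add: ker_of_def)
      then have "?q (h (d 0 x)) = B"
        using hq[OF d_closed[OF x]] lin_maps_zero[OF \<phi>l A_module H] q(2) by simp
      then show ?thesis using qz[OF cochain_closed[OF h(1) d_closed[OF x]]] by simp
    qed
    then have "h \<in> ?C" using h(1) by simp
    then show ?thesis by (rule image_eqI[rotated]) (rule LR[OF h(1) hq[symmetric]])
  qed
  moreover have "?R f \<in> ?L ` gr (hom_gmodule R A ?H) n" if f: "f \<in> ?C" for f
  proof -
    have fc: "f \<in> cochains 0 Z" "\<And>x. x \<in> carrier (P (Suc 0)) \<Longrightarrow> f (d 0 x) \<in> B" using f by simp_all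
    note fd = lin_mapsD[OF lin_maps_degD(1)[OF fc(1)]]
    have wd: "?q (f x) = ?q (f y)" if xy: "x \<in> carrier (P 0)" "y \<in> carrier (P 0)" "\<epsilon> x = \<epsilon> y" for x y
    proof -
      have "\<epsilon> (x \<oplus>\<^bsub>P 0\<^esub> \<ominus>\<^bsub>P 0\<^esub> y) = \<zero>\<^bsub>A\<^esub>"
        using xy lin_maps_minus[OF lin_maps_degD(1)[OF \<epsilon>_deg] P0.module_axioms A_module xy(2)] \<epsilon>D(1)[OF xy(2)]
        by (simp add: \<epsilon>D(2) A.M.r_neg)
      then have "x \<oplus>\<^bsub>P 0\<^esub> \<ominus>\<^bsub>P 0\<^esub> y \<in> d 0 ` carrier (P (Suc 0))"
        unfolding \<epsilon>_ker[symmetric] using xy by (simp add: ker_of_def)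
      then have "f (x \<oplus>\<^bsub>P 0\<^esub> \<ominus>\<^bsub>P 0\<^esub> y) \<in> B" using fc(2) by auto
      moreover have "f (x \<oplus>\<^bsub>P 0\<^esub> \<ominus>\<^bsub>P 0\<^esub> y) = f x \<ominus>\<^bsub>Z\<^esub> f y"
        using xy lin_maps_minus[OF lin_maps_degD(1)[OF fc(1)] P0.module_axioms Z.module_axioms xy(2)]
        by (simp add: fd(2) a_minus_def)
      ultimately show ?thesis using coset_eq_iff[OF Z.module_axioms Bd(1) fd(1)[OF xy(1)] fd(1)[OF xy(2)]] by simp
    qed
    \<comment> \<open>The choice of the preimage under \<open>\<epsilon>\<close> is immaterial: by
      \<open>wd\<close> all preimages give the same coset.\<close>
    define \<phi> where "\<phi> = (\<lambda>y\<in>carrier A. ?q (f (SOME x. x \<in> carrier (P 0) \<and> \<epsilon> x = y)))"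
    have \<phi>\<epsilon>: "\<phi> (\<epsilon> x) = ?q (f x)" if x: "x \<in> carrier (P 0)" for x
    proof -
      let ?x = "SOME x'. x' \<in> carrier (P 0) \<and> \<epsilon> x' = \<epsilon> x"
      have "?x \<in> carrier (P 0) \<and> \<epsilon> ?x = \<epsilon> x" by (rule someI[of _ x]) (use x in simp)
      then show ?thesis using wd[of ?x x] x \<epsilon>D(1)[OF x] by (simp add: \<phi>_def)
    qed
    have lift: "\<exists>x\<in>carrier (P 0). y = \<epsilon> x" if "y \<in> carrier A" for y
      using that \<epsilon>_surj by (metis imageE)
    have qf: "?q (f x) \<in> carrier ?H" if "x \<in> carrier (P 0)" for x
      using lin_mapsD(1)[OF qm(1) fd(1)[OF that]] .
    have "\<phi> \<in> lin_maps R A ?H"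
    proof (rule lin_mapsI)
      fix y assume "y \<in> carrier A"
      then obtain x where x: "x \<in> carrier (P 0)" "y = \<epsilon> x" using lift by blast
      then show "\<phi> y \<in> carrier ?H" using \<phi>\<epsilon> qf by simp
      fix y' assume "y' \<in> carrier A"
      then obtain x' where x': "x' \<in> carrier (P 0)" "y' = \<epsilon> x'" using lift by blast
      show "\<phi> (y \<oplus>\<^bsub>A\<^esub> y') = \<phi> y \<oplus>\<^bsub>?H\<^esub> \<phi> y'"
        using \<phi>\<epsilon>[of "x \<oplus>\<^bsub>P 0\<^esub> x'"] \<phi>\<epsilon>[OF x(1)] \<phi>\<epsilon>[OF x'(1)] x x' q(4)[OF fd(1)[OF x(1)] fd(1)[OF x'(1)]]
        by (simp add: \<epsilon>D(2) fd(2))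
    next
      fix a y assume a: "a \<in> carrier R" and "y \<in> carrier A"
      then obtain x where x: "x \<in> carrier (P 0)" "y = \<epsilon> x" using lift by blast
      show "\<phi> (a \<odot>\<^bsub>A\<^esub> y) = a \<odot>\<^bsub>?H\<^esub> \<phi> y"
        using \<phi>\<epsilon>[of "a \<odot>\<^bsub>P 0\<^esub> x"] \<phi>\<epsilon>[OF x(1)] x a q(5)[OF a fd(1)[OF x(1)]]
        by (simp add: \<epsilon>D(3) fd(3))
    qed
    then have "\<phi> \<in> lin_maps_deg R A ?H n"
    proof (rule lin_maps_degI)
      fix k y assume "y \<in> gr A k"
      then obtain x where x: "x \<in> gr (P 0) k" "\<epsilon> x = y" using \<epsilon>_homogeneous_lift by blast
      have "f x \<in> gr Z (k + n)" by (rule lin_maps_degD(2)[OF fc(1) x(1)])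
      then show "\<phi> y \<in> gr ?H (k + n)"
        using \<phi>\<epsilon>[OF DP.component_closed[OF x(1)]] x(2) unfolding q(3) by blast
    qed
    then have "\<phi> \<in> gr (hom_gmodule R A ?H) n" by (simp add: \<phi>_def)
    then show ?thesis by (rule image_eqI[rotated]) (rule LR[OF fc(1) \<phi>\<epsilon>, symmetric])
  qed
  ultimately show ?thesis unfolding annihilators_def Hom_annihilators_def by blast
qed

end

lemma eventually_uniform:
  fixes Q :: "nat \<Rightarrow> int \<Rightarrow> bool"
  assumes "\<forall>j<s. \<exists>n0. \<forall>n\<le>n0. Q j n"
  shows "\<exists>N. \<forall>j<s. \<forall>n\<le>N. Q j n"
  using assms
proof (induct s)
  case (Suc s)
  then obtain N where N: "\<forall>j<s. \<forall>n\<le>N. Q j n" by auto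
  obtain n0 where n0: "\<forall>n\<le>n0. Q s n" using Suc(2) by blast
  have "\<forall>j<Suc s. \<forall>n\<le>min N n0. Q j n" using N n0 by (auto simp: less_Suc_eq)
  then show ?case by blast
qed simp

section \<open>Assembly of the comparison in one degree\<close>

context augmented_free_complex
begin

lemma exact_at_zero:
  assumes "graded_module R X"
  shows "exact_at i (sub_gmodule X {\<zero>\<^bsub>X\<^esub>})"
  unfolding exact_at_def
proof
  interpret X: module R X by (rule graded_moduleD[OF assms])
  let ?O = "sub_gmodule X {\<zero>\<^bsub>X\<^esub>}"
  have O: "graded_module R ?O" by (rule homogeneous_sub_gmodule(1)[OF assms zero_submodule[OF assms] graded])
  fix f assume "f \<in> cocycles (Suc i) ?O"
  then have "f x = \<zero>\<^bsub>X\<^esub>" if "x \<in> carrier (P (Suc i))" for x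
    using cochain_closed[OF cocycle_cochain that, of f ?O] by simp
  moreover have "(\<lambda>_. \<zero>\<^bsub>?O\<^esub>) \<in> cochains i ?O"
    by (rule lin_maps_degI[OF lin_maps_const_zero[OF graded_moduleD(1)[OF O]]])
      (rule direct_sum.component_zero[OF graded_moduleD(2)[OF O]])
  ultimately show "\<exists>g\<in>cochains i ?O. \<forall>x\<in>carrier (P (Suc i)). f x = g (d i x)"
    by (intro bexI[of _ "\<lambda>_. \<zero>\<^bsub>?O\<^esub>"]) simp_all
qed

text \<open>The two families of hypotheses act independently: \<open>van2\<close> propagates to the
  vanishing of Ext^1 for \<open>B s\<close>, and \<open>van1\<close> to that for
  \<open>Z (s - 1)\<close>. These are the inputs \<open>exB\<close> and \<open>exK\<close> of
  \<open>Hom_annihilators_compare\<close>.\<close>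

lemma annihilators_Ext_eq_Hom:
  fixes M :: "('a, 'm) gmodule" and E :: "nat \<Rightarrow> ('a, 'e) gmodule"
  assumes noeth: "noetherian_ring R" and M: "graded_module R M"
    and res: "graded_injective_resolution R M E \<delta> \<iota>"
    and van1: "\<And>j. j < s \<Longrightarrow> gr (Ext_gmodule R P d (s - j) (local_cohomology R I E \<delta> j)) n =
      {\<zero>\<^bsub>Ext_gmodule R P d (s - j) (local_cohomology R I E \<delta> j)\<^esub>}"
    and van2: "\<And>j. j < s \<Longrightarrow> gr (Ext_gmodule R P d (s - j + 1) (local_cohomology R I E \<delta> j)) n =
      {\<zero>\<^bsub>Ext_gmodule R P d (s - j + 1) (local_cohomology R I E \<delta> j)\<^esub>}"
  shows "annihilators R (Ext_gmodule R P d s M) n =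
      annihilators R (hom_gmodule R A (local_cohomology R I E \<delta> s)) n"
    and "deg0_stable R (hom_gmodule R A (local_cohomology R I E \<delta> s)) m"
proof -
  have inj: "graded_injective R (E j)" for j
    using res by (simp add: graded_injective_resolution_def)
  have Eg: "graded_module R (E j)" for j using inj by (simp add: graded_injective_def)
  have Eb: "graded_baer (E j)" for j by (rule graded_injective_imp_baer[OF inj])
  have Ex: "exact_at i (E j)" for i j by (rule graded_baer_exact[OF Eg Eb])
  have \<delta>E: "\<delta> j \<in> lin_maps_deg R (E j) (E (Suc j)) 0" for j
    using res by (simp add: graded_injective_resolution_def)
  have \<iota>: "\<iota> \<in> lin_maps_deg R M (E 0) 0" "inj_on \<iota> (carrier M)"
    and K0: "ker_of (E 0) (E (Suc 0)) (\<delta> 0) = \<iota> ` carrier M"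
    and KS: "ker_of (E (Suc j)) (E (Suc (Suc j))) (\<delta> (Suc j)) = \<delta> j ` carrier (E j)" for j
    using res by (simp_all add: graded_injective_resolution_def)
  define K where "K j = sub_gmodule (E j) (ker_of (E j) (E (Suc j)) (\<delta> j))" for j
  define T where "T j = torsion_gmodule R I (E j)" for j
  have Th: "homogeneous_submodule R (E j) (torsion_set R I (E j))" for j
    by (rule torsion_set_homogeneous[OF noeth I_homogeneous Eg])
  have T_eq: "T j = sub_gmodule (E j) (torsion_set R I (E j))" for j
    by (simp add: T_def torsion_gmodule_eq)
  have Tg: "graded_module R (T j)" for j
    unfolding T_eq by (rule homogeneous_sub_gmodule(1)[OF Eg Th graded])
  have Tx: "exact_at i (T j)" for i j
    using graded_baer_exact[OF Tg[of j, unfolded T_def] torsion_graded_baer[OF noeth I_homogeneous Eg Eb]]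
    by (simp add: T_def)
  have Tc: "x \<in> carrier (E j)" if "x \<in> carrier (T j)" for x j
    using that unfolding T_eq torsion_set_def by simp
  have T0: "\<zero>\<^bsub>T j\<^esub> = \<zero>\<^bsub>E j\<^esub>" for j by (simp add: T_eq)
  have Ii: "ideal I R" using I_homogeneous by (simp add: homogeneous_ideal_def)
  have \<delta>tor: "\<delta> j x \<in> torsion_set R I (E (Suc j))" if x: "x \<in> torsion_set R I (E j)" for j x
  proof -
    note \<delta>d = lin_mapsD[OF lin_maps_degD(1)[OF \<delta>E[of j]]]
    note \<delta>0 = lin_maps_zero[OF lin_maps_degD(1)[OF \<delta>E[of j]] graded_moduleD(1)[OF Eg] graded_moduleD(1)[OF Eg]]
    obtain k where xc: "x \<in> carrier (E j)"
      and k: "\<forall>a\<in>I [^]\<^bsub>ideals_set R\<^esub> (k::nat). a \<odot>\<^bsub>E j\<^esub> x = \<zero>\<^bsub>E j\<^esub>"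
      using x unfolding torsion_set_def by blast
    have "a \<odot>\<^bsub>E (Suc j)\<^esub> \<delta> j x = \<zero>\<^bsub>E (Suc j)\<^esub>" if a: "a \<in> I [^]\<^bsub>ideals_set R\<^esub> k" for a
    proof -
      have "a \<in> carrier R" by (rule additive_subgroup.a_Hcarr[OF ideal.axioms(1)[OF ideal_pow_ideal[OF Ii]] a])
      then show ?thesis using \<delta>d(3)[of a x] xc k a \<delta>0 by simp
    qed
    then show ?thesis unfolding torsion_set_def using \<delta>d(1)[OF xc] by blast
  qed
  have \<delta>T: "\<delta> j \<in> lin_maps_deg R (T j) (T (Suc j)) 0" for j
  proof -
    note sc = homogeneous_submoduleD(2)[OF graded_moduleD(1)[OF Eg] Th]
    have "\<delta> j \<in> lin_maps_deg R (T j) (E (Suc j)) 0"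
      unfolding T_eq by (rule lin_maps_deg_sub[OF \<delta>E sc])
    then show ?thesis
      unfolding T_eq[of "Suc j"] lin_maps_deg_into_sub[OF graded_moduleD(2)[OF Tg] sc]
      using \<delta>tor by (simp add: T_eq)
  qed
  define KT where "KT j = ker_of (T j) (T (Suc j)) (\<delta> j)" for j
  define Z where "Z j = sub_gmodule (T j) (KT j)" for j
  define B where "B j = (case j of 0 \<Rightarrow> {\<zero>\<^bsub>T 0\<^esub>} | Suc k \<Rightarrow> \<delta> k ` carrier (T k))" for j
  have lc: "local_cohomology R I E \<delta> j = quot_gmodule (Z j) (B j)" for j
    unfolding local_cohomology_def cohomology_def Z_def KT_def B_def T_def by (rule refl)
  have KTh: "homogeneous_submodule R (T j) (KT j)" for j
    unfolding KT_def by (rule ker_of_homogeneous[OF Tg Tg \<delta>T])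
  have Zg: "graded_module R (Z j)" for j
    unfolding Z_def by (rule homogeneous_sub_gmodule(1)[OF Tg KTh graded])
  have Bh: "homogeneous_submodule R (T j) (B j)" for j
    using zero_submodule[OF Tg] image_homogeneous[OF Tg Tg \<delta>T] by (cases j) (simp_all add: B_def)
  have BK: "B j \<subseteq> KT j" for j
  proof (cases j)
    case 0
    then show ?thesis
      using homogeneous_submoduleD(3)[OF graded_moduleD(1)[OF Tg] KTh[of 0]] by (simp add: B_def)
  next
    case (Suc k)
    have "\<delta> k x \<in> KT (Suc k)" if x: "x \<in> carrier (T k)" for x
    proof -
      have "\<delta> k x \<in> ker_of (E (Suc k)) (E (Suc (Suc k))) (\<delta> (Suc k))"
        unfolding KS using Tc[OF x] by (rule imageI)
      then show ?thesis
        using lin_mapsD(1)[OF lin_maps_degD(1)[OF \<delta>T] x] by (simp add: KT_def ker_of_def T0)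
    qed
    then show ?thesis using Suc by (auto simp: B_def)
  qed
  have BZ: "homogeneous_submodule R (Z j) (B j)" for j
    unfolding Z_def by (rule homogeneous_submodule_sub[OF Tg graded KTh Bh BK])
  have subB: "sub_gmodule (Z j) (B j) = sub_gmodule (T j) (B j)" for j
    unfolding Z_def by (rule sub_sub_gmodule[OF BK])
  have ext: "exact_at i (Z j)" if "exact_mod i (Z j) (B j)" "exact_at i (sub_gmodule (T j) (B j))" for i j
    by (rule exact_extension[OF Zg BZ _ that(1)]) (use that(2) in \<open>simp add: subB\<close>)
  \<comment> \<open>Passing from \<open>j\<close> to \<open>j + 1\<close> lowers the Ext index by
    one, so the sum of the two indices is constant; \<open>a\<close> and \<open>b\<close> each
    follow such a diagonal.\<close>
  have shift: "exact_at i (sub_gmodule (T (Suc j)) (B (Suc j)))" if "exact_at (Suc i) (Z j)" for i j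
    using exact_at_image[OF Tg Tg \<delta>T that[unfolded Z_def KT_def] Tx] by (simp add: B_def)
  have ex0: "exact_at i (sub_gmodule (T 0) (B 0))" for i
    using exact_at_zero[OF Tg] by (simp add: B_def)
  \<comment> \<open>\<open>exact_mod i\<close> concerns Ext of index \<open>i + 1\<close>. This is
    \<open>s - j\<close> here and \<open>s - j + 1\<close> in \<open>m2\<close>.\<close>
  have m1: "exact_mod i (Z j) (B j)" if "i + j + 1 = s" for i j
    using exact_mod_of_Ext_zero[OF Zg BZ, of i j] van1[of j] that by (auto simp: lc)
  have m2: "exact_mod i (Z j) (B j)" if "i + j = s" "j < s" for i j
    using exact_mod_of_Ext_zero[OF Zg BZ, of i j] van2[of j] that by (auto simp: lc)
  \<comment> \<open>Of interest at \<open>i = 0\<close> and \<open>j = s\<close>: Ext^1 vanishes for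
    \<open>B s\<close>.\<close>
  have a: "exact_at i (sub_gmodule (T j) (B j))" if "i + j = s" for i j
    using that
  proof (induct j arbitrary: i)
    case 0
    show ?case by (rule ex0)
  next
    case (Suc j)
    show ?case by (rule shift[OF ext[OF m2 Suc(1)]]) (use Suc(2) in simp_all)
  qed
  \<comment> \<open>Of interest at \<open>i = 0\<close> and \<open>j = s - 1\<close>, where together
    with \<open>m1\<close> it gives the vanishing of Ext^1 for \<open>Z (s - 1)\<close>.\<close>
  have b: "exact_at i (sub_gmodule (T j) (B j))" if "i + j + 1 = s" for i j
    using that
  proof (induct j arbitrary: i)
    case 0
    show ?case by (rule ex0)
  next
    case (Suc j)
    show ?case by (rule shift[OF ext[OF m1 Suc(1)]]) (use Suc(2) in simp_all)
  qed
  \<comment> \<open>Dimension shifting along \<open>E\<close>: by exactness the image of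
    \<open>\<delta> j\<close> is \<open>K (Suc j)\<close>, so each use of the connecting
    correspondence lowers the index by one and raises \<open>j\<close> by one.\<close>
  have chain: "Ext_annihilators i (K j) = Ext_annihilators 0 (K (j + i))" for i j
  proof (induct i arbitrary: j)
    case (Suc i)
    have "Ext_annihilators (Suc i) (K j) = image_annihilators (Suc i) (E j) (E (Suc j)) (\<delta> j)"
      unfolding K_def by (rule Ext_annihilators_kernel[OF Eg Eg \<delta>E Ex])
    also have "\<dots> = Ext_annihilators i (sub_gmodule (E (Suc j)) (\<delta> j ` carrier (E j)))"
      by (rule Ext_annihilators_image[OF Eg Eg \<delta>E Ex, symmetric])
    also have "\<dots> = Ext_annihilators i (K (Suc j))" by (simp add: K_def KS)
    also have "\<dots> = Ext_annihilators 0 (K (j + Suc i))" using Suc[of "Suc j"] by simp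
    finally show ?case .
  qed simp
  have cT: "cocycles 0 (T j) = cocycles 0 (E j)" for j
    unfolding T_def by (rule cocycles_torsion_gmodule[OF noeth Eg])
  \<comment> \<open>The values of a cocycle on \<open>P 0\<close> are torsion, and on torsion
    elements lying in the kernel of \<open>\<delta> j\<close> means the same in \<open>T j\<close>
    and in \<open>E j\<close>.\<close>
  have cZ: "cocycles 0 (Z j) = cocycles 0 (K j)" for j
  proof -
    note kE = homogeneous_submoduleD(2)[OF graded_moduleD(1)[OF Eg] ker_of_homogeneous[OF Eg Eg \<delta>E]]
    note kT = homogeneous_submoduleD(2)[OF graded_moduleD(1)[OF Tg] KTh]
    have "f x \<in> KT j \<longleftrightarrow> f x \<in> ker_of (E j) (E (Suc j)) (\<delta> j)"
      if f: "f \<in> cocycles 0 (T j)" and x: "x \<in> carrier (P 0)" for f x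
    proof -
      have "f x \<in> carrier (T j)" by (rule cochain_closed[OF cocycle_cochain[OF f] x])
      then show ?thesis using Tc by (simp add: KT_def ker_of_def T0)
    qed
    then show ?thesis
      unfolding Z_def K_def set_eq_iff cocycles_sub[OF kE] cocycles_sub[OF kT] cT[symmetric] by blast
  qed
  have "annihilators R (Ext_gmodule R P d s M) n = Hom_annihilators (Z s) (B s)"
  proof (cases s)
    case 0
    have "Ext0_annihilators M = Ext0_annihilators (K 0)"
      unfolding K_def K0 by (rule Ext_annihilators_inj(2)[OF M Eg \<iota>])
    also have "\<dots> = Ext0_annihilators (Z 0)"
      unfolding Ext0_annihilators_def cZ by (simp add: K_def Z_def T_eq)
    also have "\<dots> = Hom_annihilators (Z 0) (B 0)"
      unfolding Hom_annihilators_zero[symmetric] by (simp add: B_def Z_def)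
    finally show ?thesis using annihilators_Ext[OF M, of s] 0 by simp
  next
    case (Suc k)
    have "annihilators R (Ext_gmodule R P d s M) n = Ext_annihilators k M"
      using annihilators_Ext[OF M, of s] Suc by simp
    also have "\<dots> = Ext_annihilators k (K 0)"
      unfolding K_def K0 by (rule Ext_annihilators_inj(1)[OF M Eg \<iota>])
    also have "\<dots> = Ext_annihilators 0 (K k)" using chain[of k 0] by simp
    also have "\<dots> = image_annihilators 0 (E k) (E (Suc k)) (\<delta> k)"
      unfolding K_def by (rule Ext_annihilators_kernel[OF Eg Eg \<delta>E Ex])
    \<comment> \<open>By \<open>cT\<close> and \<open>cZ\<close>, cocycles with values in
      \<open>E\<close> may be replaced by torsion-valued ones; here the computation passes from the
      resolution to the complex that defines local cohomology.\<close>
    also have "\<dots> = (\<lambda>f. {a \<in> rgr R 0. \<exists>g\<in>cocycles 0 (T k). \<forall>x\<in>carrier (P 0). a \<odot>\<^bsub>T (Suc k)\<^esub> f x = \<delta> k (g x)}) `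
        cocycles 0 (Z (Suc k))"
      unfolding image_annihilators_def cT cZ unfolding K_def KS by (simp add: T_eq)
    also have "\<dots> = Hom_annihilators (Z (Suc k)) (B (Suc k))"
    proof -
      have "exact_at 0 (sub_gmodule (T (Suc k)) (\<delta> k ` carrier (T k)))"
        using a[of 0 "Suc k"] Suc by (simp add: B_def)
      moreover have "exact_at 0 (sub_gmodule (T k) (ker_of (T k) (T (Suc k)) (\<delta> k)))"
        using ext[OF m1[of 0 k] b[of 0 k]] Suc by (simp add: Z_def KT_def)
      ultimately show ?thesis
        using Hom_annihilators_compare[OF Tg Tg \<delta>T KTh, of k] BK[of "Suc k"]
        by (simp add: B_def Z_def)
    qed
    finally show ?thesis using Suc by simp
  qed
  also have "\<dots> = annihilators R (hom_gmodule R A (local_cohomology R I E \<delta> s)) n"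
    unfolding lc by (rule annihilators_Hom[OF Zg BZ, symmetric])
  finally show "annihilators R (Ext_gmodule R P d s M) n =
      annihilators R (hom_gmodule R A (local_cohomology R I E \<delta> s)) n" .
  show "deg0_stable R (hom_gmodule R A (local_cohomology R I E \<delta> s)) m"
    unfolding lc by (rule hom_deg0_stable[OF A_module A_gr_closed quot_deg0_stable[OF graded Zg BZ] graded])
qed

end

theorem theorem4p4:
  fixes R :: "'a gring"
    and M :: "('a, 'm) gmodule"
    and P :: "nat \<Rightarrow> ('a, 'p) gmodule" and d :: "nat \<Rightarrow> 'p \<Rightarrow> 'p" and \<epsilon> :: "'p \<Rightarrow> 'a set"
    and E :: "nat \<Rightarrow> ('a, 'e) gmodule" and \<delta> :: "nat \<Rightarrow> 'e \<Rightarrow> 'e" and \<iota> :: "'m \<Rightarrow> 'e"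
    and s :: nat
  defines "Rplus \<equiv> irrelevant_ideal R"
  defines "A \<equiv> quot_gmodule (regular_gmodule R) Rplus"
  defines "H \<equiv> local_cohomology R Rplus E \<delta>"
  assumes "homogeneous_ring R" and "noetherian_ring R"
    and "graded_module R M"
    and "graded_free_resolution R A P d \<epsilon>"
    and "graded_injective_resolution R M E \<delta> \<iota>"
    and "\<forall>j<s. asymptotically_zero (Ext_gmodule R P d (s - j) (H j))"
    and "\<forall>j<s. asymptotically_zero (Ext_gmodule R P d (s - j + 1) (H j))"
  shows "(asymptotic_stability_Ass R (Ext_gmodule R P d s M) \<longleftrightarrow>
            asymptotic_stability_Ass R (hom_gmodule R A (H s))) \<and>
         (asymptotic_stability_Supp R (Ext_gmodule R P d s M) \<longleftrightarrow>
            asymptotic_stability_Supp R (hom_gmodule R A (H s))) \<and>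
         (tame (Ext_gmodule R P d s M) \<longleftrightarrow> tame (hom_gmodule R A (H s)))"
proof -
  have gR: "graded_ring R" using assms(4) by (simp add: homogeneous_ring_def)
  interpret R: graded_cring R by (rule graded_cringI[OF gR])
  \<comment> \<open>No locale assumption mentions the degree, so the locale predicate has no
    argument for it, and \<open>comp\<close> serves all degrees at once.\<close>
  have comp: "augmented_free_complex R P d Rplus \<epsilon> A"
  proof (intro augmented_free_complex.intro free_complex.intro R.graded_cring_axioms
      free_complex_axioms.intro augmented_free_complex_axioms.intro)
    show "R.homogeneous_ideal Rplus" unfolding Rplus_def by (rule R.irrelevant_ideal_homogeneous)
    show "r \<in> Rplus" if "1 \<le> i" "r \<in> rgr R i" for i r
      unfolding Rplus_def using that by (rule R.positive_degree_irrelevant)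
    show "A = quot_gmodule (R.shifted 0) Rplus" unfolding A_def R.regular_eq_shifted ..
  qed (use assms(7) in \<open>simp_all add: graded_free_resolution_def\<close>)
  \<comment> \<open>Only finitely many \<open>j\<close> occur, so one bound works for all of
    them.\<close>
  obtain N1 where N1: "\<forall>j<s. \<forall>n\<le>N1. gr (Ext_gmodule R P d (s - j) (H j)) n = {\<zero>\<^bsub>Ext_gmodule R P d (s - j) (H j)\<^esub>}"
    using eventually_uniform[OF assms(9)[unfolded asymptotically_zero_def]] by blast
  obtain N2 where N2: "\<forall>j<s. \<forall>n\<le>N2. gr (Ext_gmodule R P d (s - j + 1) (H j)) n = {\<zero>\<^bsub>Ext_gmodule R P d (s - j + 1) (H j)\<^esub>}"
    using eventually_uniform[OF assms(10)[unfolded asymptotically_zero_def]] by blast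
  show ?thesis
  proof (rule R.asymptotic_properties_cong[where N = "min N1 N2"])
    fix n assume n: "n \<le> min N1 N2"
    show "annihilators R (Ext_gmodule R P d s M) n = annihilators R (hom_gmodule R A (H s)) n"
      unfolding H_def
      by (rule augmented_free_complex.annihilators_Ext_eq_Hom(1)[OF comp assms(5,6,8)])
        (use N1 N2 n in \<open>simp_all add: H_def\<close>)
  next
    fix n
    show "deg0_stable R (Ext_gmodule R P d s M) n"
      by (rule free_complex.Ext_deg0_stable[OF augmented_free_complex.axioms(1)[OF comp] assms(6)])
    \<comment> \<open>Stability is required in every degree, while the cited lemma assumes vanishing
      in its own degree; as its second conclusion has a separate degree, the single value
      \<open>min N1 N2\<close> is enough.\<close>
    show "deg0_stable R (hom_gmodule R A (H s)) n"
      unfolding H_def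
      by (rule augmented_free_complex.annihilators_Ext_eq_Hom(2)[OF comp assms(5,6,8), where n = "min N1 N2"])
        (use N1 N2 in \<open>simp_all add: H_def\<close>)
  qed
qed

end
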